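(* Let $d\geq 2$ and let $r,S$ be real numbers with $\frac12<r<\min\left(\frac d2,\,S-\frac12\right)$. Define $$p_0=\frac{d-2r+2(S-r)(d-1)}{-\left((S-r)-\frac12\right)(d-2r)+2(S-r)(d-1)}.$$ Then $p_0<2$, and for every $p$ with $$p\in\left(p_0,\tfrac{2d}{d-2(S-r)}\right]\ \text{ if } S-r<\tfrac d2,\qquad p\in(p_0,\infty)\ \text{ if } S-r\geq \tfrac d2,$$ there is a constant $C_{rad,+}(r,S,p,d)<\infty$ such that $$\|D^r\varphi\|_{L^p(\mathbb{R}^d)}\leq C_{rad,+}(r,S,p,d)\,\|\varphi\|_{L^2(\mathbb{R}^d)}^{1-\theta}\,\|D^S\varphi\|_{L^2(\mathbb{R}^d)}^{\theta}\qquad\text{for all }\varphi\in H^{S,r}_{rad,+}(\mathbb{R}^d),$$ where $\theta$ is determined by $\frac1p=\frac12+\frac{r-\theta S}{d}$.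
   Context: For $s\in\mathbb{R}$, $D^s$ denotes the Fourier multiplier $\widehat{D^s\varphi}(\xi)=|\xi|^s\widehat\varphi(\xi)$, with $\widehat\varphi(\xi)=\int_{\mathbb{R}^d}e^{-2\pi i x\cdot\xi}\varphi(x)\,dx$. $H^S(\mathbb{R}^d)$ is the usual inhomogeneous $L^2$-Sobolev space. $H^S_{rad}(\mathbb{R}^d)$ is the set of radially symmetric functions $\varphi(x)=\varphi(|x|)$ in $H^S(\mathbb{R}^d)$, and $H^{S,r}_{rad,+}(\mathbb{R}^d)=\{\varphi\in H^S_{rad}(\mathbb{R}^d):\ D^r\varphi\geq 0 \text{ a.e.}\}$. *)

theory Defs
  imports "HOL-Analysis.Analysis"
begin

text \<open>Functions on R^d are modelled as complex-valued functions on real^'n, d = CARD('n),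
  with Lebesgue measure lborel.\<close>

definition sq_int :: "('a::euclidean_space \<Rightarrow> complex) \<Rightarrow> bool" where
  "sq_int f \<longleftrightarrow> f \<in> borel_measurable lborel \<and> integrable lborel (\<lambda>x. (cmod (f x))\<^sup>2)"

definition L2norm :: "('a::euclidean_space \<Rightarrow> complex) \<Rightarrow> real" where
  "L2norm f = sqrt (integral\<^sup>L lborel (\<lambda>x. (cmod (f x))\<^sup>2))"

definition Lpnorm :: "real \<Rightarrow> ('a::euclidean_space \<Rightarrow> complex) \<Rightarrow> real" where
  "Lpnorm p f = (integral\<^sup>L lborel (\<lambda>x. cmod (f x) powr p)) powr (1 / p)"

definition fourier_L1 :: "('a::euclidean_space \<Rightarrow> complex) \<Rightarrow> 'a \<Rightarrow> complex" where
  "fourier_L1 g \<xi> = integral\<^sup>L lborel (\<lambda>x. exp (- (2 * pi * \<i> * complex_of_real (x \<bullet> \<xi>))) * g x)"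

text \<open>Plancherel (L^2) Fourier transform: psi is the L^2-Fourier transform of phi
  (characterised, uniquely up to null sets, by the multiplication formula against L^1 \<inter> L^2).\<close>
definition fourier_L2 :: "('a::euclidean_space \<Rightarrow> complex) \<Rightarrow> ('a \<Rightarrow> complex) \<Rightarrow> bool" where
  "fourier_L2 \<phi> \<psi> \<longleftrightarrow> sq_int \<phi> \<and> sq_int \<psi> \<and>
     (\<forall>g. g \<in> borel_measurable lborel \<and> integrable lborel g \<and> sq_int g \<longrightarrow>
        integral\<^sup>L lborel (\<lambda>\<xi>. \<psi> \<xi> * g \<xi>) = integral\<^sup>L lborel (\<lambda>x. \<phi> x * fourier_L1 g x))"

definition is_Dpow :: "real \<Rightarrow> ('a::euclidean_space \<Rightarrow> complex) \<Rightarrow> ('a \<Rightarrow> complex) \<Rightarrow> bool" where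
  "is_Dpow s \<phi> u \<longleftrightarrow> (\<exists>\<psi>. fourier_L2 \<phi> \<psi> \<and> fourier_L2 u (\<lambda>\<xi>. complex_of_real (norm \<xi> powr s) * \<psi> \<xi>))"

definition in_H :: "real \<Rightarrow> ('a::euclidean_space \<Rightarrow> complex) \<Rightarrow> bool" where
  "in_H S \<phi> \<longleftrightarrow> (\<exists>\<psi>. fourier_L2 \<phi> \<psi> \<and>
      sq_int (\<lambda>\<xi>. complex_of_real ((1 + (norm \<xi>)\<^sup>2) powr (S / 2)) * \<psi> \<xi>))"

definition radial :: "('a::euclidean_space \<Rightarrow> complex) \<Rightarrow> bool" where
  "radial \<phi> \<longleftrightarrow> (\<forall>x y. norm x = norm y \<longrightarrow> \<phi> x = \<phi> y)"

definition in_H_rad_plus :: "real \<Rightarrow> real \<Rightarrow> ('a::euclidean_space \<Rightarrow> complex) \<Rightarrow> bool" where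
  "in_H_rad_plus S r \<phi> \<longleftrightarrow> in_H S \<phi> \<and> radial \<phi> \<and>
     (\<forall>u. is_Dpow r \<phi> u \<longrightarrow> (AE x in lborel. Im (u x) = 0 \<and> Re (u x) \<ge> 0))"

end

theory Submission
  imports Defs "HOL-Probability.Probability"
begin

text \<open>
  By homogeneity everything is measured in the length \<open>L\<close> with \<open>\<parallel>\<phi>\<parallel> = L\<^sup>S \<parallel>D\<^sup>S \<phi>\<parallel>\<close>. For \<open>p \<ge> 2\<close> the
  estimate is the Sobolev embedding combined with interpolation on the Fourier side. For \<open>p < 2\<close> let \<open>u = D\<^sup>r \<phi> \<ge> 0\<close>, \<open>s = S - r\<close>. Testing \<open>u\<close> against
  Gaussians bounds the integral of \<open>u\<close> over the ball of radius \<open>R\<close> by a multiple of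
  \<open>R\<^bsup>d/2 - r\<^esup> \<parallel>\<phi>\<parallel>\<close>; by radial symmetry a ball of radius \<open>h \<le> R\<close> at distance \<open>R\<close> from the origin
  carries only the fraction \<open>(h/R)\<^bsup>d - 1\<^esup>\<close> of this mass. Since \<open>u \<ge> 0\<close>, the square of \<open>u\<close> is
  controlled by the square of a finite difference of \<open>u\<close> of step \<open>z\<close> plus products \<open>u(x) u(x + j z)\<close>.
  Averaging over \<open>z\<close> in the ball of radius \<open>h\<close> bounds the integral of \<open>u\<^sup>2\<close> over the annulus
  of radius \<open>R\<close> by \<open>h\<^bsup>2 s\<^esup> \<parallel>D\<^sup>S \<phi>\<parallel>\<^sup>2 + h\<^sup>-\<^sup>1 R\<^bsup>1 - 2 r\<^esup> \<parallel>\<phi>\<parallel>\<^sup>2\<close>. Optimising \<open>h\<close>,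
  interpolating between the first and second moments of \<open>u\<close> on each dyadic annulus and summing gives a
  geometric series that converges exactly for \<open>p > p\<^sub>0\<close>.
\<close>

text \<open>Regularity controls only differences of \<open>u\<close>; the sign supplies the missing
  information. Because \<open>u\<close> is nonnegative, its pairing with a Gaussian is already a
  local L^1 bound in terms of \<open>\<phi>\<close> alone, and the cross terms of a squared
  difference can be bounded by masses of small balls. Write m = d/2 - r and \<kappa> = (2r - 1)/(2s
  + 1). At radius \<rho> L, with \<rho> at least 1, the balanced step h is of order L
  \<rho>^(-\<kappa>); the first moment is then bounded by a multiple of \<rho>^m, and the second by
  a multiple of \<rho>^(-2 s \<kappa>), a decay that comes from r > 1/2. Interpolation leaves the
  power m (2 - p) - 2 s \<kappa> (p - 1) of \<rho>, which is negative iff p > p0: clearing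
  denominators produces the fraction that defines p0. Since the L^2 Fourier transform is
  characterised by duality, \<open>D^r \<phi>\<close> is fixed up to null sets only. This is why
  Plancherel and uniqueness have to be available for that characterisation, and why every symmetry
  of \<open>u\<close> is stated almost everywhere.\<close>

abbreviation nn_integral_lborel :: "('a::euclidean_space \<Rightarrow> ennreal) \<Rightarrow> ennreal" (binder "NNINT " 10) where
  "nn_integral_lborel \<equiv> nn_integral lborel"

lemmas LBINT_cong = Bochner_Integration.integral_cong
lemmas integrable_dominated = Bochner_Integration.integrable_bound

lemma ball_in_borel [measurable]: "ball (x::'a::metric_space) r \<in> sets borel"
  by simp

section \<open>Affine and orthogonal changes of variables for Lebesgue measure\<close>

lemma nn_integral_lborel_affine:
  fixes t :: "'a::euclidean_space"
  assumes [measurable]: "f \<in> borel_measurable borel" and c: "c \<noteq> 0"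
  shows "(NNINT x. f x) = ennreal (\<bar>c\<bar> ^ DIM('a)) * (NNINT x. f (t + c *\<^sub>R x))"
  by (subst lborel_affine[OF c, of t])
     (simp add: nn_integral_density nn_integral_distr nn_integral_cmult)

lemma nn_integral_lborel_translate:
  fixes a :: "'a::euclidean_space"
  assumes "f \<in> borel_measurable borel"
  shows "(NNINT x. f (x + a)) = (NNINT x. f x)"
  using nn_integral_lborel_affine[OF assms, of 1 a] by (simp add: add.commute)

lemma nn_integral_lborel_reflect:
  fixes a :: "'a::euclidean_space"
  assumes "f \<in> borel_measurable borel"
  shows "(NNINT x. f (a - x)) = (NNINT x. f x)"
  using nn_integral_lborel_affine[OF assms, of "-1" a] by simp

lemma integral_lborel_affine:
  fixes t :: "'a::euclidean_space" and f :: "'a \<Rightarrow> 'b::{banach,second_countable_topology}"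
  assumes [measurable]: "f \<in> borel_measurable borel" and c: "c \<noteq> 0"
  shows "(LBINT x. f x) = (\<bar>c\<bar> ^ DIM('a)) *\<^sub>R (LBINT x. f (t + c *\<^sub>R x))"
  by (subst lborel_affine[OF c, of t])
     (simp add: integral_density integral_distr)

lemma integrable_lborel_affine:
  fixes t :: "'a::euclidean_space" and f :: "'a \<Rightarrow> 'b::{banach,second_countable_topology}"
  assumes [measurable]: "f \<in> borel_measurable borel" and c: "c \<noteq> 0"
  shows "integrable lborel (\<lambda>x. f (t + c *\<^sub>R x)) \<longleftrightarrow> integrable lborel f"
proof -
  have "integrable lborel f \<longleftrightarrow> integrable lborel (\<lambda>x. (\<bar>c\<bar> ^ DIM('a)) *\<^sub>R f (t + c *\<^sub>R x))"
    by (subst lborel_affine[OF c, of t])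
       (simp add: integrable_density integrable_distr_eq)
  moreover have "integrable lborel (\<lambda>x. f (t + c *\<^sub>R x))"
    if "integrable lborel (\<lambda>x. (\<bar>c\<bar> ^ DIM('a)) *\<^sub>R f (t + c *\<^sub>R x))"
    using integrable_scaleR_right[OF that, of "1 / \<bar>c\<bar> ^ DIM('a)"] c by simp
  ultimately show ?thesis using integrable_scaleR_right by blast
qed

lemma integral_lborel_translate:
  fixes a :: "'a::euclidean_space" and f :: "'a \<Rightarrow> 'b::{banach,second_countable_topology}"
  assumes "f \<in> borel_measurable borel"
  shows "(LBINT x. f (x + a)) = (LBINT x. f x)"
  using integral_lborel_affine[OF assms, of 1 a] by (simp add: add.commute)

lemma integral_lborel_reflect:
  fixes a :: "'a::euclidean_space" and f :: "'a \<Rightarrow> 'b::{banach,second_countable_topology}"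
  assumes "f \<in> borel_measurable borel"
  shows "(LBINT x. f (a - x)) = (LBINT x. f x)"
  using integral_lborel_affine[OF assms, of "-1" a] by simp

lemma integrable_lborel_translate:
  fixes a :: "'a::euclidean_space" and f :: "'a \<Rightarrow> 'b::{banach,second_countable_topology}"
  assumes "integrable lborel f"
  shows "integrable lborel (\<lambda>x. f (x + a))"
  using integrable_lborel_affine[of f 1 a] assms by (simp add: add.commute)

lemma integrable_lborel_reflect:
  fixes a :: "'a::euclidean_space" and f :: "'a \<Rightarrow> 'b::{banach,second_countable_topology}"
  assumes "integrable lborel f"
  shows "integrable lborel (\<lambda>x. f (a - x))"
  using integrable_lborel_affine[of f "-1" a] assms by simp

lemma orthogonal_measurable:
  fixes Q :: "'a::euclidean_space \<Rightarrow> 'a"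
  assumes "orthogonal_transformation Q"
  shows "Q \<in> borel_measurable borel"
  using assms orthogonal_transformation_linear linear_continuous_on linear_conv_bounded_linear
    borel_measurable_continuous_onI by blast

text \<open>Any translation invariant, locally finite \<open>\<nu>\<close> satisfies
  \<open>\<nu> A * \<lambda> B = \<nu> B * \<lambda> A\<close> by Tonelli; taking \<open>B\<close> to be a ball
  identifies the image of Lebesgue measure under an isometry.\<close>

lemma lborel_distr_orthogonal:
  fixes Q :: "'a::euclidean_space \<Rightarrow> 'a"
  assumes Q: "orthogonal_transformation Q"
  shows "distr lborel borel Q = lborel"
proof -
  define \<nu> where "\<nu> = distr lborel borel Q"
  have lin: "linear Q" using Q orthogonal_transformation_linear by blast
  have normQ: "norm (Q x) = norm x" for x
    using Q by (simp add: orthogonal_transformation)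
  note [measurable] = orthogonal_measurable[OF Q]
  have surjQ: "surj Q" using Q orthogonal_transformation_surj by blast
  have sets[simp, measurable_cong]: "sets \<nu> = sets borel" by (simp add: \<nu>_def)
  have sp[simp]: "space \<nu> = UNIV" by (simp add: \<nu>_def)
  \<comment> \<open>An isometry fixing the origin preserves centred balls; this makes the constant
    of proportionality equal to one.\<close>
  have ball: "emeasure \<nu> (ball 0 r) = emeasure lborel (ball (0::'a) r)" for r
  proof -
    have "Q -` ball 0 r = ball 0 r" by (auto simp: normQ)
    then show ?thesis unfolding \<nu>_def by (subst emeasure_distr) auto
  qed
  interpret \<nu>: sigma_finite_measure \<nu>
  proof
    show "\<exists>A. countable A \<and> A \<subseteq> sets \<nu> \<and> \<Union> A = space \<nu> \<and> (\<forall>a\<in>A. emeasure \<nu> a \<noteq> \<infinity>)"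
    proof (intro exI conjI)
      show "\<Union> (range (\<lambda>n::nat. ball (0::'a) (real n))) = space \<nu>"
        using reals_Archimedean2 by auto
      show "\<forall>a\<in>range (\<lambda>n::nat. ball (0::'a) (real n)). emeasure \<nu> a \<noteq> \<infinity>"
        using emeasure_lborel_ball_finite by (auto simp: ball less_top[symmetric])
    qed auto
  qed
  interpret P: pair_sigma_finite \<nu> lborel by standard
  have trans: "(\<integral>\<^sup>+x. f (x + a) \<partial>\<nu>) = (\<integral>\<^sup>+x. f x \<partial>\<nu>)"
    if [measurable]: "f \<in> borel_measurable borel" for f a
  proof -
    \<comment> \<open>Shifting the image by Q b is taking the image of a shift by b, so \<nu>
      inherits translation invariance.\<close>
    obtain b where b: "a = Q b" using surjQ by (metis surjD)
    have "(\<integral>\<^sup>+x. f (x + a) \<partial>\<nu>) = (NNINT x. f (Q (x + b)))"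
      unfolding \<nu>_def by (subst nn_integral_distr) (auto simp: b linear_add[OF lin])
    also have "\<dots> = (NNINT x. f (Q x))"
      by (rule nn_integral_lborel_translate[where f = "\<lambda>x. f (Q x)"]) simp
    also have "\<dots> = (\<integral>\<^sup>+x. f x \<partial>\<nu>)"
      unfolding \<nu>_def by (subst nn_integral_distr) auto
    finally show ?thesis .
  qed
  \<comment> \<open>Shift y by x inside Lebesgue measure, exchange the integrals, and shift x by y
    inside \<nu>: the indicator of B no longer depends on y, and a reflection evaluates the
    remaining y-integral over A.\<close>
  have key: "emeasure \<nu> A * emeasure lborel B = emeasure lborel A * emeasure \<nu> B"
    if [measurable]: "A \<in> sets borel" "B \<in> sets borel" for A B
  proof -
    have "emeasure \<nu> A * emeasure lborel B = (\<integral>\<^sup>+x. indicator A x * (NNINT y. indicator B y) \<partial>\<nu>)"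
      by (simp add: nn_integral_multc)
    also have "\<dots> = (\<integral>\<^sup>+x. (NNINT y. indicator A x * indicator B (y + x)) \<partial>\<nu>)"
    proof (intro nn_integral_cong)
      fix x
      have "(NNINT y. indicator B (y + x)) = (NNINT y. indicator B y)"
        by (rule nn_integral_lborel_translate) simp
      then show "indicator A x * (NNINT y. indicator B y)
          = (NNINT y. indicator A x * indicator B (y + x))"
        by (subst nn_integral_cmult) auto
    qed
    also have "\<dots> = (NNINT y. (\<integral>\<^sup>+x. indicator A x * indicator B (y + x) \<partial>\<nu>))"
      by (rule P.Fubini'[symmetric]) measurable
    also have "\<dots> = (NNINT y. (\<integral>\<^sup>+x. indicator A (x - y) * indicator B x \<partial>\<nu>))"
    proof (rule nn_integral_cong)
      fix y
      show "(\<integral>\<^sup>+x. indicator A x * indicator B (y + x) \<partial>\<nu>) = (\<integral>\<^sup>+x. indicator A (x - y) * indicator B x \<partial>\<nu>)"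
        using trans[of "\<lambda>x. indicator A (x - y) * indicator B x" y] by (simp add: add.commute)
    qed
    also have "\<dots> = (\<integral>\<^sup>+x. (NNINT y. indicator A (x - y) * indicator B x) \<partial>\<nu>)"
      by (rule P.Fubini') measurable
    also have "\<dots> = (\<integral>\<^sup>+x. emeasure lborel A * indicator B x \<partial>\<nu>)"
    proof (intro nn_integral_cong)
      fix x
      have "(NNINT y. indicator A (x - y)) = (NNINT y. indicator A y)"
        by (rule nn_integral_lborel_reflect) simp
      then show "(NNINT y. indicator A (x - y) * indicator B x) = emeasure lborel A * indicator B x"
        by (subst nn_integral_multc) auto
    qed
    also have "\<dots> = emeasure lborel A * emeasure \<nu> B"
      by (simp add: nn_integral_cmult)
    finally show ?thesis .
  qed
  have "\<nu> = lborel"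
  proof (rule measure_eqI)
    fix A assume "A \<in> sets \<nu>"
    then have "A \<in> sets borel" by simp
    from key[OF this, of "ball 0 1"]
    have *: "emeasure \<nu> A * emeasure lborel (ball (0::'a) 1) = emeasure lborel A * emeasure lborel (ball (0::'a) 1)"
      by (simp add: ball)
    have "emeasure lborel (ball (0::'a) 1) \<noteq> 0"
      using emeasure_lborel_ball_finite[of "0::'a" 1] content_ball_pos[of 1 "0::'a"]
      by (metis measure_def enn2real_0 less_irrefl zero_less_one)
    moreover have "emeasure lborel (ball (0::'a) 1) \<noteq> \<top>"
      using emeasure_lborel_ball_finite[of "0::'a" 1] by auto
    ultimately show "emeasure \<nu> A = emeasure lborel A"
      using * by (metis ennreal_mult_cancel_left mult.commute)
  qed simp
  then show ?thesis by (simp add: \<nu>_def)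
qed

section \<open>Square integrable functions\<close>

lemma sq_int_measurable: "sq_int f \<Longrightarrow> f \<in> borel_measurable borel"
  by (simp add: sq_int_def)

lemma L2norm_nonneg [simp]: "0 \<le> L2norm f"
  by (simp add: L2norm_def)

lemma L2norm_square: "(L2norm f)\<^sup>2 = (LBINT x. (cmod (f x))\<^sup>2)"
  by (simp add: L2norm_def)

lemma nn_integral_square_cmod:
  assumes "sq_int f"
  shows "(NNINT x. ennreal ((cmod (f x))\<^sup>2)) = ennreal ((L2norm f)\<^sup>2)"
  using assms by (simp add: L2norm_square sq_int_def nn_integral_eq_integral)

lemma sq_int_L2norm_le_nn:
  assumes [measurable]: "f \<in> borel_measurable borel"
    and le: "(NNINT x. ennreal ((cmod (f x))\<^sup>2)) \<le> ennreal (c\<^sup>2)" and "0 \<le> c"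
  shows "sq_int f" "L2norm f \<le> c"
proof -
  show "sq_int f" unfolding sq_int_def
    using le by (auto intro!: integrableI_nonneg simp: le_less_trans)
  then have "ennreal ((L2norm f)\<^sup>2) \<le> ennreal (c\<^sup>2)"
    using le by (simp add: nn_integral_square_cmod)
  then show "L2norm f \<le> c"
    using \<open>0 \<le> c\<close> by (simp add: power2_le_iff_abs_le)
qed

lemma L2_product:
  assumes f: "sq_int f" and g: "sq_int g"
  shows integrable_sq_int_mult: "integrable lborel (\<lambda>x. f x * g x)"
    and L2_Cauchy_Schwarz_norm: "(LBINT x. cmod (f x * g x)) \<le> L2norm f * L2norm g"
    and L2_Cauchy_Schwarz: "cmod (LBINT x. f x * g x) \<le> L2norm f * L2norm g"
    and L2_Cauchy_Schwarz_nn: "(NNINT x. ennreal (cmod (f x * g x))) \<le> ennreal (L2norm f * L2norm g)"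
proof -
  note [measurable] = sq_int_measurable[OF f] sq_int_measurable[OF g]
  let ?I = "\<integral>\<^sup>+x. ennreal (cmod (f x)) * ennreal (cmod (g x)) \<partial>lborel"
  have "?I\<^sup>2 \<le> (NNINT x. ennreal (cmod (f x)) ^ 2) * (NNINT x. ennreal (cmod (g x)) ^ 2)"
    by (rule Cauchy_Schwarz_nn_integral) auto
  also have "\<dots> = ennreal ((L2norm f * L2norm g)\<^sup>2)"
    by (simp add: ennreal_power nn_integral_square_cmod f g ennreal_mult' power_mult_distrib)
  also have "\<dots> = ennreal (L2norm f * L2norm g) ^ 2"
    by (simp add: ennreal_power)
  finally have I: "?I\<^sup>2 \<le> ennreal (L2norm f * L2norm g) ^ 2" .
  have "?I \<le> ennreal (L2norm f * L2norm g)"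
  proof (cases ?I rule: ennreal_cases)
    case (real i)
    with I have "i\<^sup>2 \<le> (L2norm f * L2norm g)\<^sup>2" by (simp add: ennreal_power)
    then have "i \<le> L2norm f * L2norm g" by (rule power2_le_imp_le) simp
    then show ?thesis by (simp add: real)
  next
    case top
    with I show ?thesis by (simp add: ennreal_power top_unique)
  qed
  then show *: "(NNINT x. ennreal (cmod (f x * g x))) \<le> ennreal (L2norm f * L2norm g)"
    by (simp add: norm_mult ennreal_mult')
  then show int: "integrable lborel (\<lambda>x. f x * g x)"
    by (intro integrableI_bounded) (auto simp: le_less_trans)
  show **: "(LBINT x. cmod (f x * g x)) \<le> L2norm f * L2norm g"
    using * int by (subst (asm) nn_integral_eq_integral) auto
  show "cmod (LBINT x. f x * g x) \<le> L2norm f * L2norm g"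
    using integral_norm_bound[of lborel "\<lambda>x. f x * g x"] ** by linarith
qed

lemma sq_int_cmult: "sq_int f \<Longrightarrow> sq_int (\<lambda>x. c * f x)"
  unfolding sq_int_def by (auto simp: norm_mult power_mult_distrib)

lemma sq_int_add:
  assumes f: "sq_int f" and g: "sq_int g"
  shows "sq_int (\<lambda>x. f x + g x)"
proof -
  note [measurable] = sq_int_measurable[OF f] sq_int_measurable[OF g]
  have "integrable lborel (\<lambda>x. 2 * (cmod (f x))\<^sup>2 + 2 * (cmod (g x))\<^sup>2)"
    using f g by (auto simp: sq_int_def)
  then have "integrable lborel (\<lambda>x. (cmod (f x + g x))\<^sup>2)"
  proof (rule integrable_dominated)
    have "(cmod (f x + g x))\<^sup>2 \<le> 2 * (cmod (f x))\<^sup>2 + 2 * (cmod (g x))\<^sup>2" for x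
    proof -
      have "(cmod (f x + g x))\<^sup>2 \<le> (cmod (f x) + cmod (g x))\<^sup>2"
        by (intro power_mono norm_triangle_ineq) auto
      also have "\<dots> \<le> 2 * (cmod (f x))\<^sup>2 + 2 * (cmod (g x))\<^sup>2"
        using sum_squares_bound[of "cmod (f x)" "cmod (g x)"] by (simp add: power2_sum)
      finally show ?thesis .
    qed
    then show "AE x in lborel. norm ((cmod (f x + g x))\<^sup>2) \<le> norm (2 * (cmod (f x))\<^sup>2 + 2 * (cmod (g x))\<^sup>2)"
      by auto
  qed auto
  then show ?thesis by (simp add: sq_int_def)
qed

lemma sq_int_diff:
  assumes f: "sq_int f" and g: "sq_int g"
  shows "sq_int (\<lambda>x. f x - g x)"
  using sq_int_add[OF f sq_int_cmult[OF g, of "-1"]] by simp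

lemma sq_int_cnj: "sq_int f \<Longrightarrow> sq_int (\<lambda>x. cnj (f x))"
  unfolding sq_int_def by (auto intro: measurable_compose[OF _ borel_measurable_continuous_onI[OF continuous_on_cnj[OF continuous_on_id]]])

lemma L2norm_cnj [simp]: "L2norm (\<lambda>x. cnj (f x)) = L2norm f"
  by (simp add: L2norm_def)

lemma L2norm_bound:
  assumes f: "sq_int f" and [measurable]: "g \<in> borel_measurable borel"
    and le: "AE x in lborel. cmod (g x) \<le> c * cmod (f x)" and "0 \<le> c"
  shows "sq_int g" "L2norm g \<le> c * L2norm f"
proof -
  note [measurable] = sq_int_measurable[OF f]
  have "(NNINT x. ennreal ((cmod (g x))\<^sup>2)) \<le> (NNINT x. ennreal (c\<^sup>2) * ennreal ((cmod (f x))\<^sup>2))"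
  proof (intro nn_integral_mono_AE, use le in eventually_elim)
    case (elim x)
    then have "(cmod (g x))\<^sup>2 \<le> (c * cmod (f x))\<^sup>2" by (intro power_mono) auto
    then show ?case by (simp add: ennreal_mult[symmetric] power_mult_distrib)
  qed
  also have "\<dots> = ennreal ((c * L2norm f)\<^sup>2)"
    by (simp add: nn_integral_cmult nn_integral_square_cmod[OF f] ennreal_mult power_mult_distrib)
  finally have *: "(NNINT x. ennreal ((cmod (g x))\<^sup>2)) \<le> ennreal ((c * L2norm f)\<^sup>2)" .
  show "sq_int g" "L2norm g \<le> c * L2norm f"
    using sq_int_L2norm_le_nn[OF _ *] \<open>0 \<le> c\<close> by auto
qed

lemma L2norm_eq_0:
  assumes "sq_int f" and "L2norm f = 0"
  shows "AE x in lborel. f x = 0"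
proof -
  have "(LBINT x. (cmod (f x))\<^sup>2) = 0"
    using assms(2) by (metis L2norm_square power_zero_numeral)
  then show ?thesis
    using assms(1) by (subst (asm) integral_nonneg_eq_0_iff_AE) (auto simp: sq_int_def)
qed

lemma sq_int_translate:
  assumes "sq_int f"
  shows "sq_int (\<lambda>x. f (x + a))" "L2norm (\<lambda>x. f (x + a)) = L2norm f"
  using assms integrable_lborel_translate[of "\<lambda>x. (cmod (f x))\<^sup>2" a]
    integral_lborel_translate[of "\<lambda>x. (cmod (f x))\<^sup>2" a]
  by (auto simp: sq_int_def L2norm_def)

lemma sq_int_reflect:
  assumes "sq_int f"
  shows "sq_int (\<lambda>x. f (- x))" "L2norm (\<lambda>x. f (- x)) = L2norm f"
  using assms integrable_lborel_reflect[of "\<lambda>x. (cmod (f x))\<^sup>2" 0]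
    integral_lborel_reflect[of "\<lambda>x. (cmod (f x))\<^sup>2" 0]
  by (auto simp: sq_int_def L2norm_def)

text \<open>Cutting off both in space and in height turns a square integrable \<open>f\<close> into
  bounded functions that are also integrable, hence admissible as test functions in
  \<open>fourier_L2\<close>, and that approximate \<open>f\<close> in L^2.\<close>

definition truncate :: "nat \<Rightarrow> ('a::euclidean_space \<Rightarrow> complex) \<Rightarrow> 'a \<Rightarrow> complex" where
  "truncate N f x = (if norm x \<le> real N \<and> cmod (f x) \<le> real N then f x else 0)"

lemma truncate_measurable [measurable]:
  "f \<in> borel_measurable borel \<Longrightarrow> truncate N f \<in> borel_measurable borel"
  unfolding truncate_def[abs_def] by simp

lemma truncate_bound: "cmod (truncate N f x) \<le> real N" "cmod (truncate N f x) \<le> cmod (f x)"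
  by (auto simp: truncate_def)

lemma truncate_tendsto: "(\<lambda>N. truncate N f x) \<longlonglongrightarrow> f x"
proof (rule tendsto_eventually)
  obtain n where n: "max (norm x) (cmod (f x)) \<le> real n" using real_arch_simple by blast
  have "truncate N f x = f x" if "n \<le> N" for N
  proof -
    have "real n \<le> real N" using that by simp
    then show ?thesis using n by (auto simp: truncate_def)
  qed
  then show "eventually (\<lambda>N. truncate N f x = f x) sequentially"
    by (auto simp: eventually_sequentially)
qed

lemma truncate_integrable:
  assumes [measurable]: "f \<in> borel_measurable borel"
  shows "integrable lborel (truncate N f)"
proof (rule integrable_dominated)
  show "integrable lborel (\<lambda>x::'a. indicator (cball 0 (real N)) x *\<^sub>R real N)"
    using emeasure_lborel_cball_finite[of "0::'a" "real N"]
    by (intro integrable_real_indicator[THEN integrable_scaleR_left]) auto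
qed (auto simp: truncate_def split: split_indicator)

lemma sq_int_truncate: "sq_int f \<Longrightarrow> sq_int (truncate N f)"
  using L2norm_bound(1)[of f "truncate N f" 1] by (simp add: truncate_bound truncate_measurable sq_int_measurable)

lemma truncate_L2:
  assumes f: "sq_int f"
  shows "(\<lambda>N. L2norm (\<lambda>x. f x - truncate N f x)) \<longlonglongrightarrow> 0"
    and "(\<lambda>N. L2norm (truncate N f)) \<longlonglongrightarrow> L2norm f"
proof -
  note [measurable] = sq_int_measurable[OF f]
  have 1: "(\<lambda>N. (LBINT x. (cmod (f x - truncate N f x))\<^sup>2)) \<longlonglongrightarrow> (LBINT x::'a. 0::real)"
  proof (rule integral_dominated_convergence[where w="\<lambda>x. (cmod (f x))\<^sup>2"])
    show "AE x in lborel. (\<lambda>N. (cmod (f x - truncate N f x))\<^sup>2) \<longlonglongrightarrow> 0"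
      using truncate_tendsto by (intro AE_I2 tendsto_eq_intros refl | force)+
    show "AE x in lborel. norm ((cmod (f x - truncate N f x))\<^sup>2) \<le> (cmod (f x))\<^sup>2" for N
      by (auto simp: truncate_def)
  qed (use f in \<open>auto simp: sq_int_def\<close>)
  show "(\<lambda>N. L2norm (\<lambda>x. f x - truncate N f x)) \<longlonglongrightarrow> 0"
    unfolding L2norm_def using tendsto_real_sqrt[OF 1] by simp
  have 2: "(\<lambda>N. (LBINT x. (cmod (truncate N f x))\<^sup>2)) \<longlonglongrightarrow> (LBINT x. (cmod (f x))\<^sup>2)"
  proof (rule integral_dominated_convergence[where w="\<lambda>x. (cmod (f x))\<^sup>2"])
    show "AE x in lborel. (\<lambda>N. (cmod (truncate N f x))\<^sup>2) \<longlonglongrightarrow> (cmod (f x))\<^sup>2"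
      using truncate_tendsto by (intro AE_I2 tendsto_intros)
    show "AE x in lborel. norm ((cmod (truncate N f x))\<^sup>2) \<le> (cmod (f x))\<^sup>2" for N
      by (auto simp: truncate_def)
  qed (use f in \<open>auto simp: sq_int_def\<close>)
  show "(\<lambda>N. L2norm (truncate N f)) \<longlonglongrightarrow> L2norm f"
    unfolding L2norm_def using tendsto_real_sqrt[OF 2] by simp
qed

section \<open>Gaussians and approximate identities\<close>

abbreviation fker :: "real \<Rightarrow> complex" where
  "fker t \<equiv> exp (- (2 * pi * \<i> * complex_of_real t))"

abbreviation ifker :: "real \<Rightarrow> complex" where
  "ifker t \<equiv> exp (2 * pi * \<i> * complex_of_real t)"

definition gauss :: "real \<Rightarrow> 'a::euclidean_space \<Rightarrow> real" where
  "gauss \<epsilon> x = exp (- (pi * \<epsilon> * (norm x)\<^sup>2))"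

lemma gauss_measurable [measurable]: "gauss \<epsilon> \<in> borel_measurable borel"
  unfolding gauss_def[abs_def] by measurable

lemma gauss_nonneg [simp]: "0 \<le> gauss \<epsilon> x"
  by (simp add: gauss_def)

lemma gauss_le_1: "0 \<le> \<epsilon> \<Longrightarrow> gauss \<epsilon> x \<le> 1"
  by (simp add: gauss_def)

lemma gauss_minus [simp]: "gauss \<epsilon> (- x) = gauss \<epsilon> x"
  by (simp add: gauss_def)

lemma gauss_real_Fourier:
  fixes \<xi> :: real
  assumes e: "0 < \<epsilon>"
  shows "integrable lborel (\<lambda>x::real. fker (x * \<xi>) * of_real (exp (- (pi * \<epsilon> * x\<^sup>2))))" (is "integrable _ ?g")
    and "(LBINT x. fker (x * \<xi>) * of_real (exp (- (pi * \<epsilon> * x\<^sup>2))))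
         = of_real (1 / sqrt \<epsilon> * exp (- (pi * \<xi>\<^sup>2 / \<epsilon>)))"
proof -
  \<comment> \<open>The substitution x -> c x carries the characteristic function of the standard
    normal law at t into the wanted integral; c matches the quadratic exponents and t the linear
    ones.\<close>
  define c where "c = sqrt (2 * pi * \<epsilon>)"
  have c: "0 < c" "c\<^sup>2 = 2 * pi * \<epsilon>" using e by (auto simp: c_def)
  define t where "t = - (2 * pi * \<xi>) / c"
  define f where "f x = std_normal_density x *\<^sub>R iexp (t * x)" for x
  have fm [measurable]: "f \<in> borel_measurable borel" unfolding f_def by measurable
  have f1: "integral\<^sup>L lborel f = of_real (exp (- (t\<^sup>2) / 2))"
    using fun_cong[OF char_std_normal_distribution, of t]
    unfolding char_def f_def by (subst (asm) integral_density) auto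
  have fint: "integrable lborel f"
    by (rule integrable_dominated[of _ std_normal_density]) (auto simp: f_def norm_mult)
  have fc: "f (c * x) = of_real (1 / sqrt (2 * pi)) * ?g x" for x
  proof -
    have "\<i> * (complex_of_real (t * (c * x))) = - (2 * pi * \<i> * complex_of_real (x * \<xi>))"
      using c by (simp add: t_def)
    moreover have "(c * x)\<^sup>2 / 2 = pi * \<epsilon> * x\<^sup>2" using c by (simp add: power_mult_distrib)
    ultimately show ?thesis
      by (simp add: f_def normal_density_def scaleR_conv_of_real del: of_real_mult)
  qed
  have "integrable lborel (\<lambda>x. f (0 + c *\<^sub>R x))"
    using integrable_lborel_affine[OF fm, of c 0] c fint by simp
  then have "integrable lborel (\<lambda>x. of_real (sqrt (2 * pi)) * f (c * x))" by auto
  then show "integrable lborel ?g" by (simp add: fc)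
  have "integral\<^sup>L lborel f = \<bar>c\<bar> *\<^sub>R (LBINT x. f (c * x))"
    using integral_lborel_affine[OF fm, of c 0] c by simp
  also have "(LBINT x. f (c * x)) = of_real (1 / sqrt (2 * pi)) * integral\<^sup>L lborel ?g"
    by (simp add: fc)
  finally have "integral\<^sup>L lborel ?g = of_real (sqrt (2 * pi) / c * exp (- (t\<^sup>2) / 2))"
    using f1 c by (simp add: field_simps scaleR_conv_of_real)
  moreover have "sqrt (2 * pi) / c = 1 / sqrt \<epsilon>" by (simp add: c_def real_sqrt_mult)
  moreover have "- (t\<^sup>2) / 2 = - (pi * \<xi>\<^sup>2 / \<epsilon>)"
  proof -
    have "t\<^sup>2 = (2 * pi * \<xi>)\<^sup>2 / (2 * pi * \<epsilon>)" by (simp add: t_def power_divide c(2))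
    then show ?thesis using e by (simp add: power2_eq_square field_simps)
  qed
  ultimately show "integral\<^sup>L lborel ?g = of_real (1 / sqrt \<epsilon> * exp (- (pi * \<xi>\<^sup>2 / \<epsilon>)))" by metis
qed

lemma gauss_prod: "gauss \<epsilon> x = (\<Prod>b\<in>Basis. exp (- (pi * \<epsilon> * (x \<bullet> b)\<^sup>2)))"
proof -
  have "(norm x)\<^sup>2 = (\<Sum>b\<in>Basis. (x \<bullet> b)\<^sup>2)"
    by (subst power2_norm_eq_inner, subst euclidean_inner) (simp add: power2_eq_square)
  then show ?thesis
    by (simp add: gauss_def sum_distrib_left exp_sum flip: sum_negf)
qed

lemma gauss_integrable:
  assumes "0 < \<epsilon>"
  shows "integrable lborel (gauss \<epsilon> :: 'a::euclidean_space \<Rightarrow> real)"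
proof (rule integrableI_nonneg)
  have "integrable lborel (\<lambda>x::real. exp (- (pi * \<epsilon> * x\<^sup>2)))"
    using integrable_norm[OF gauss_real_Fourier(1)[OF assms, of 0]] by simp
  then have fin: "(NNINT x. ennreal (exp (- (pi * \<epsilon> * x\<^sup>2)))) < \<infinity>"
    by (simp add: integrable_iff_bounded)
  have "(NNINT x. ennreal (gauss \<epsilon> (x::'a)))
     = (NNINT x::'a. (\<Prod>b\<in>Basis. ennreal (exp (- (pi * \<epsilon> * (x \<bullet> b)\<^sup>2)))))"
    by (simp add: gauss_prod prod_ennreal)
  also have "\<dots> = (\<Prod>b\<in>(Basis::'a set). (NNINT x. ennreal (exp (- (pi * \<epsilon> * x\<^sup>2)))))"
    by (rule nn_integral_lborel_prod) auto
  also have "\<dots> < \<infinity>" using fin by (auto simp: power_less_top_ennreal)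
  finally show "(NNINT x. ennreal (gauss \<epsilon> (x::'a))) < \<infinity>" .
qed auto

text \<open>This is the Fourier transform of \<open>gauss \<epsilon>\<close>. Its total mass is one
  and it concentrates at the origin as \<epsilon> tends to 0, so it also serves as approximate
  identity.\<close>

definition ghat :: "real \<Rightarrow> 'a::euclidean_space \<Rightarrow> real" where
  "ghat \<epsilon> x = (1 / sqrt \<epsilon>) ^ DIM('a) * gauss (1 / \<epsilon>) x"

lemma gauss_Fourier:
  fixes \<xi> :: "'a::euclidean_space"
  assumes "0 < \<epsilon>"
  shows "fourier_L1 (\<lambda>x. of_real (gauss \<epsilon> x)) \<xi> = of_real (ghat \<epsilon> \<xi>)"
proof -
  let ?h = "\<lambda>b t. fker (t * (\<xi> \<bullet> b)) * of_real (exp (- (pi * \<epsilon> * t\<^sup>2)))"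
  interpret product_sigma_finite "\<lambda>b::'a. lborel :: real measure" by standard
  have eq: "fker (x \<bullet> \<xi>) * of_real (gauss \<epsilon> x) = (\<Prod>b\<in>Basis. ?h b (x \<bullet> b))" for x
  proof -
    have "x \<bullet> \<xi> = (\<Sum>b\<in>Basis. (x \<bullet> b) * (\<xi> \<bullet> b))" by (rule euclidean_inner)
    then have *: "- (2 * pi * \<i> * complex_of_real (x \<bullet> \<xi>)) = (\<Sum>b\<in>Basis. - (2 * pi * \<i> * complex_of_real ((x \<bullet> b) * (\<xi> \<bullet> b))))"
      by (simp add: sum_distrib_left sum_negf)
    have "fker (x \<bullet> \<xi>) = (\<Prod>b\<in>Basis. fker ((x \<bullet> b) * (\<xi> \<bullet> b)))"
      unfolding * by (rule exp_sum) simp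
    then show ?thesis by (simp only: gauss_prod of_real_prod prod.distrib)
  qed
  have "fourier_L1 (\<lambda>x. of_real (gauss \<epsilon> x)) \<xi> = (LBINT x. (\<Prod>b\<in>Basis. ?h b (x \<bullet> b)))"
    unfolding fourier_L1_def by (simp only: eq)
  also have "\<dots> = (\<integral>f. (\<Prod>b\<in>Basis. ?h b (f b)) \<partial>(\<Pi>\<^sub>M b\<in>(Basis::'a set). lborel))"
    by (subst lborel_eq, subst integral_distr) (auto intro!: LBINT_cong prod.cong)
  also have "\<dots> = (\<Prod>b\<in>Basis. integral\<^sup>L lborel (?h b))"
    by (rule product_integral_prod[OF finite_Basis gauss_real_Fourier(1)[OF assms]])
  also have "\<dots> = (\<Prod>b\<in>Basis. of_real (1 / sqrt \<epsilon> * exp (- (pi * (\<xi> \<bullet> b)\<^sup>2 / \<epsilon>))))"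
    by (intro prod.cong refl gauss_real_Fourier(2)[OF assms])
  also have "\<dots> = of_real (ghat \<epsilon> \<xi>)"
    unfolding of_real_prod[symmetric] by (simp only: ghat_def gauss_prod prod.distrib) simp
  finally show ?thesis .
qed

lemma ghat_measurable [measurable]: "ghat \<epsilon> \<in> borel_measurable borel"
  unfolding ghat_def[abs_def] by measurable

lemma ghat_nonneg [simp]: "0 < \<epsilon> \<Longrightarrow> 0 \<le> ghat \<epsilon> x"
  by (simp add: ghat_def)

lemma ghat_integrable: "0 < \<epsilon> \<Longrightarrow> integrable lborel (ghat \<epsilon>)"
  unfolding ghat_def[abs_def] by (intro integrable_mult_right gauss_integrable) auto

lemma integral_gauss:
  assumes "0 < \<epsilon>"
  shows "integral\<^sup>L lborel (gauss \<epsilon> :: 'a::euclidean_space \<Rightarrow> real) = (1 / sqrt \<epsilon>) ^ DIM('a)"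
proof -
  have "complex_of_real (integral\<^sup>L lborel (gauss \<epsilon> :: 'a \<Rightarrow> real)) = fourier_L1 (\<lambda>x. of_real (gauss \<epsilon> x)) (0::'a)"
    by (simp add: fourier_L1_def)
  also have "\<dots> = of_real ((1 / sqrt \<epsilon>) ^ DIM('a))" unfolding gauss_Fourier[OF assms] by (simp add: ghat_def gauss_def)
  finally show ?thesis by (simp only: of_real_eq_iff)
qed

text \<open>For the indicator of an open set the claim is dominated convergence, because a point of
  the set stays in it under small shifts. Outer regularity then reaches measurable sets, and the
  induction principle for integrable functions reaches the rest. Sequences of shifts are used so
  that dominated convergence applies.\<close>

lemma L1_translation_continuous:
  fixes f :: "'a::euclidean_space \<Rightarrow> complex"
  assumes f: "integrable lborel f" and y: "y \<longlonglongrightarrow> 0"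
  shows "(\<lambda>n. LBINT x. cmod (f (x + y n) - f x)) \<longlonglongrightarrow> 0"
proof -
  define N where "N g n = (LBINT x. cmod (g (x + y n) - g x))" for g :: "'a \<Rightarrow> complex" and n :: nat
  \<comment> \<open>The claim is closed under L^1 limits: replacing f by g costs the L^1 distance
    twice, since the shifted distance has the same integral.\<close>
  have approx: "N f \<longlonglongrightarrow> 0" if f: "integrable lborel f"
    and ex: "\<And>e. 0 < e \<Longrightarrow> \<exists>g. integrable lborel g \<and> (LBINT x. cmod (g x - f x)) < e \<and> N g \<longlonglongrightarrow> 0" for f
  proof (rule LIMSEQ_I)
    fix e :: real assume e: "0 < e"
    obtain g where g: "integrable lborel g" "(LBINT x. cmod (g x - f x)) < e / 4" "N g \<longlonglongrightarrow> 0"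
      using ex[of "e / 4"] e by auto
    have "eventually (\<lambda>n. N g n < e / 2) sequentially"
      using g(3) e by (intro order_tendstoD(2)[where y=0]) auto
    then obtain n0 where n0: "\<And>n. n \<ge> n0 \<Longrightarrow> N g n < e / 2" by (auto simp: eventually_sequentially)
    show "\<exists>n0. \<forall>n\<ge>n0. norm (N f n - 0) < e"
    proof (intro exI allI impI)
      fix n assume n: "n0 \<le> n"
      let ?D = "\<lambda>x. cmod (g x - f x)" and ?G = "\<lambda>x. cmod (g (x + y n) - g x)"
      have iD: "integrable lborel ?D" and iG: "integrable lborel ?G"
        using f g(1) integrable_lborel_translate[OF g(1)] by auto
      note iDt = integrable_lborel_translate[OF iD, of "y n"]
      have "N f n \<le> (LBINT x. ?G x + ?D (x + y n) + ?D x)"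
        unfolding N_def
      proof (intro integral_mono Bochner_Integration.integrable_add iD iG iDt)
        show "integrable lborel (\<lambda>x. cmod (f (x + y n) - f x))"
          using f integrable_lborel_translate[OF f] by auto
        fix x
        have "f (x + y n) - f x = (g (x + y n) - g x) - (g (x + y n) - f (x + y n)) + (g x - f x)" by simp
        then show "cmod (f (x + y n) - f x) \<le> ?G x + ?D (x + y n) + ?D x"
          by (metis (no_types, lifting) add_right_mono norm_triangle_ineq norm_triangle_ineq4 order_trans)
      qed
      also have "\<dots> = N g n + (LBINT x. ?D (x + y n)) + (LBINT x. ?D x)"
        unfolding N_def using iD iG iDt by simp
      also have "(LBINT x. ?D (x + y n)) = (LBINT x. ?D x)"
        by (rule integral_lborel_translate[of ?D]) (use f g(1) in simp)
      also have "N g n + (LBINT x. ?D x) + (LBINT x. ?D x) < e" using n0[OF n] g(2) by linarith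
      finally show "norm (N f n - 0) < e" by (simp add: N_def)
    qed
  qed
  \<comment> \<open>The absolute difference of the two indicators is their sum minus twice their
    product, so only the mass of the overlap has to converge.\<close>
  have "open": "N (\<lambda>x. indicator U x *\<^sub>R c) \<longlonglongrightarrow> 0" if U: "open U" "emeasure lborel U < \<infinity>" for U c
  proof -
    note [measurable] = borel_open[OF U(1)]
    have iU: "integrable lborel (indicator U :: 'a \<Rightarrow> real)" using U(2) by simp
    note iUt = integrable_lborel_translate[OF iU]
    let ?P = "\<lambda>n. LBINT x. indicat_real U x * indicator U (x + y n)" and ?m = "LBINT x. indicat_real U x"
    have lim: "?P \<longlonglongrightarrow> ?m"
    proof (rule integral_dominated_convergence[where w="indicator U"])
      show "AE x in lborel. (\<lambda>n. indicator U x * indicator U (x + y n) :: real) \<longlonglongrightarrow> indicator U x"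
      proof (rule AE_I2)
        fix x
        show "(\<lambda>n. indicator U x * indicator U (x + y n) :: real) \<longlonglongrightarrow> indicator U x"
        proof (cases "x \<in> U")
          case True
          have "(\<lambda>n. x + y n) \<longlonglongrightarrow> x" using tendsto_add[OF tendsto_const y, of x] by simp
          then have "eventually (\<lambda>n. x + y n \<in> U) sequentially"
            using U(1) True topological_tendstoD by blast
          then have "eventually (\<lambda>n. indicator U x * indicator U (x + y n) = (indicator U x :: real)) sequentially"
            by eventually_elim (use True in auto)
          then show ?thesis by (rule tendsto_eventually)
        qed auto
      qed
    qed (use iU in \<open>auto split: split_indicator\<close>)
    have "N (\<lambda>x. indicator U x *\<^sub>R c) n = cmod c * (2 * ?m - 2 * ?P n)" for n
    proof -
      have iP: "integrable lborel (\<lambda>x. indicator U x * indicator U (x + y n) :: real)"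
        by (rule integrable_dominated[OF iU]) (auto split: split_indicator)
      have "N (\<lambda>x. indicator U x *\<^sub>R c) n
        = (LBINT x. cmod c * (indicator U (x + y n) + indicator U x - 2 * (indicator U x * indicator U (x + y n))))"
        unfolding N_def by (intro LBINT_cong) (auto split: split_indicator)
      also have "\<dots> = cmod c * ((LBINT x. indicator U (x + y n)) + ?m - 2 * ?P n)"
        using iU iUt[of "y n"] iP by simp
      also have "(LBINT x. indicat_real U (x + y n)) = ?m"
        by (rule integral_lborel_translate) simp
      finally show ?thesis by simp
    qed
    then have "N (\<lambda>x. indicator U x *\<^sub>R c) = (\<lambda>n. cmod c * (2 * ?m - 2 * ?P n))" by blast
    moreover have "(\<lambda>n. cmod c * (2 * ?m - 2 * ?P n)) \<longlonglongrightarrow> cmod c * (2 * ?m - 2 * ?m)"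
      by (intro tendsto_intros lim)
    ultimately show ?thesis by simp
  qed
  from f have "N f \<longlonglongrightarrow> 0"
  proof (induction rule: integrable_induct)
    case (base A c)
    have A [measurable]: "A \<in> sets borel" using base by simp
    show ?case
    proof (rule approx)
      show "integrable lborel (\<lambda>x. indicator A x *\<^sub>R c)" using base by simp
      fix e :: real assume e: "0 < e"
      \<comment> \<open>The \<open>+ 1\<close> in the denominator covers c = 0.\<close>
      define \<delta> where "\<delta> = e / (cmod c + 1)"
      have \<delta>: "0 < \<delta>" "cmod c * \<delta> < e" using e by (auto simp: \<delta>_def field_simps add_pos_nonneg)
      obtain U where U: "open U" "A \<subseteq> U" "emeasure lborel (U - A) < ennreal \<delta>"
        using outer_regular_lborel[OF A, of \<delta>] \<delta> by auto
      note [measurable] = borel_open[OF U(1)]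
      have finD: "emeasure lborel (U - A) < \<infinity>"
        using U(3) by (metis ennreal_less_top infinity_ennreal_def order_less_trans)
      have "emeasure lborel U = emeasure lborel A + emeasure lborel (U - A)"
        using U(2) by (subst plus_emeasure) (auto intro!: arg_cong[where f="emeasure lborel"])
      then have finU: "emeasure lborel U < \<infinity>" using base(2) finD by simp
      have D: "measure lborel (U - A) \<le> \<delta>"
        using U(3) finD \<delta> by (simp add: emeasure_eq_ennreal_measure ennreal_less_iff)
      have "(LBINT x. cmod (indicator U x *\<^sub>R c - indicator A x *\<^sub>R c)) = (LBINT x. cmod c * indicator (U - A) x)"
        using U(2) by (intro LBINT_cong) (auto split: split_indicator)
      also have "\<dots> = cmod c * measure lborel (U - A)" by simp
      also have "\<dots> < e" using mult_left_mono[OF D, of "cmod c"] \<delta> by simp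
      finally show "\<exists>g. integrable lborel g \<and> (LBINT x. cmod (g x - indicator A x *\<^sub>R c)) < e \<and> N g \<longlonglongrightarrow> 0"
        using finU "open"[OF U(1) finU, of c] by (intro exI[of _ "\<lambda>x. indicator U x *\<^sub>R c"]) simp
    qed
  next
    case (add f g)
    note t = integrable_lborel_translate[OF add(1)] integrable_lborel_translate[OF add(2)]
    show ?case
    proof (rule tendsto_sandwich[OF _ _ tendsto_const])
      show "(\<lambda>n. N f n + N g n) \<longlonglongrightarrow> 0" using add tendsto_add_zero by blast
      have "N (\<lambda>x. f x + g x) n \<le> (LBINT x. cmod (f (x + y n) - f x) + cmod (g (x + y n) - g x))" for n
        unfolding N_def using add(1,2) t
        by (intro integral_mono) (auto simp: add_diff_add intro: norm_triangle_ineq)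
      then show "eventually (\<lambda>n. N (\<lambda>x. f x + g x) n \<le> N f n + N g n) sequentially"
        unfolding N_def using add(1,2) t by simp
    qed (auto simp: N_def)
  next
    case (lim f s)
    have [measurable]: "f \<in> borel_measurable borel" "\<And>i. s i \<in> borel_measurable borel"
      using lim(1,4) by auto
    have sf: "(\<lambda>i. LBINT x. cmod (s i x - f x)) \<longlonglongrightarrow> (LBINT x::'a. 0)"
    proof (rule integral_dominated_convergence[where w="\<lambda>x. 3 * cmod (f x)"])
      show "AE x in lborel. (\<lambda>i. cmod (s i x - f x)) \<longlonglongrightarrow> 0"
      proof (rule AE_I2)
        fix x
        have "(\<lambda>i. s i x) \<longlonglongrightarrow> f x" using lim(2) by simp
        then show "(\<lambda>i. cmod (s i x - f x)) \<longlonglongrightarrow> 0" by (intro tendsto_norm_zero LIM_zero)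
      qed
      show "AE x in lborel. norm (cmod (s i x - f x)) \<le> 3 * cmod (f x)" for i
      proof (rule AE_I2)
        fix x
        show "norm (cmod (s i x - f x)) \<le> 3 * cmod (f x)"
          using lim(3)[of x i] norm_triangle_ineq4[of "s i x" "f x"] by simp
      qed
    qed (use lim in auto)
    show ?case
    proof (rule approx[OF lim(4)])
      fix e :: real assume "0 < e"
      then have "eventually (\<lambda>i. (LBINT x. cmod (s i x - f x)) < e) sequentially"
        using sf by (intro order_tendstoD(2)) auto
      then show "\<exists>g. integrable lborel g \<and> (LBINT x. cmod (g x - f x)) < e \<and> N g \<longlonglongrightarrow> 0"
        using lim(1,5) by (auto simp: eventually_sequentially)
    qed
  qed
  then show ?thesis by (simp add: N_def[abs_def])
qed

text \<open>Truncating f makes it bounded, so that L^1 continuity of translations of g suffices for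
  the main part; Cauchy-Schwarz bounds the remainder uniformly in the shift, because shifts preserve
  the L^2 norm of g.\<close>

lemma L2_translation_weakly_continuous:
  fixes f g :: "'a::euclidean_space \<Rightarrow> complex"
  assumes f: "sq_int f" and g: "sq_int g" "integrable lborel g" and y: "y \<longlonglongrightarrow> 0"
  shows "(\<lambda>n. LBINT x. f x * g (x + y n)) \<longlonglongrightarrow> (LBINT x. f x * g x)"
proof (rule LIMSEQ_I)
  fix e :: real assume e: "0 < e"
  note [measurable] = sq_int_measurable[OF f] sq_int_measurable[OF g(1)]
  have "(\<lambda>N. L2norm (\<lambda>x. f x - truncate N f x) * L2norm g) \<longlonglongrightarrow> 0"
    using tendsto_mult_left_zero[OF truncate_L2(1)[OF f]] .
  then have "eventually (\<lambda>N. L2norm (\<lambda>x. f x - truncate N f x) * L2norm g < e / 4) sequentially"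
    using e by (intro order_tendstoD(2)[where y=0]) auto
  then obtain N where N: "L2norm (\<lambda>x. f x - truncate N f x) * L2norm g < e / 4"
    by (auto simp: eventually_sequentially)
  let ?t = "truncate N f"
  let ?I = "\<lambda>h. LBINT x. f x * h x" and ?d = "\<lambda>x. f x - truncate N f x"
  have sd: "sq_int ?d" using f by (intro sq_int_diff sq_int_truncate)
  have st: "sq_int ?t" by (rule sq_int_truncate[OF f])
  have "(\<lambda>n. real N * (LBINT x. cmod (g (x + y n) - g x))) \<longlonglongrightarrow> 0"
    using tendsto_mult_right_zero[OF L1_translation_continuous[OF g(2) y]] .
  then have "eventually (\<lambda>n. real N * (LBINT x. cmod (g (x + y n) - g x)) < e / 2) sequentially"
    using e by (intro order_tendstoD(2)[where y=0]) auto
  then obtain n0 where n0: "\<And>n. n \<ge> n0 \<Longrightarrow> real N * (LBINT x. cmod (g (x + y n) - g x)) < e / 2"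
    by (auto simp: eventually_sequentially)
  show "\<exists>n0. \<forall>n\<ge>n0. norm (?I (\<lambda>x. g (x + y n)) - ?I g) < e"
  proof (intro exI allI impI)
    fix n assume n: "n0 \<le> n"
    note gt = sq_int_translate[OF g(1), of "y n"]
    note gi = integrable_lborel_translate[OF g(2), of "y n"]
    have A: "cmod (LBINT x. ?d x * g (x + y n)) < e / 4"
      using L2_Cauchy_Schwarz[OF sd gt(1)] N gt(2) by simp
    have B: "cmod (LBINT x. ?d x * g x) < e / 4"
      using L2_Cauchy_Schwarz[OF sd g(1)] N by simp
    have sg: "sq_int (\<lambda>x. g (x + y n) - g x)" by (intro sq_int_diff gt g)
    have "cmod (LBINT x. ?t x * (g (x + y n) - g x)) \<le> (LBINT x. cmod (?t x * (g (x + y n) - g x)))"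
      by simp
    also have "\<dots> \<le> (LBINT x. real N * cmod (g (x + y n) - g x))"
    proof (rule integral_mono)
      show "integrable lborel (\<lambda>x. cmod (?t x * (g (x + y n) - g x)))"
        by (intro integrable_norm integrable_sq_int_mult st sg)
      show "integrable lborel (\<lambda>x. real N * cmod (g (x + y n) - g x))"
        using gi g(2) by auto
    qed (auto simp: norm_mult intro!: mult_right_mono truncate_bound)
    also have "\<dots> < e / 2" using n0[OF n] by simp
    finally have C: "cmod (LBINT x. ?t x * (g (x + y n) - g x)) < e / 2" .
    note ints = integrable_sq_int_mult[OF sd gt(1)] integrable_sq_int_mult[OF sd g(1)] integrable_sq_int_mult[OF st sg]
    have "?I (\<lambda>x. g (x + y n)) - ?I g
       = (LBINT x. f x * g (x + y n) - f x * g x)"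
      by (intro Bochner_Integration.integral_diff[symmetric] integrable_sq_int_mult f g gt)
    also have "\<dots> = (LBINT x. ?d x * g (x + y n) - ?d x * g x + ?t x * (g (x + y n) - g x))"
      by (intro LBINT_cong) (auto simp: algebra_simps)
    also have "\<dots> = (LBINT x. ?d x * g (x + y n)) - (LBINT x. ?d x * g x) + (LBINT x. ?t x * (g (x + y n) - g x))"
      using ints by (subst Bochner_Integration.integral_add) (auto simp del: right_diff_distrib left_diff_distrib simp: Bochner_Integration.integral_diff)
    finally have eq: "?I (\<lambda>x. g (x + y n)) - ?I g = \<dots>" .
    show "norm (?I (\<lambda>x. g (x + y n)) - ?I g) < e"
      unfolding eq by (rule le_less_trans[OF norm_triangle_ineq], rule le_less_trans[OF add_right_mono[OF norm_triangle_ineq4]])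
        (use A B C in linarith)
  qed
qed

text \<open>Convergence is needed only weakly. By Fubini the pairing is the average of the
  correlation C against \<open>ghat\<close>; rescaling y by the square root of \<epsilon> freezes
  the Gaussian and moves \<epsilon> into the argument of C, which is bounded and continuous at 0,
  with C 0 the claimed limit.\<close>

lemma gauss_approximate_identity:
  fixes f h :: "'a::euclidean_space \<Rightarrow> complex"
  assumes f: "sq_int f" and h: "sq_int h" "integrable lborel h"
    and e: "\<And>n. 0 < \<epsilon> n" "\<epsilon> \<longlonglongrightarrow> 0"
  shows "(\<lambda>n. LBINT x. f x * (LBINT y. h (x + y) * of_real (ghat (\<epsilon> n) y))) \<longlonglongrightarrow> (LBINT x. f x * h x)"
proof -
  note [measurable] = sq_int_measurable[OF f] sq_int_measurable[OF h(1)]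
  define C where "C y = (LBINT x. f x * h (x + y))" for y
  let ?H = "\<lambda>\<delta> z. C (sqrt \<delta> *\<^sub>R z) * of_real (gauss 1 z)"
  have Cm [measurable]: "C \<in> borel_measurable borel"
  proof -
    have "(\<lambda>y. LBINT x. f x * h (x + y)) \<in> borel_measurable lborel" by measurable
    then show ?thesis by (simp add: C_def[abs_def])
  qed
  have Cb: "cmod (C y) \<le> L2norm f * L2norm h" for y
    unfolding C_def using L2_Cauchy_Schwarz[OF f sq_int_translate(1)[OF h(1), of y]] by (simp add: sq_int_translate(2)[OF h(1)])
  have 1: "(LBINT x. f x * (LBINT y. h (x + y) * of_real (ghat \<delta> y))) = (LBINT z. ?H \<delta> z)"
    if d: "0 < \<delta>" for \<delta>
  proof -
    let ?F = "\<lambda>x y. f x * (h (x + y) * complex_of_real (ghat \<delta> y))"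
    have Fm: "case_prod ?F \<in> borel_measurable (lborel \<Otimes>\<^sub>M lborel)" by measurable
    have Fm': "case_prod (\<lambda>x y. ?F y x) \<in> borel_measurable (lborel \<Otimes>\<^sub>M lborel)" by measurable
    have int': "integrable (lborel \<Otimes>\<^sub>M lborel) (case_prod (\<lambda>x y. ?F y x))"
    proof (rule integrableI_bounded[OF Fm'])
      have "(\<integral>\<^sup>+ z. ennreal (norm (case_prod (\<lambda>x y. ?F y x) z)) \<partial>(lborel \<Otimes>\<^sub>M lborel))
        = (NNINT y. \<integral>\<^sup>+x. ennreal (norm (?F x y)) \<partial>lborel)"
        by (subst lborel.nn_integral_fst[symmetric]) auto
      also have "\<dots> \<le> (NNINT y::'a. ennreal (L2norm f * L2norm h) * ennreal (ghat \<delta> y))"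
      proof (intro nn_integral_mono)
        fix y
        have "(NNINT x. ennreal (norm (?F x y))) = (NNINT x. ennreal (cmod (f x * h (x + y))) * ennreal (ghat \<delta> y))"
          using d by (intro nn_integral_cong) (auto simp: norm_mult mult.assoc ennreal_mult')
        also have "\<dots> = (NNINT x. ennreal (cmod (f x * h (x + y)))) * ennreal (ghat \<delta> y)"
          by (rule nn_integral_multc) auto
        also have "\<dots> \<le> ennreal (L2norm f * L2norm h) * ennreal (ghat \<delta> y)"
          using L2_Cauchy_Schwarz_nn[OF f sq_int_translate(1)[OF h(1), of y]]
          by (intro mult_right_mono) (auto simp: sq_int_translate(2)[OF h(1)])
        finally show "(NNINT x. ennreal (norm (?F x y))) \<le> ennreal (L2norm f * L2norm h) * ennreal (ghat \<delta> y)" .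
      qed
      also have "\<dots> < \<infinity>"
        using ghat_integrable[OF d, where 'a='a] d
        by (subst nn_integral_cmult) (auto simp: nn_integral_eq_integral ennreal_mult_less_top)
      finally show "(\<integral>\<^sup>+ z. ennreal (norm (case_prod (\<lambda>x y. ?F y x) z)) \<partial>(lborel \<Otimes>\<^sub>M lborel)) < \<infinity>" .
    qed
    have "(LBINT x. f x * (LBINT y. h (x + y) * of_real (ghat \<delta> y))) = (LBINT x. \<integral>y. ?F x y \<partial>lborel)"
      by simp
    also have "\<dots> = (LBINT y. \<integral>x. ?F x y \<partial>lborel)"
      using lborel_pair.Fubini_integral[OF int'] by simp
    also have "\<dots> = (LBINT y. C y * of_real (ghat \<delta> y))"
      unfolding C_def by (intro LBINT_cong refl)
         (simp only: mult.assoc[symmetric] integral_mult_left_zero)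
    also have "\<dots> = (sqrt \<delta> ^ DIM('a)) *\<^sub>R (LBINT z. C (sqrt \<delta> *\<^sub>R z) * of_real (ghat \<delta> (sqrt \<delta> *\<^sub>R z)))"
      using integral_lborel_affine[of "\<lambda>y. C y * of_real (ghat \<delta> y)" "sqrt \<delta>" 0] d by simp
    also have "\<dots> = (LBINT z. (sqrt \<delta> ^ DIM('a)) *\<^sub>R (C (sqrt \<delta> *\<^sub>R z) * of_real (ghat \<delta> (sqrt \<delta> *\<^sub>R z))))"
      by simp
    also have "\<dots> = (LBINT z. ?H \<delta> z)"
    proof (intro LBINT_cong refl)
      fix z :: 'a
      have "sqrt \<delta> ^ DIM('a) * ghat \<delta> (sqrt \<delta> *\<^sub>R z) = gauss 1 z"
        using d by (simp add: ghat_def gauss_def power_mult_distrib power_divide)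
      then show "(sqrt \<delta> ^ DIM('a)) *\<^sub>R (C (sqrt \<delta> *\<^sub>R z) * of_real (ghat \<delta> (sqrt \<delta> *\<^sub>R z))) = ?H \<delta> z"
        by (metis mult_scaleR_right of_real_mult scaleR_conv_of_real)
    qed
    finally show ?thesis .
  qed
  have "(\<lambda>n. LBINT z. ?H (\<epsilon> n) z) \<longlonglongrightarrow> (\<integral>z. C 0 * of_real (gauss 1 z) \<partial>(lborel::'a measure))"
  proof (rule integral_dominated_convergence[where w="\<lambda>z. L2norm f * L2norm h * gauss 1 z"])
    show "integrable lborel (\<lambda>z::'a. L2norm f * L2norm h * gauss 1 z)"
      by (intro integrable_mult_right gauss_integrable) auto
    show "AE z in lborel. (\<lambda>n. ?H (\<epsilon> n) z) \<longlonglongrightarrow> C 0 * of_real (gauss 1 z)"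
    proof (intro AE_I2 tendsto_mult tendsto_const)
      fix z :: 'a
      have "(\<lambda>n. sqrt (\<epsilon> n) *\<^sub>R z) \<longlonglongrightarrow> 0"
        using tendsto_scaleR[OF tendsto_real_sqrt[OF e(2)] tendsto_const, of z] by simp
      from L2_translation_weakly_continuous[OF f h this]
      show "(\<lambda>n. C (sqrt (\<epsilon> n) *\<^sub>R z)) \<longlonglongrightarrow> C 0" by (simp add: C_def)
    qed
    show "AE z in lborel. norm (?H (\<epsilon> n) z) \<le> L2norm f * L2norm h * gauss 1 z" for n
      using Cb by (auto simp: norm_mult intro!: mult_right_mono)
  qed measurable
  moreover have "(\<integral>z. C 0 * of_real (gauss 1 z) \<partial>(lborel::'a measure)) = C 0"
    by (simp add: integral_gauss)
  ultimately have "(\<lambda>n. LBINT z. ?H (\<epsilon> n) z) \<longlonglongrightarrow> C 0"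
    by metis
  then show ?thesis unfolding 1[OF e(1)] by (simp add: C_def)
qed

section \<open>The Plancherel theorem\<close>

lemma cmod_fourier_kernel [simp]: "cmod (exp (- (2 * complex_of_real pi * \<i> * complex_of_real t))) = 1"
  by (simp add: norm_exp_eq_Re)

lemma cmod_inverse_fourier_kernel [simp]: "cmod (exp (2 * complex_of_real pi * \<i> * complex_of_real t)) = 1"
  by (simp add: norm_exp_eq_Re)

lemma fourier_L1_measurable [measurable]:
  assumes [measurable]: "g \<in> borel_measurable borel"
  shows "fourier_L1 g \<in> borel_measurable borel"
proof -
  have "(\<lambda>\<xi>. \<integral>x. fker (x \<bullet> \<xi>) * g x \<partial>lborel) \<in> borel_measurable lborel"
    by measurable
  then show ?thesis by (simp add: fourier_L1_def[abs_def])
qed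

lemma fourier_L1_bound: "cmod (fourier_L1 g \<xi>) \<le> (LBINT x. cmod (g x))"
  unfolding fourier_L1_def
  by (rule order_trans[OF integral_norm_bound]) (simp add: norm_mult)

lemma integrable_fourier_kernel_mult:
  assumes "integrable lborel g"
  shows "integrable lborel (\<lambda>x. fker (x \<bullet> \<xi>) * g x)"
  using assms by (rule integrable_dominated) (use assms in \<open>auto simp: norm_mult\<close>)

lemma fourier_L1_mult_formula:
  fixes f g :: "'a::euclidean_space \<Rightarrow> complex"
  assumes f: "integrable lborel f" and g: "integrable lborel g"
  shows "(LBINT \<xi>. fourier_L1 f \<xi> * g \<xi>) = (LBINT x. f x * fourier_L1 g x)"
proof -
  have [measurable]: "f \<in> borel_measurable borel" "g \<in> borel_measurable borel" using f g by auto
  let ?F = "\<lambda>x \<xi>. fker (x \<bullet> \<xi>) * f x * g \<xi>"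
  have int: "integrable (lborel \<Otimes>\<^sub>M lborel) (case_prod ?F)"
  proof (rule integrableI_bounded)
    have "(\<integral>\<^sup>+ z. ennreal (norm (case_prod ?F z)) \<partial>(lborel \<Otimes>\<^sub>M lborel))
      = (NNINT x. \<integral>\<^sup>+y. ennreal (cmod (f x)) * ennreal (cmod (g y)) \<partial>lborel)"
      by (subst lborel.nn_integral_fst[symmetric]) (auto simp: norm_mult ennreal_mult')
    also have "\<dots> = (NNINT x. ennreal (cmod (f x))) * (NNINT y. ennreal (cmod (g y)))"
      by (simp add: nn_integral_cmult nn_integral_multc)
    also have "\<dots> < \<infinity>"
      using f g by (simp add: integrable_iff_bounded ennreal_mult_less_top)
    finally show "(\<integral>\<^sup>+ z. ennreal (norm (case_prod ?F z)) \<partial>(lborel \<Otimes>\<^sub>M lborel)) < \<infinity>" .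
  qed measurable
  have "(LBINT \<xi>. fourier_L1 f \<xi> * g \<xi>) = (LBINT \<xi>. \<integral>x. ?F x \<xi> \<partial>lborel)"
    unfolding fourier_L1_def by simp
  also have "\<dots> = (LBINT x. \<integral>\<xi>. ?F x \<xi> \<partial>lborel)"
    using lborel_pair.Fubini_integral[OF int] by simp
  also have "\<dots> = (LBINT x. f x * fourier_L1 g x)"
    unfolding fourier_L1_def
    by (subst integral_mult_right_zero[symmetric])
       (intro LBINT_cong refl, simp add: inner_commute mult_ac)
  finally show ?thesis .
qed

definition inv_fourier :: "('a::euclidean_space \<Rightarrow> complex) \<Rightarrow> 'a \<Rightarrow> complex" where
  "inv_fourier g x = fourier_L1 g (- x)"

lemma inv_fourier_measurable [measurable]:
  assumes [measurable]: "g \<in> borel_measurable borel"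
  shows "inv_fourier g \<in> borel_measurable borel"
  unfolding inv_fourier_def[abs_def] by measurable

lemma inv_fourier_reflect:
  assumes [measurable]: "h \<in> borel_measurable borel"
  shows "inv_fourier h \<xi> = fourier_L1 (\<lambda>x. h (- x)) \<xi>"
  unfolding inv_fourier_def fourier_L1_def
  by (subst integral_lborel_reflect[symmetric, where a=0]) auto

lemma cnj_inv_fourier: "cnj (inv_fourier h \<xi>) = fourier_L1 (\<lambda>x. cnj (h x)) \<xi>"
proof -
  have "cnj (inv_fourier h \<xi>) = (LBINT x. cnj (fker (x \<bullet> - \<xi>) * h x))"
    unfolding inv_fourier_def fourier_L1_def by (rule Bochner_Integration.integral_cnj[symmetric])
  also have "\<dots> = fourier_L1 (\<lambda>x. cnj (h x)) \<xi>"
    unfolding fourier_L1_def by (intro LBINT_cong refl) (simp add: exp_cnj)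
  finally show ?thesis .
qed

lemma integrable_inv_fourier_gauss:
  fixes h :: "'a::euclidean_space \<Rightarrow> complex"
  assumes h: "integrable lborel h" and e: "0 < \<epsilon>"
  shows "integrable lborel (\<lambda>\<xi>. inv_fourier h \<xi> * of_real (gauss \<epsilon> \<xi>))"
proof (rule integrable_dominated)
  show "integrable lborel (\<lambda>\<xi>::'a. (LBINT x. cmod (h x)) * gauss \<epsilon> \<xi>)"
    by (intro integrable_mult_right gauss_integrable e)
  have "cmod (inv_fourier h \<xi>) \<le> (LBINT x. cmod (h x))" for \<xi>
    unfolding inv_fourier_def by (rule fourier_L1_bound)
  then show "AE \<xi> in lborel. norm (inv_fourier h \<xi> * of_real (gauss \<epsilon> \<xi>)) \<le> norm ((LBINT x. cmod (h x)) * gauss \<epsilon> \<xi>)"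
    by (auto simp: norm_mult abs_mult intro!: mult_mono)
qed (use h in measurable)

text \<open>Regularised inversion: the Gaussian factor restores integrability, the multiplication
  formula moves the transform from the reflected h to a modulated Gaussian, and modulation becomes a
  shift of \<open>ghat\<close>.\<close>

lemma fourier_inv_fourier_gauss:
  fixes h :: "'a::euclidean_space \<Rightarrow> complex"
  assumes h: "integrable lborel h" and e: "0 < \<epsilon>"
  shows "fourier_L1 (\<lambda>\<xi>. inv_fourier h \<xi> * of_real (gauss \<epsilon> \<xi>)) x = (LBINT y. h (x + y) * of_real (ghat \<epsilon> y))"
proof -
  have [measurable]: "h \<in> borel_measurable borel" using h by simp
  let ?k = "\<lambda>\<xi>. fker (\<xi> \<bullet> x) * of_real (gauss \<epsilon> \<xi>)"
  have k: "integrable lborel ?k"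
    by (intro integrable_fourier_kernel_mult integrable_of_real gauss_integrable e)
  have hm: "integrable lborel (\<lambda>x. h (- x))" using integrable_lborel_reflect[OF h, of 0] by simp
  have "fourier_L1 (\<lambda>\<xi>. inv_fourier h \<xi> * of_real (gauss \<epsilon> \<xi>)) x = (LBINT \<xi>. fourier_L1 (\<lambda>x. h (- x)) \<xi> * ?k \<xi>)"
    unfolding fourier_L1_def[of "\<lambda>\<xi>. inv_fourier h \<xi> * of_real (gauss \<epsilon> \<xi>)"]
    by (intro LBINT_cong) (auto simp: inv_fourier_reflect mult_ac)
  also have "\<dots> = (LBINT y. h (- y) * fourier_L1 ?k y)"
    by (rule fourier_L1_mult_formula[OF hm k])
  also have "\<dots> = (LBINT y. h (- y) * of_real (ghat \<epsilon> (x + y)))"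
  proof -
    have "fourier_L1 ?k y = of_real (ghat \<epsilon> (x + y))" for y
      unfolding gauss_Fourier[OF e, symmetric] fourier_L1_def
      by (intro LBINT_cong) (auto simp: inner_add_right algebra_simps exp_add[symmetric])
    then show ?thesis by simp
  qed
  also have "\<dots> = (LBINT y. h (x + y) * of_real (ghat \<epsilon> y))"
    by (subst integral_lborel_reflect[symmetric, where a="- x"]) (auto simp: ghat_def add.commute)
  finally show ?thesis .
qed

definition eps_seq :: "nat \<Rightarrow> real" where "eps_seq n = 1 / real (Suc n)"

lemma eps_seq: "0 < eps_seq n" "eps_seq \<longlonglongrightarrow> 0"
  using LIMSEQ_inverse_real_of_nat by (auto simp: eps_seq_def[abs_def] inverse_eq_divide)

lemma eps_seq_antimono: "m \<le> n \<Longrightarrow> eps_seq n \<le> eps_seq m"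
  by (auto simp: eps_seq_def frac_le)

lemma gauss_eps_seq_tendsto: "(\<lambda>n. gauss (eps_seq n) x) \<longlonglongrightarrow> 1"
proof -
  have "(\<lambda>n. exp (- (pi * eps_seq n * (norm x)\<^sup>2))) \<longlonglongrightarrow> exp (- (pi * 0 * (norm x)\<^sup>2))"
    by (intro tendsto_intros eps_seq(2))
  then show ?thesis by (simp add: gauss_def)
qed

lemma gauss_regularize_limit:
  fixes F :: "'a::euclidean_space \<Rightarrow> complex"
  assumes F: "integrable lborel F"
  shows "(\<lambda>n. LBINT x. F x * of_real (gauss (eps_seq n) x)) \<longlonglongrightarrow> integral\<^sup>L lborel F"
proof (rule integral_dominated_convergence[where w="\<lambda>x. cmod (F x)"])
  show "AE x in lborel. (\<lambda>n. F x * of_real (gauss (eps_seq n) x)) \<longlonglongrightarrow> F x"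
  proof (rule AE_I2)
    fix x
    have "(\<lambda>n. F x * of_real (gauss (eps_seq n) x)) \<longlonglongrightarrow> F x * of_real 1"
      by (intro tendsto_intros gauss_eps_seq_tendsto)
    then show "(\<lambda>n. F x * of_real (gauss (eps_seq n) x)) \<longlonglongrightarrow> F x" by simp
  qed
  show "AE x in lborel. norm (F x * of_real (gauss (eps_seq n) x)) \<le> cmod (F x)" for n
    by (intro AE_I2) (simp add: norm_mult mult_left_le gauss_le_1 less_imp_le[OF eps_seq(1)])
qed (use F in auto)

text \<open>The Gaussian-weighted integrals of the squared modulus increase along
  \<open>eps_seq\<close>, and by regularised inversion they converge to the squared norm of h.
  Monotone convergence therefore yields square integrability and the value of the norm at
  once.\<close>

lemma inv_fourier_Plancherel:
  fixes h :: "'a::euclidean_space \<Rightarrow> complex"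
  assumes h: "sq_int h" "integrable lborel h"
  shows "sq_int (inv_fourier h)" "L2norm (inv_fourier h) = L2norm h"
proof -
  note [measurable] = sq_int_measurable[OF h(1)]
  let ?g = "\<lambda>n \<xi>. inv_fourier h \<xi> * of_real (gauss (eps_seq n) \<xi>)"
  let ?u = "\<lambda>n \<xi>. (cmod (inv_fourier h \<xi>))\<^sup>2 * gauss (eps_seq n) \<xi>"
  have ic: "integrable lborel (\<lambda>x. cnj (h x))" using h(2) by simp
  have eq: "complex_of_real (?u n \<xi>) = fourier_L1 (\<lambda>x. cnj (h x)) \<xi> * ?g n \<xi>" for n \<xi>
    unfolding of_real_mult complex_norm_square by (simp add: cnj_inv_fourier[symmetric])
  have ug: "integrable lborel (\<lambda>\<xi>. complex_of_real (?u n \<xi>))" for n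
    unfolding eq
  proof (rule integrable_dominated)
    show "integrable lborel (\<lambda>\<xi>. (LBINT x. cmod (cnj (h x))) * cmod (?g n \<xi>))"
      by (intro integrable_mult_right integrable_norm integrable_inv_fourier_gauss h eps_seq)
    show "AE x in lborel. norm (fourier_L1 (\<lambda>x. cnj (h x)) x * ?g n x) \<le> norm ((LBINT x. cmod (cnj (h x))) * cmod (?g n x))"
    proof (rule AE_I2)
      fix x
      have "cmod (fourier_L1 (\<lambda>x. cnj (h x)) x) \<le> (LBINT x. cmod (cnj (h x)))" by (rule fourier_L1_bound)
      then have "cmod (fourier_L1 (\<lambda>x. cnj (h x)) x) * cmod (?g n x) \<le> (LBINT x. cmod (cnj (h x))) * cmod (?g n x)"
        by (rule mult_right_mono) simp
      then show "norm (fourier_L1 (\<lambda>x. cnj (h x)) x * ?g n x) \<le> norm ((LBINT x. cmod (cnj (h x))) * cmod (?g n x))"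
        by (metis abs_ge_self norm_mult order_trans real_norm_def)
    qed
    show "(\<lambda>\<xi>. fourier_L1 (\<lambda>x. cnj (h x)) \<xi> * ?g n \<xi>) \<in> borel_measurable lborel"
      using ic by measurable
  qed
  then have ui: "integrable lborel (?u n)" for n
    using integrable_Re[OF ug[of n]] by simp
  have lim: "(\<lambda>n. integral\<^sup>L lborel (?u n)) \<longlonglongrightarrow> (L2norm h)\<^sup>2"
  proof -
    have "(\<lambda>n. LBINT x. cnj (h x) * fourier_L1 (?g n) x) \<longlonglongrightarrow> (LBINT x. cnj (h x) * h x)"
      unfolding fourier_inv_fourier_gauss[OF h(2) eps_seq(1)]
      by (intro gauss_approximate_identity sq_int_cnj h eps_seq)
    moreover have "(LBINT x. cnj (h x) * fourier_L1 (?g n) x) = of_real (integral\<^sup>L lborel (?u n))" for n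
    proof -
      have "(LBINT x. cnj (h x) * fourier_L1 (?g n) x) = (LBINT \<xi>. fourier_L1 (\<lambda>x. cnj (h x)) \<xi> * ?g n \<xi>)"
        by (rule fourier_L1_mult_formula[symmetric, OF ic integrable_inv_fourier_gauss[OF h(2) eps_seq(1)]])
      also have "\<dots> = (LBINT \<xi>. of_real (?u n \<xi>))" by (simp only: eq)
      also have "\<dots> = of_real (integral\<^sup>L lborel (?u n))" by (rule integral_complex_of_real)
      finally show ?thesis .
    qed
    moreover have "(LBINT x. cnj (h x) * h x) = of_real ((L2norm h)\<^sup>2)"
      unfolding L2norm_square integral_complex_of_real[symmetric]
      by (intro LBINT_cong) (simp_all only: complex_norm_square mult.commute)
    ultimately have "(\<lambda>n. complex_of_real (integral\<^sup>L lborel (?u n))) \<longlonglongrightarrow> of_real ((L2norm h)\<^sup>2)" by simp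
    then show ?thesis by (simp only: tendsto_of_real_iff)
  qed
  have mono: "AE x in lborel. mono (\<lambda>n. ?u n x)"
    by (intro AE_I2 monoI mult_left_mono) (auto simp: gauss_def intro!: mult_left_mono mult_right_mono eps_seq_antimono)
  have pt: "AE x in lborel. (\<lambda>n. ?u n x) \<longlonglongrightarrow> (cmod (inv_fourier h x))\<^sup>2"
  proof (rule AE_I2)
    fix x
    have "(\<lambda>n. ?u n x) \<longlonglongrightarrow> (cmod (inv_fourier h x))\<^sup>2 * 1"
      by (intro tendsto_intros gauss_eps_seq_tendsto)
    then show "(\<lambda>n. ?u n x) \<longlonglongrightarrow> (cmod (inv_fourier h x))\<^sup>2" by simp
  qed
  have i: "integrable lborel (\<lambda>x. (cmod (inv_fourier h x))\<^sup>2)"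
    by (rule integrable_monotone_convergence[OF ui mono pt lim]) measurable
  then show "sq_int (inv_fourier h)" by (simp add: sq_int_def)
  have "(LBINT x. (cmod (inv_fourier h x))\<^sup>2) = (L2norm h)\<^sup>2"
    by (rule integral_monotone_convergence[OF ui mono pt lim]) measurable
  then show "L2norm (inv_fourier h) = L2norm h"
    unfolding L2norm_def[of "inv_fourier h"] by simp
qed

lemma sq_int_fourier_L1:
  assumes "sq_int g" "integrable lborel g"
  shows "sq_int (fourier_L1 g)" "L2norm (fourier_L1 g) = L2norm g"
  using sq_int_reflect[OF inv_fourier_Plancherel(1)[OF assms]] inv_fourier_Plancherel(2)[OF assms]
  by (simp_all add: inv_fourier_def)

lemma fourier_L2I:
  fixes \<phi> \<psi> :: "'a::euclidean_space \<Rightarrow> complex"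
  assumes "sq_int \<phi>" "sq_int \<psi>"
    and "\<And>g. sq_int g \<Longrightarrow> integrable lborel g \<Longrightarrow> (LBINT \<xi>. \<psi> \<xi> * g \<xi>) = (LBINT x. \<phi> x * fourier_L1 g x)"
  shows "fourier_L2 \<phi> \<psi>"
  using assms by (simp add: fourier_L2_def)

text \<open>This ties the integral formula to the characterisation by duality. After inserting a
  Gaussian, one side converges by dominated convergence and the other by the approximate
  identity.\<close>

lemma fourier_L2_inv_fourier:
  fixes h :: "'a::euclidean_space \<Rightarrow> complex"
  assumes h: "sq_int h" "integrable lborel h"
  shows "fourier_L2 (inv_fourier h) h"
proof (rule fourier_L2I)
  show "sq_int (inv_fourier h)" by (rule inv_fourier_Plancherel[OF h])
  show "sq_int h" by fact
  fix g :: "'a \<Rightarrow> complex" assume g: "sq_int g" "integrable lborel g"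
  have "(\<lambda>n. LBINT x. inv_fourier h x * fourier_L1 g x * of_real (gauss (eps_seq n) x))
      \<longlonglongrightarrow> (LBINT x. inv_fourier h x * fourier_L1 g x)"
    by (intro gauss_regularize_limit integrable_sq_int_mult inv_fourier_Plancherel h sq_int_fourier_L1 g)
  moreover have "(LBINT x. inv_fourier h x * fourier_L1 g x * of_real (gauss (eps_seq n) x))
      = (LBINT x. g x * (LBINT y. h (x + y) * of_real (ghat (eps_seq n) y)))" for n
  proof -
    have "(LBINT x. inv_fourier h x * fourier_L1 g x * of_real (gauss (eps_seq n) x))
      = (LBINT x. fourier_L1 g x * (inv_fourier h x * of_real (gauss (eps_seq n) x)))"
      by (intro LBINT_cong) auto
    also have "\<dots> = (LBINT x. g x * fourier_L1 (\<lambda>x. inv_fourier h x * of_real (gauss (eps_seq n) x)) x)"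
      by (intro fourier_L1_mult_formula g integrable_inv_fourier_gauss h eps_seq)
    finally show ?thesis by (simp add: fourier_inv_fourier_gauss[OF h(2) eps_seq(1)])
  qed
  moreover have "(\<lambda>n. LBINT x. g x * (LBINT y. h (x + y) * of_real (ghat (eps_seq n) y))) \<longlonglongrightarrow> (LBINT x. g x * h x)"
    by (intro gauss_approximate_identity g h eps_seq)
  ultimately have "(LBINT x. inv_fourier h x * fourier_L1 g x) = (LBINT x. g x * h x)"
    using LIMSEQ_unique by simp
  then show "(LBINT \<xi>. h \<xi> * g \<xi>) = (LBINT x. inv_fourier h x * fourier_L1 g x)"
    by (simp add: mult.commute)
qed

lemma fourier_L2_sq_int: "fourier_L2 \<phi> \<psi> \<Longrightarrow> sq_int \<phi>" "fourier_L2 \<phi> \<psi> \<Longrightarrow> sq_int \<psi>"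
  by (auto simp: fourier_L2_def)

lemma fourier_L2_testD:
  assumes "fourier_L2 \<phi> \<psi>" "sq_int g" "integrable lborel g"
  shows "(LBINT \<xi>. \<psi> \<xi> * g \<xi>) = (LBINT x. \<phi> x * fourier_L1 g x)"
  using assms by (auto simp: fourier_L2_def)

text \<open>The counterpart of the defining identity, with the test function on the side of \<phi>.
  It comes from testing with the inverse transform of h times a Gaussian, which is integrable even
  when the inverse transform is not, and removing the Gaussian in the limit.\<close>

lemma fourier_L2_pairing:
  fixes h :: "'a::euclidean_space \<Rightarrow> complex"
  assumes F: "fourier_L2 \<phi> \<psi>" and h: "sq_int h" "integrable lborel h"
  shows "(LBINT x. \<phi> x * h x) = (LBINT \<xi>. \<psi> \<xi> * inv_fourier h \<xi>)"
proof -
  note [measurable] = sq_int_measurable[OF h(1)]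
  note s = fourier_L2_sq_int[OF F]
  have lim: "(\<lambda>n. LBINT x. \<psi> x * inv_fourier h x * of_real (gauss (eps_seq n) x))
      \<longlonglongrightarrow> (LBINT x. \<psi> x * inv_fourier h x)"
    by (intro gauss_regularize_limit integrable_sq_int_mult inv_fourier_Plancherel h s)
  have "(LBINT x. \<psi> x * inv_fourier h x * of_real (gauss (eps_seq n) x))
      = (LBINT x. \<phi> x * (LBINT y. h (x + y) * of_real (ghat (eps_seq n) y)))" for n
  proof -
    have "sq_int (\<lambda>x. inv_fourier h x * of_real (gauss (eps_seq n) x))"
      by (rule L2norm_bound(1)[OF inv_fourier_Plancherel(1)[OF h], of _ 1])
         (auto simp: norm_mult gauss_le_1[OF less_imp_le[OF eps_seq(1)]] intro!: mult_left_le)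
    from fourier_L2_testD[OF F this integrable_inv_fourier_gauss[OF h(2) eps_seq(1)]]
    show ?thesis by (simp add: fourier_inv_fourier_gauss[OF h(2) eps_seq(1)] mult.assoc)
  qed
  with lim have "(\<lambda>n. LBINT x. \<phi> x * (LBINT y. h (x + y) * of_real (ghat (eps_seq n) y)))
      \<longlonglongrightarrow> (LBINT x. \<psi> x * inv_fourier h x)" by simp
  moreover have "(\<lambda>n. LBINT x. \<phi> x * (LBINT y. h (x + y) * of_real (ghat (eps_seq n) y))) \<longlonglongrightarrow> (LBINT x. \<phi> x * h x)"
    by (intro gauss_approximate_identity s h eps_seq)
  ultimately show ?thesis using LIMSEQ_unique by blast
qed

text \<open>Testing with the conjugate of a truncation gives N^2 \<le> c N for its norm N; the norms
  of the truncations converge to that of f.\<close>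

lemma L2norm_le_by_duality:
  fixes f :: "'a::euclidean_space \<Rightarrow> complex"
  assumes f: "sq_int f" and "0 \<le> c"
    and b: "\<And>h. sq_int h \<Longrightarrow> integrable lborel h \<Longrightarrow> cmod (LBINT x. f x * h x) \<le> c * L2norm h"
  shows "L2norm f \<le> c"
proof (rule LIMSEQ_le_const2[OF truncate_L2(2)[OF f]], intro exI allI impI)
  fix N :: nat
  note [measurable] = sq_int_measurable[OF f]
  let ?h = "\<lambda>x. cnj (truncate N f x)"
  have h: "sq_int ?h" "integrable lborel ?h"
    using sq_int_cnj[OF sq_int_truncate[OF f]] truncate_integrable[of f N] by auto
  have "(LBINT x. f x * ?h x) = (LBINT x. of_real ((cmod (truncate N f x))\<^sup>2))"
    unfolding complex_norm_square by (intro LBINT_cong) (auto simp: truncate_def)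
  also have "\<dots> = of_real ((L2norm (truncate N f))\<^sup>2)"
    unfolding L2norm_square by (rule integral_complex_of_real)
  finally have "(L2norm (truncate N f))\<^sup>2 \<le> c * L2norm (truncate N f)"
    using b[OF h] by (simp add: norm_power)
  then show "L2norm (truncate N f) \<le> c"
    by (cases "L2norm (truncate N f) = 0") (auto simp: power2_eq_square less_le \<open>0 \<le> c\<close>)
qed

text \<open>Each inequality is duality: the pairing passes to the other side, where the transformed
  test function has an unchanged L^2 norm.\<close>

lemma fourier_L2_Plancherel:
  assumes F: "fourier_L2 \<phi> \<psi>"
  shows "L2norm \<psi> = L2norm \<phi>"
proof (rule antisym)
  note s = fourier_L2_sq_int[OF F]
  show "L2norm \<psi> \<le> L2norm \<phi>"
  proof (rule L2norm_le_by_duality[OF s(2) L2norm_nonneg])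
    fix h :: "'a \<Rightarrow> complex" assume h: "sq_int h" "integrable lborel h"
    show "cmod (LBINT x. \<psi> x * h x) \<le> L2norm \<phi> * L2norm h"
      unfolding fourier_L2_testD[OF F h]
      using L2_Cauchy_Schwarz[OF s(1) sq_int_fourier_L1(1)[OF h]] by (simp add: sq_int_fourier_L1(2)[OF h])
  qed
  show "L2norm \<phi> \<le> L2norm \<psi>"
  proof (rule L2norm_le_by_duality[OF s(1) L2norm_nonneg])
    fix h :: "'a \<Rightarrow> complex" assume h: "sq_int h" "integrable lborel h"
    show "cmod (LBINT x. \<phi> x * h x) \<le> L2norm \<psi> * L2norm h"
      unfolding fourier_L2_pairing[OF F h]
      using L2_Cauchy_Schwarz[OF s(2) inv_fourier_Plancherel(1)[OF h]] by (simp add: inv_fourier_Plancherel(2)[OF h])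
  qed
qed

lemma fourier_L2_add:
  assumes 1: "fourier_L2 \<phi>1 \<psi>1" and 2: "fourier_L2 \<phi>2 \<psi>2"
  shows "fourier_L2 (\<lambda>x. \<phi>1 x + \<phi>2 x) (\<lambda>\<xi>. \<psi>1 \<xi> + \<psi>2 \<xi>)"
proof (rule fourier_L2I)
  note s = fourier_L2_sq_int[OF 1] fourier_L2_sq_int[OF 2]
  show "sq_int (\<lambda>x. \<phi>1 x + \<phi>2 x)" "sq_int (\<lambda>\<xi>. \<psi>1 \<xi> + \<psi>2 \<xi>)" by (intro sq_int_add s)+
  fix g :: "'a \<Rightarrow> complex" assume g: "sq_int g" "integrable lborel g"
  note gh = sq_int_fourier_L1(1)[OF g]
  show "(LBINT \<xi>. (\<psi>1 \<xi> + \<psi>2 \<xi>) * g \<xi>) = (LBINT x. (\<phi>1 x + \<phi>2 x) * fourier_L1 g x)"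
    using fourier_L2_testD[OF 1 g] fourier_L2_testD[OF 2 g]
    by (simp add: distrib_right integrable_sq_int_mult s g gh)
qed

lemma fourier_L2_cmult:
  assumes 1: "fourier_L2 \<phi> \<psi>"
  shows "fourier_L2 (\<lambda>x. c * \<phi> x) (\<lambda>\<xi>. c * \<psi> \<xi>)"
  using assms unfolding fourier_L2_def by (auto simp: sq_int_cmult mult.assoc)

lemma fourier_L2_diff:
  assumes 1: "fourier_L2 \<phi>1 \<psi>1" and 2: "fourier_L2 \<phi>2 \<psi>2"
  shows "fourier_L2 (\<lambda>x. \<phi>1 x - \<phi>2 x) (\<lambda>\<xi>. \<psi>1 \<xi> - \<psi>2 \<xi>)"
  using fourier_L2_add[OF 1 fourier_L2_cmult[OF 2, of "-1"]] by simp

text \<open>\<open>is_Dpow\<close> and \<open>in_H\<close> choose a transform existentially.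
  Plancherel for the difference shows that such choices agree almost everywhere, and also that the
  transform determines the function.\<close>

lemma fourier_L2_unique:
  assumes 1: "fourier_L2 \<phi>1 \<psi>1" and 2: "fourier_L2 \<phi>2 \<psi>2"
  shows "(AE x in lborel. \<phi>1 x = \<phi>2 x) \<longleftrightarrow> (AE \<xi> in lborel. \<psi>1 \<xi> = \<psi>2 \<xi>)"
proof -
  note D = fourier_L2_diff[OF 1 2]
  have z: "L2norm f = 0 \<longleftrightarrow> (AE x in lborel. f x = 0)" if "sq_int f" for f :: "'a \<Rightarrow> complex"
    using that integral_nonneg_eq_0_iff_AE[of lborel "\<lambda>x. (cmod (f x))\<^sup>2"] by (auto simp: L2norm_def sq_int_def)
  show ?thesis
    using z[OF fourier_L2_sq_int(1)[OF D]] z[OF fourier_L2_sq_int(2)[OF D]] fourier_L2_Plancherel[OF D] by simp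
qed

section \<open>Translations and rotations under the Fourier transform\<close>

lemma fourier_L2_translate:
  fixes z :: "'a::euclidean_space"
  assumes F: "fourier_L2 \<phi> \<psi>"
  shows "fourier_L2 (\<lambda>x. \<phi> (x + z)) (\<lambda>\<xi>. ifker (z \<bullet> \<xi>) * \<psi> \<xi>)"
proof (rule fourier_L2I)
  note s = fourier_L2_sq_int[OF F]
  note [measurable] = sq_int_measurable[OF s(1)] sq_int_measurable[OF s(2)]
  show "sq_int (\<lambda>x. \<phi> (x + z))" by (rule sq_int_translate[OF s(1)])
  show "sq_int (\<lambda>\<xi>. ifker (z \<bullet> \<xi>) * \<psi> \<xi>)"
    by (rule L2norm_bound(1)[OF s(2), of _ 1]) (auto simp: norm_mult)
  fix g :: "'a \<Rightarrow> complex" assume g: "sq_int g" "integrable lborel g"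
  note [measurable] = sq_int_measurable[OF g(1)]
  let ?g = "\<lambda>\<xi>. ifker (z \<bullet> \<xi>) * g \<xi>"
  have g': "sq_int ?g" by (rule L2norm_bound(1)[OF g(1), of _ 1]) (auto simp: norm_mult)
  have g'': "integrable lborel ?g"
    using g(2) by (rule integrable_dominated) (auto simp: norm_mult)
  have sh: "fourier_L1 ?g (x + z) = fourier_L1 g x" for x
  proof -
    have "fker (\<xi> \<bullet> (x + z)) * ?g \<xi> = fker (\<xi> \<bullet> x) * g \<xi>" for \<xi>
    proof -
      have "- (2 * pi * \<i> * complex_of_real (\<xi> \<bullet> (x + z))) + 2 * pi * \<i> * complex_of_real (z \<bullet> \<xi>) = - (2 * pi * \<i> * complex_of_real (\<xi> \<bullet> x))"
        by (simp add: inner_add_right inner_commute[of z] distrib_left)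
      then show ?thesis by (metis exp_add mult.assoc)
    qed
    then show ?thesis unfolding fourier_L1_def by (simp only:)
  qed
  have "(LBINT \<xi>. ifker (z \<bullet> \<xi>) * \<psi> \<xi> * g \<xi>) = (LBINT \<xi>. \<psi> \<xi> * ?g \<xi>)"
    by (intro LBINT_cong) auto
  also have "\<dots> = (LBINT x. \<phi> x * fourier_L1 ?g x)" by (rule fourier_L2_testD[OF F g' g''])
  also have "\<dots> = (LBINT x. \<phi> (x + z) * fourier_L1 ?g (x + z))"
    by (rule integral_lborel_translate[symmetric]) measurable
  finally show "(LBINT \<xi>. ifker (z \<bullet> \<xi>) * \<psi> \<xi> * g \<xi>) = (LBINT x. \<phi> (x + z) * fourier_L1 g x)"
    by (simp only: sh)
qed

lemma integral_lborel_orthogonal: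
  fixes Q :: "'a::euclidean_space \<Rightarrow> 'a" and f :: "'a \<Rightarrow> 'b::{banach,second_countable_topology}"
  assumes Q: "orthogonal_transformation Q" and [measurable]: "f \<in> borel_measurable borel"
  shows "(LBINT x. f (Q x)) = integral\<^sup>L lborel f"
proof -
  note [measurable] = orthogonal_measurable[OF Q]
  have "integral\<^sup>L lborel f = integral\<^sup>L (distr lborel borel Q) f" by (simp add: lborel_distr_orthogonal[OF Q])
  also have "\<dots> = (LBINT x. f (Q x))" by (rule integral_distr) auto
  finally show ?thesis by simp
qed

lemma integrable_lborel_orthogonal:
  fixes Q :: "'a::euclidean_space \<Rightarrow> 'a" and f :: "'a \<Rightarrow> 'b::{banach,second_countable_topology}"
  assumes Q: "orthogonal_transformation Q" and f: "integrable lborel f"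
  shows "integrable lborel (\<lambda>x. f (Q x))"
proof -
  note [measurable] = orthogonal_measurable[OF Q]
  have "integrable (distr lborel borel Q) f" using f by (simp add: lborel_distr_orthogonal[OF Q])
  then show ?thesis using f by (subst (asm) integrable_distr_eq) auto
qed

lemma sq_int_orthogonal:
  fixes Q :: "'a::euclidean_space \<Rightarrow> 'a"
  assumes Q: "orthogonal_transformation Q" and f: "sq_int f"
  shows "sq_int (\<lambda>x. f (Q x))"
  using integrable_lborel_orthogonal[OF Q, of "\<lambda>x. (cmod (f x))\<^sup>2"] f
    measurable_compose[OF orthogonal_measurable[OF Q], of f borel]
  by (simp add: sq_int_def)

lemma fourier_L2_orthogonal:
  fixes Q :: "'a::euclidean_space \<Rightarrow> 'a"
  assumes Q: "orthogonal_transformation Q" and F: "fourier_L2 \<phi> \<psi>"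
  shows "fourier_L2 (\<lambda>x. \<phi> (Q x)) (\<lambda>\<xi>. \<psi> (Q \<xi>))"
proof (rule fourier_L2I)
  note s = fourier_L2_sq_int[OF F]
  note [measurable] = sq_int_measurable[OF s(1)] sq_int_measurable[OF s(2)]
  show "sq_int (\<lambda>x. \<phi> (Q x))" "sq_int (\<lambda>\<xi>. \<psi> (Q \<xi>))" using sq_int_orthogonal[OF Q s(1)] sq_int_orthogonal[OF Q s(2)] by auto
  fix g :: "'a \<Rightarrow> complex" assume g: "sq_int g" "integrable lborel g"
  \<comment> \<open>Composing the test function with the inverse rotation lets both sides be read
    after the change of variables by Q.\<close>
  define P where "P = inv Q"
  have P: "orthogonal_transformation P" unfolding P_def by (rule orthogonal_transformation_inv[OF Q])
  have PQ: "P (Q x) = x" for x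
    unfolding P_def using orthogonal_transformation_inj[OF Q] by (simp add: inv_f_f)
  note [measurable] = sq_int_measurable[OF g(1)] orthogonal_measurable[OF P] orthogonal_measurable[OF Q]
  have g': "sq_int (\<lambda>x. g (P x))" "integrable lborel (\<lambda>x. g (P x))"
    using sq_int_orthogonal[OF P g(1)] integrable_lborel_orthogonal[OF P g(2)] by auto
  have sh: "fourier_L1 (\<lambda>x. g (P x)) (Q x) = fourier_L1 g x" for x
  proof -
    have "fourier_L1 (\<lambda>x. g (P x)) (Q x) = (LBINT y. fker (Q y \<bullet> Q x) * g (P (Q y)))"
      unfolding fourier_L1_def
      by (rule integral_lborel_orthogonal[OF Q, symmetric]) measurable
    then show ?thesis using Q by (simp add: PQ orthogonal_transformation_def fourier_L1_def)
  qed
  have "(LBINT \<xi>. \<psi> (Q \<xi>) * g \<xi>) = (LBINT \<xi>. \<psi> (Q \<xi>) * g (P (Q \<xi>)))" by (simp add: PQ)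
  also have "\<dots> = (LBINT \<xi>. \<psi> \<xi> * g (P \<xi>))"
    by (rule integral_lborel_orthogonal[OF Q, of "\<lambda>\<xi>. \<psi> \<xi> * g (P \<xi>)"]) measurable
  also have "\<dots> = (LBINT x. \<phi> x * fourier_L1 (\<lambda>x. g (P x)) x)" by (rule fourier_L2_testD[OF F g'])
  also have "\<dots> = (LBINT x. \<phi> (Q x) * fourier_L1 (\<lambda>x. g (P x)) (Q x))"
    by (rule integral_lborel_orthogonal[OF Q, symmetric]) measurable
  finally show "(LBINT \<xi>. \<psi> (Q \<xi>) * g \<xi>) = (LBINT x. \<phi> (Q x) * fourier_L1 g x)"
    by (simp add: sh)
qed

section \<open>Sobolev embedding for exponents above two\<close>

abbreviation freq_weight :: "real \<Rightarrow> ('a::euclidean_space \<Rightarrow> complex) \<Rightarrow> 'a \<Rightarrow> complex" where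
  "freq_weight a \<psi> \<equiv> \<lambda>\<xi>. complex_of_real (norm \<xi> powr a) * \<psi> \<xi>"

text \<open>With t = L |\<xi>| one has t^(2a) \<le> 1 + t^(2S). The length L is chosen so that the
  two terms have equal integrals, which is the origin of the factor sqrt 2. The bound is kept in
  terms of L, the length used in all later estimates.\<close>

lemma weighted_L2_interpolation:
  fixes \<psi> :: "'a::euclidean_space \<Rightarrow> complex"
  assumes \<psi>: "sq_int \<psi>" and w: "sq_int (freq_weight S \<psi>)"
    and S: "0 < S" and a: "0 \<le> a" "a \<le> S"
    and A: "0 < L2norm \<psi>" and B: "0 < L2norm (freq_weight S \<psi>)"
  defines "L \<equiv> (L2norm \<psi> / L2norm (freq_weight S \<psi>)) powr (1 / S)"
  shows "sq_int (freq_weight a \<psi>)"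
    and "L2norm (freq_weight a \<psi>) \<le> sqrt 2 * (L2norm \<psi> * L powr - a)"
proof -
  note [measurable] = sq_int_measurable[OF \<psi>]
  let ?A = "L2norm \<psi>" and ?B = "L2norm (freq_weight S \<psi>)"
  have L: "0 < L" using A B by (simp add: L_def)
  have LS: "L powr (2 * S) * ?B\<^sup>2 = ?A\<^sup>2"
  proof -
    have "L powr (2 * S) = (?A / ?B) powr 2" using S by (simp add: L_def powr_powr)
    also have "\<dots> = (?A / ?B)\<^sup>2" using A B by (simp add: powr_numeral)
    finally show ?thesis using B by (simp add: power_divide)
  qed
  have pt: "(cmod (of_real (norm \<xi> powr a) * \<psi> \<xi>))\<^sup>2
     \<le> L powr (- (2 * a)) * ((cmod (\<psi> \<xi>))\<^sup>2 + L powr (2 * S) * (cmod (of_real (norm \<xi> powr S) * \<psi> \<xi>))\<^sup>2)" for \<xi>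
  \<comment> \<open>At the origin \<open>0 powr a\<close> is 0 for every a, including a = 0, so the
    left side vanishes there.\<close>
  proof (cases "\<xi> = 0")
    case False
    let ?t = "L * norm \<xi>"
    have t: "0 < ?t" using L False by simp
    have "?t powr (2 * a) \<le> 1 + ?t powr (2 * S)"
    proof (cases "?t \<le> 1")
      case True
      then have "?t powr (2 * a) \<le> 1 powr (2 * a)" using t a by (intro powr_mono2) auto
      then show ?thesis by (smt (verit) powr_ge_zero powr_one_eq_one)
    next
      case False
      then have "?t powr (2 * a) \<le> ?t powr (2 * S)" using a by (intro powr_mono) auto
      then show ?thesis by simp
    qed
    then have "L powr (- (2 * a)) * ?t powr (2 * a) \<le> L powr (- (2 * a)) * (1 + ?t powr (2 * S))"
      by (rule mult_left_mono) simp
    moreover have "L powr (- (2 * a)) * ?t powr (2 * a) = (norm \<xi> powr a)\<^sup>2"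
      using L by (simp add: powr_mult powr_minus field_simps power2_eq_square powr_add[symmetric])
    moreover have "?t powr (2 * S) = L powr (2 * S) * (norm \<xi> powr S)\<^sup>2"
      using L by (simp add: powr_mult power2_eq_square powr_add[symmetric])
    ultimately have "(norm \<xi> powr a)\<^sup>2 \<le> L powr (- (2 * a)) * (1 + L powr (2 * S) * (norm \<xi> powr S)\<^sup>2)" by simp
    then have "(norm \<xi> powr a)\<^sup>2 * (cmod (\<psi> \<xi>))\<^sup>2 \<le> L powr (- (2 * a)) * (1 + L powr (2 * S) * (norm \<xi> powr S)\<^sup>2) * (cmod (\<psi> \<xi>))\<^sup>2"
      by (rule mult_right_mono) simp
    then show ?thesis by (simp add: norm_mult power_mult_distrib algebra_simps)
  qed (simp add: norm_mult)
  have "(NNINT \<xi>. ennreal ((cmod (of_real (norm \<xi> powr a) * \<psi> \<xi>))\<^sup>2))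
      \<le> (NNINT \<xi>. ennreal (L powr (- (2 * a))) * (ennreal ((cmod (\<psi> \<xi>))\<^sup>2) + ennreal (L powr (2 * S)) * ennreal ((cmod (of_real (norm \<xi> powr S) * \<psi> \<xi>))\<^sup>2)))"
    using pt by (intro nn_integral_mono) (simp add: ennreal_mult'[symmetric] ennreal_plus[symmetric] ennreal_leI del: ennreal_plus)
  also have "\<dots> = ennreal (L powr (- (2 * a))) * (ennreal (?A\<^sup>2) + ennreal (L powr (2 * S)) * ennreal (?B\<^sup>2))"
    by (simp add: nn_integral_cmult nn_integral_add nn_integral_square_cmod[OF \<psi>] nn_integral_square_cmod[OF w])
  also have "\<dots> = ennreal (L powr (- (2 * a)) * (?A\<^sup>2 + L powr (2 * S) * ?B\<^sup>2))"
    by (simp add: ennreal_mult'[symmetric] ennreal_plus[symmetric] del: ennreal_plus)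
  also have "L powr (- (2 * a)) * (?A\<^sup>2 + L powr (2 * S) * ?B\<^sup>2) = (sqrt 2 * (?A * L powr - a))\<^sup>2"
  proof -
    have "(L powr - a)\<^sup>2 = L powr (- (2 * a))" using L by (simp add: power2_eq_square powr_add[symmetric])
    then show ?thesis by (simp add: LS power_mult_distrib)
  qed
  finally have *: "(NNINT \<xi>. ennreal ((cmod (of_real (norm \<xi> powr a) * \<psi> \<xi>))\<^sup>2)) \<le> ennreal ((sqrt 2 * (?A * L powr - a))\<^sup>2)" .
  show "sq_int (freq_weight a \<psi>)"
    and "L2norm (freq_weight a \<psi>) \<le> sqrt 2 * (L2norm \<psi> * L powr - a)"
    using sq_int_L2norm_le_nn[OF _ *] A L by auto
qed

lemma nn_integral_powr_Icc:
  fixes a c :: real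
  assumes "-1 < a" "0 \<le> c"
  shows "(NNINT t. ennreal (t powr a) * indicator {0..c} t) = ennreal (c powr (a + 1) / (a + 1))"
proof -
  have "(NNINT t. ennreal (t powr a) * indicator {0..c} t) = (NNINT t. ennreal (indicator {0..c} t * t powr a))"
    by (intro nn_integral_cong) (auto split: split_indicator)
  also have "\<dots> = ennreal (c powr (a + 1) / (a + 1))"
    by (rule nn_integral_has_integral_lebesgue[OF _ has_integral_powr_from_0[OF assms]]) simp
  finally show ?thesis .
qed

definition unit_ball_volume :: "'a::euclidean_space itself \<Rightarrow> real" where
  "unit_ball_volume _ = measure lborel (ball (0::'a) 1)"

lemma unit_ball_volume_pos: "0 < unit_ball_volume TYPE('a::euclidean_space)"
  unfolding unit_ball_volume_def by (rule content_ball_pos) simp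

lemma emeasure_ball_scaled:
  fixes c :: "'a::euclidean_space"
  assumes "0 \<le> r"
  shows "emeasure lborel (ball c r) = ennreal (unit_ball_volume TYPE('a) * r ^ DIM('a))"
  unfolding unit_ball_volume_def
  using content_ball_conv_unit_ball[OF assms, of c] emeasure_lborel_ball_finite[of c r]
  by (subst emeasure_eq_ennreal_measure) (auto simp: mult.commute)

lemma ennreal_term_le_suminf: "f i \<le> (\<Sum>i. f i :: ennreal)"
  using sum_le_suminf[of f "{i}"] by simp

text \<open>Dyadic shells replace polar coordinates: shell j contributes at most a multiple of R^(d
  - b) q^j with q = 2^(-(d - b)), and b < d makes the series converge.\<close>

lemma nn_integral_ball_norm_powr:
  assumes b: "0 \<le> b" "b < real DIM('a::euclidean_space)"
  shows "\<exists>K>0. \<forall>R>0. (NNINT \<xi>. ennreal (norm (\<xi>::'a) powr - b) * indicator (ball 0 R) \<xi>)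
     \<le> ennreal (K * R powr (real DIM('a) - b))"
proof -
  let ?d = "real DIM('a)" and ?\<omega> = "unit_ball_volume TYPE('a)"
  define q where "q = 2 powr - (?d - b)"
  have q: "0 < q" "q < 1" using b by (auto simp: q_def powr_less_one)
  define K where "K = ?\<omega> * 2 powr b / (1 - q)"
  have K: "0 < K" using q unit_ball_volume_pos[where 'a='a] by (simp add: K_def)
  have "(NNINT \<xi>::'a. ennreal (norm \<xi> powr - b) * indicator (ball 0 R) \<xi>)
     \<le> ennreal (K * R powr (?d - b))" if R: "0 < R" for R
  proof -
    define \<rho> where "\<rho> j = R * 2 powr - real j" for j :: nat
    have \<rho>: "0 < \<rho> j" for j using R by (simp add: \<rho>_def)
    let ?t = "\<lambda>j \<xi>. ennreal ((\<rho> (Suc j)) powr - b) * indicator (ball 0 (\<rho> j)) \<xi>"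
    have pt: "ennreal (norm \<xi> powr - b) * indicator (ball 0 R) \<xi>
        \<le> (\<Sum>j. ?t j \<xi>)" for \<xi> :: 'a
    proof (cases "\<xi> \<in> ball 0 R \<and> \<xi> \<noteq> 0")
      case True
      then have n: "0 < norm \<xi>" "norm \<xi> < R" by auto
      \<comment> \<open>The ceiling minus one gives j < l \<le> j + 1, that is, \<rho> (j + 1) \<le>
        |\<xi>| < \<rho> j.\<close>
      define j where "j = nat \<lceil>log 2 (R / norm \<xi>)\<rceil> - 1"
      have lg: "0 < log 2 (R / norm \<xi>)" using n R by (subst zero_less_log_cancel_iff) (auto simp: field_simps)
      define l where "l = log 2 (R / norm \<xi>)"
      have jl: "real j < l" "l \<le> real (Suc j)" using lg unfolding j_def l_def by linarith+
      have eq: "norm \<xi> = R * 2 powr - l" using n R by (simp add: l_def powr_minus powr_log_cancel)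
      have le: "\<rho> (Suc j) \<le> norm \<xi>"
        unfolding eq \<rho>_def using jl R by (intro mult_left_mono powr_mono) auto
      have "norm \<xi> < \<rho> j"
        unfolding eq \<rho>_def using jl R by (intro mult_strict_left_mono powr_less_mono) auto
      moreover have "norm \<xi> powr - b \<le> \<rho> (Suc j) powr - b"
        using le \<rho>[of "Suc j"] b by (intro powr_mono2') auto
      ultimately have "ennreal (norm \<xi> powr - b) * indicator (ball 0 R) \<xi> \<le> ?t j \<xi>"
        using True by (simp add: ennreal_leI)
      also have "\<dots> \<le> (\<Sum>j. ?t j \<xi>)" by (rule ennreal_term_le_suminf)
      finally show ?thesis .
    qed auto
    have "(NNINT \<xi>::'a. ennreal (norm \<xi> powr - b) * indicator (ball 0 R) \<xi>)
       \<le> (NNINT \<xi>::'a. (\<Sum>j. ?t j \<xi>))"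
      by (intro nn_integral_mono pt)
    also have "\<dots> = (\<Sum>j. \<integral>\<^sup>+\<xi>. ?t j \<xi> \<partial>(lborel::'a measure))"
      by (rule nn_integral_suminf) measurable
    also have "\<dots> = (\<Sum>j. ennreal (?\<omega> * 2 powr b * R powr (?d - b) * q ^ j))"
    proof (intro suminf_cong)
      fix j
      have "(NNINT \<xi>::'a. ?t j \<xi>)
         = ennreal ((\<rho> (Suc j)) powr - b * (?\<omega> * \<rho> j ^ DIM('a)))"
        using \<rho>[of j] by (simp add: nn_integral_cmult_indicator emeasure_ball_scaled ennreal_mult')
      also have "(\<rho> (Suc j)) powr - b * (?\<omega> * \<rho> j ^ DIM('a)) = ?\<omega> * 2 powr b * R powr (?d - b) * q ^ j"
      proof -
        have e1: "\<rho> (Suc j) powr - b = R powr - b * 2 powr (real (Suc j) * b)"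
        proof -
          have "- real (Suc j) * - b = real (Suc j) * b" by (rule minus_mult_minus)
          then show ?thesis unfolding \<rho>_def by (simp only: powr_mult powr_powr)
        qed
        have e2: "\<rho> j ^ DIM('a) = R powr ?d * 2 powr (- real j * ?d)"
          using R \<rho>[of j] by (simp add: powr_realpow[symmetric] \<rho>_def powr_mult powr_powr)
        have e3: "q ^ j = 2 powr (- (?d - b) * real j)"
          by (simp add: q_def powr_realpow[symmetric] powr_powr)
        have e4: "R powr - b * R powr ?d = R powr (?d - b)" using R by (simp add: powr_add[symmetric])
        have e5: "2 powr (real (Suc j) * b) * 2 powr (- real j * ?d) = 2 powr b * (2::real) powr (- (?d - b) * real j)"
          unfolding powr_add[symmetric] by (intro arg_cong2[where f="(powr)"]) (auto simp: algebra_simps)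
        have "(a * x) * (?\<omega> * (c * y)) = ?\<omega> * e * (a * c) * z" if "x * y = e * z" for a c e x y z :: real
          using arg_cong[OF that, of "\<lambda>t. ?\<omega> * a * c * t"] by (simp add: mult_ac)
        from this[OF e5, of "R powr - b" "R powr ?d"]
        show ?thesis by (simp only: e1 e2 e3 e4)
      qed
      finally show "(NNINT \<xi>::'a. ?t j \<xi>)
         = ennreal (?\<omega> * 2 powr b * R powr (?d - b) * q ^ j)" .
    qed
    also have "\<dots> = ennreal (\<Sum>j. ?\<omega> * 2 powr b * R powr (?d - b) * q ^ j)"
      using q unit_ball_volume_pos[where 'a='a]
      by (intro suminf_ennreal2 summable_mult summable_geometric) (auto simp: mult_nonneg_nonneg less_imp_le)
    also have "(\<Sum>j. ?\<omega> * 2 powr b * R powr (?d - b) * q ^ j) = K * R powr (?d - b)"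
      using q by (subst suminf_mult) (auto simp: suminf_geometric summable_geometric K_def)
    finally show ?thesis .
  qed
  then show ?thesis using K by blast
qed

text \<open>The proof of Chemin and Xu: at height \<open>\<lambda>\<close> split \<open>u\<close> at the frequency \<open>R \<lambda>\<close> for which the
  low-frequency part is bounded by \<open>\<lambda> / 2\<close>, and estimate the high-frequency part in \<open>L\<^sup>2\<close>.\<close>

lemma Sobolev_embedding:
  fixes p :: real
  assumes p: "2 < p"
  defines "d \<equiv> real DIM('a::euclidean_space)"
  defines "s \<equiv> d / 2 - d / p"
  shows "\<exists>C\<ge>0. \<forall>(u::'a \<Rightarrow> complex) v. fourier_L2 u v \<and> sq_int (freq_weight s v) \<longrightarrow>
     (NNINT x. ennreal (cmod (u x) powr p)) \<le> ennreal (C * L2norm (freq_weight s v) powr p)" (is "\<exists>C\<ge>0. \<forall>u v. _ u v \<longrightarrow> ?bound C u v")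
proof -
  have d: "0 < d" by (simp add: d_def)
  have s: "0 < s" "2 * s < d" using p d by (auto simp: s_def field_simps)
  obtain K where K: "0 < K" "\<And>R. 0 < R \<Longrightarrow> (NNINT \<xi>. ennreal (norm (\<xi>::'a) powr - (2 * s)) * indicator (ball 0 R) \<xi>) \<le> ennreal (K * R powr (d - 2 * s))"
    using nn_integral_ball_norm_powr[of "2 * s", where 'a='a] s unfolding d_def by auto
  \<comment> \<open>Cauchy-Schwarz against |\<xi>|^(-s) on the ball of radius R bounds the L^1 norm
    of the low frequencies by c0 R^(d/p) E, because (d - 2s)/2 = d/p.\<close>
  define c0 where "c0 = sqrt K"
  have c0: "0 < c0" using K by (simp add: c0_def)
  \<comment> \<open>The factor p comes from the layer-cake formula, 4 from Chebyshev at height l/2,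
    1/(p - 2) from integrating l^(p - 3), and the power of 2 c0 from the cutoff \<Lambda>.\<close>
  define C where "C = 4 * p / (p - 2) * (2 * c0) powr (p - 2)"
  have C: "0 \<le> C" using p by (simp add: C_def)
  have main: "?bound C u v"
    if F: "fourier_L2 u v" and w: "sq_int (freq_weight s v)" for u v :: "'a \<Rightarrow> complex"
  proof -
    note sq = fourier_L2_sq_int[OF F]
    note [measurable] = sq_int_measurable[OF sq(1)] sq_int_measurable[OF sq(2)]
    let ?w = "\<lambda>\<xi>. of_real (norm \<xi> powr s) * v \<xi>"
    define E where "E = L2norm ?w"
    have AE0: "AE \<xi> in lborel. \<xi> \<noteq> (0::'a)" using AE_lborel_singleton by auto
    \<comment> \<open>The cutoff frequency divides by E. If E = 0, then v vanishes off the origin,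
      hence u vanishes almost everywhere.\<close>
    show ?thesis
    proof (cases "E = 0")
      case True
      have "AE \<xi> in lborel. ?w \<xi> = 0" using L2norm_eq_0[OF w] True by (simp add: E_def)
      with AE0 have "AE \<xi> in lborel. v \<xi> = 0" by eventually_elim auto
      moreover have "fourier_L2 (\<lambda>x. 0 * u x) (\<lambda>\<xi>. 0 * v \<xi>)" by (rule fourier_L2_cmult[OF F])
      ultimately have "AE x in lborel. u x = 0" using fourier_L2_unique[OF F, of "\<lambda>x. 0" "\<lambda>x. 0"] by simp
      then have "(NNINT x. ennreal (cmod (u x) powr p)) = (NNINT x::'a. 0)"
        by (intro nn_integral_cong_AE) (auto elim!: eventually_mono)
      then show ?thesis by simp
    next
      case False
      then have E: "0 < E" by (simp add: E_def less_le)
      \<comment> \<open>The largest height l for which \<xi> still counts as a high frequency, i.e.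
        the inverse of the dependence of R on l. It lets Fubini perform the l-integration
        first.\<close>
      define \<Lambda> where "\<Lambda> \<xi> = 2 * c0 * E * norm (\<xi>::'a) powr (d / p)" for \<xi>
      have \<Lambda>m [measurable]: "\<Lambda> \<in> borel_measurable borel" unfolding \<Lambda>_def by measurable
      let ?K = "\<lambda>l. NNINT \<xi>. ennreal ((cmod (v \<xi>))\<^sup>2) * indicator {\<xi>. l \<le> \<Lambda> \<xi>} \<xi>"
      let ?f = "\<lambda>l x. ennreal p * (ennreal (l powr (p - 1)) * indicator {0..cmod (u x)} l)"
      let ?k = "\<lambda>l \<xi>. ennreal (4 * p) * ennreal ((cmod (v \<xi>))\<^sup>2) * (ennreal (l powr (p - 3)) * indicator {0..\<Lambda> \<xi>} l)"
      \<comment> \<open>Where |u| \<ge> l, the high-frequency part is at least l/2, since the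
        low-frequency part is at most l/2; Chebyshev and Plancherel do the rest.\<close>
      have level: "emeasure lborel {x. l \<le> cmod (u x)} \<le> ennreal (4 / l\<^sup>2) * ?K l"
        if l: "0 < l" for l
      proof -
        define R where "R = (l / (2 * c0 * E)) powr (p / d)"
        have R: "0 < R" using l c0 E by (simp add: R_def)
        have RL: "R powr (d / p) = l / (2 * c0 * E)" using l c0 E p d by (simp add: R_def powr_powr)
        have Riff: "R \<le> norm \<xi> \<Longrightarrow> l \<le> \<Lambda> \<xi>" for \<xi>
        proof -
          assume "R \<le> norm \<xi>"
          then have "R powr (d / p) \<le> norm \<xi> powr (d / p)" using R d p by (intro powr_mono2) auto
          then show ?thesis using c0 E by (simp add: RL \<Lambda>_def field_simps)
        qed
        define v1 where "v1 \<xi> = (if norm \<xi> < R then v \<xi> else 0)" for \<xi>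
        have v1m [measurable]: "v1 \<in> borel_measurable borel" unfolding v1_def by measurable
        define k where "k \<xi> = complex_of_real (norm \<xi> powr - s * indicator (ball 0 R) \<xi>)" for \<xi> :: 'a
        have km [measurable]: "k \<in> borel_measurable borel" unfolding k_def by measurable
        have "(NNINT \<xi>. ennreal ((cmod (k \<xi>))\<^sup>2)) = (NNINT \<xi>. ennreal (norm (\<xi>::'a) powr - (2 * s)) * indicator (ball 0 R) \<xi>)"
          by (intro nn_integral_cong) (auto simp: k_def norm_mult power2_eq_square powr_add[symmetric] split: split_indicator)
        also have "\<dots> \<le> ennreal ((c0 * R powr (d / p))\<^sup>2)"
        proof -
          have "(c0 * R powr (d / p))\<^sup>2 = K * R powr (d - 2 * s)"
          proof -
            have "d - 2 * s = d / p + d / p" by (simp add: s_def)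
            then have "R powr (d - 2 * s) = (R powr (d / p))\<^sup>2" by (simp only: powr_add power2_eq_square)
            then show ?thesis using K(1) by (simp add: c0_def power_mult_distrib)
          qed
          then show ?thesis using K(2)[OF R] by simp
        qed
        finally have *: "(NNINT \<xi>. ennreal ((cmod (k \<xi>))\<^sup>2)) \<le> ennreal ((c0 * R powr (d / p))\<^sup>2)" .
        have k: "sq_int k" "L2norm k \<le> c0 * R powr (d / p)"
          using sq_int_L2norm_le_nn[OF _ *] c0 by auto
        have kw: "AE \<xi> in lborel. k \<xi> * ?w \<xi> = v1 \<xi>"
          using AE0
        proof eventually_elim
          case (elim \<xi>)
          then show ?case
            by (auto simp: k_def v1_def powr_minus mult.assoc[symmetric] simp flip: of_real_mult split: split_indicator)
        qed
        have v1i: "integrable lborel v1"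
          using integrable_sq_int_mult[OF k(1) w] kw by (subst integrable_cong_AE[where g="\<lambda>\<xi>. k \<xi> * ?w \<xi>"]) auto
        have v1s: "sq_int v1" by (rule L2norm_bound(1)[OF sq(2), of _ 1]) (auto simp: v1_def)
        have "(LBINT \<xi>. cmod (v1 \<xi>)) = (LBINT \<xi>. cmod (k \<xi> * ?w \<xi>))"
          using kw by (intro integral_cong_AE) (auto elim!: eventually_mono)
        also have "\<dots> \<le> L2norm k * E" unfolding E_def by (rule L2_Cauchy_Schwarz_norm[OF k(1) w])
        also have "\<dots> \<le> c0 * R powr (d / p) * E" using k(2) E by (intro mult_right_mono) auto
        also have "\<dots> = l / 2" using c0 E by (simp add: RL)
        finally have low: "cmod (inv_fourier v1 x) \<le> l / 2" for x
          using fourier_L1_bound[of v1 "- x"] by (simp add: inv_fourier_def)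
        let ?u2 = "\<lambda>x. u x - inv_fourier v1 x"
        have F2: "fourier_L2 ?u2 (\<lambda>\<xi>. v \<xi> - v1 \<xi>)"
          by (intro fourier_L2_diff F fourier_L2_inv_fourier v1s v1i)
        have "emeasure lborel {x. l \<le> cmod (u x)} = (NNINT x. indicator {x. l \<le> cmod (u x)} x)" by simp
        also have "\<dots> \<le> (NNINT x. ennreal (4 / l\<^sup>2) * ennreal ((cmod (?u2 x))\<^sup>2))"
        proof (rule nn_integral_mono)
          fix x
          show "indicator {x. l \<le> cmod (u x)} x \<le> ennreal (4 / l\<^sup>2) * ennreal ((cmod (?u2 x))\<^sup>2)"
          proof (cases "l \<le> cmod (u x)")
            case True
            then have "l / 2 \<le> cmod (?u2 x)" using low[of x] norm_triangle_ineq2[of "u x" "inv_fourier v1 x"] by linarith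
            then have "(l / 2)\<^sup>2 \<le> (cmod (?u2 x))\<^sup>2" using l by (intro power_mono) auto
            then have "1 \<le> 4 / l\<^sup>2 * (cmod (?u2 x))\<^sup>2" using l by (simp add: field_simps power_divide)
            then have "ennreal 1 \<le> ennreal (4 / l\<^sup>2 * (cmod (?u2 x))\<^sup>2)" by (rule ennreal_leI)
            also have "\<dots> = ennreal (4 / l\<^sup>2) * ennreal ((cmod (?u2 x))\<^sup>2)" by (rule ennreal_mult') simp
            finally show ?thesis using True by simp
          qed simp
        qed
        also have "\<dots> = ennreal (4 / l\<^sup>2) * (NNINT x. ennreal ((cmod (?u2 x))\<^sup>2))"
          by (rule nn_integral_cmult) measurable
        also have "(NNINT x. ennreal ((cmod (?u2 x))\<^sup>2)) = (NNINT \<xi>. ennreal ((cmod (v \<xi> - v1 \<xi>))\<^sup>2))"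
          unfolding nn_integral_square_cmod[OF fourier_L2_sq_int(1)[OF F2]] nn_integral_square_cmod[OF fourier_L2_sq_int(2)[OF F2]]
          by (simp add: fourier_L2_Plancherel[OF F2])
        also have "\<dots> \<le> ?K l"
          using Riff by (intro nn_integral_mono) (auto simp: v1_def split: split_indicator)
        finally show ?thesis by (simp add: mult_left_mono)
      qed
      have "(NNINT x. ennreal (cmod (u x) powr p))
         = (NNINT x. (NNINT l. ?f l x))"
        using p by (intro nn_integral_cong, subst nn_integral_cmult)
          (auto simp: nn_integral_powr_Icc ennreal_mult'[symmetric])
      also have "\<dots> = (NNINT l. (NNINT x. ?f l x))"
        by (rule lborel_pair.Fubini'[symmetric]) (simp add: indicator_def)
      also have "\<dots> \<le> (NNINT l. (NNINT \<xi>. ?k l \<xi>))"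
      proof (rule nn_integral_mono)
        fix l :: real
        show "(NNINT x. ?f l x)
          \<le> (NNINT \<xi>. ?k l \<xi>)"
        proof (cases "0 < l")
          case True
          have "(NNINT x. ?f l x)
              = (NNINT x. ennreal (p * l powr (p - 1)) * indicator {x. l \<le> cmod (u x)} x)"
            using True p by (intro nn_integral_cong) (auto simp: ennreal_mult' split: split_indicator)
          also have "\<dots> = ennreal (p * l powr (p - 1)) * emeasure lborel {x. l \<le> cmod (u x)}"
            by (rule nn_integral_cmult_indicator) measurable
          also have "\<dots> \<le> ennreal (p * l powr (p - 1)) * (ennreal (4 / l\<^sup>2) * ?K l)"
            by (intro mult_left_mono level True) auto
          also have "\<dots> = ennreal (4 * p * l powr (p - 3)) * ?K l"
          proof -
            have "l powr (p - 1) = l powr (p - 3) * l\<^sup>2"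
              using powr_add[of l "p - 3" 2] True by simp
            then have "p * l powr (p - 1) * (4 / l\<^sup>2) = 4 * p * l powr (p - 3)" using True by simp
            moreover have "ennreal (p * l powr (p - 1)) * ennreal (4 / l\<^sup>2) = ennreal (p * l powr (p - 1) * (4 / l\<^sup>2))"
              using p by (intro ennreal_mult'[symmetric]) simp
            ultimately show ?thesis by (simp only: mult.assoc[symmetric])
          qed
          also have "\<dots> = (NNINT \<xi>. ennreal (4 * p * l powr (p - 3)) * (ennreal ((cmod (v \<xi>))\<^sup>2) * indicator {\<xi>. l \<le> \<Lambda> \<xi>} \<xi>))"
            by (rule nn_integral_cmult[symmetric]) measurable
          also have "\<dots> = (NNINT \<xi>. ?k l \<xi>)"
            using True p by (intro nn_integral_cong) (auto simp: ennreal_mult' mult_ac split: split_indicator)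
          finally show ?thesis .
        next
          case False
          then have "(NNINT x. ?f l x) = (NNINT x::'a. 0)"
            by (intro nn_integral_cong) (auto split: split_indicator)
          then show ?thesis by simp
        qed
      qed
      also have "\<dots> = (NNINT \<xi>. (NNINT l. ?k l \<xi>))"
        by (rule lborel_pair.Fubini') (simp add: indicator_def)
      also have "\<dots> = (NNINT \<xi>. ennreal (C * E powr (p - 2)) * ennreal ((cmod (?w \<xi>))\<^sup>2))"
      proof (rule nn_integral_cong)
        fix \<xi> :: 'a
        have "0 \<le> \<Lambda> \<xi>" using c0 E by (simp add: \<Lambda>_def)
        then have "(NNINT l. ennreal (l powr (p - 3)) * indicator {0..\<Lambda> \<xi>} l) = ennreal (\<Lambda> \<xi> powr (p - 2) / (p - 2))"
          using nn_integral_powr_Icc[of "p - 3" "\<Lambda> \<xi>"] p by simp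
        then have "(NNINT l. ?k l \<xi>)
          = ennreal (4 * p * (cmod (v \<xi>))\<^sup>2 * (\<Lambda> \<xi> powr (p - 2) / (p - 2)))"
          using p by (subst nn_integral_cmult) (auto simp: ennreal_mult'[symmetric])
        also have "4 * p * (cmod (v \<xi>))\<^sup>2 * (\<Lambda> \<xi> powr (p - 2) / (p - 2)) = C * E powr (p - 2) * (cmod (?w \<xi>))\<^sup>2"
        proof -
          have "\<Lambda> \<xi> powr (p - 2) = (2 * c0) powr (p - 2) * E powr (p - 2) * norm \<xi> powr (d / p * (p - 2))"
            using c0 E by (simp add: \<Lambda>_def powr_mult powr_powr)
          moreover have "d / p * (p - 2) = s + s" using p by (simp add: s_def field_simps)
          ultimately have "\<Lambda> \<xi> powr (p - 2) = (2 * c0) powr (p - 2) * E powr (p - 2) * (norm \<xi> powr s)\<^sup>2"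
            by (simp only: powr_add power2_eq_square)
          then show ?thesis using p by (simp add: C_def norm_mult power_mult_distrib field_simps)
        qed
        finally show "(NNINT l. ?k l \<xi>)
          = ennreal (C * E powr (p - 2)) * ennreal ((cmod (?w \<xi>))\<^sup>2)"
          using C by (simp add: ennreal_mult')
      qed
      also have "\<dots> = ennreal (C * E powr (p - 2)) * ennreal (E\<^sup>2)"
        unfolding E_def nn_integral_square_cmod[OF w, symmetric] by (rule nn_integral_cmult) measurable
      also have "\<dots> = ennreal (C * E powr p)"
      proof -
        have "E powr p = E powr (p - 2) * E\<^sup>2" using powr_add[of E "p - 2" 2] E by simp
        then show ?thesis using C by (simp add: ennreal_mult'[symmetric] mult.assoc)
      qed
      finally show ?thesis by (simp add: E_def)
    qed
  qed
  show ?thesis using C main by blast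
qed

section \<open>Nonnegative radial functions and exponents below two\<close>

lemma nn_integral_lborel_orthogonal:
  fixes Q :: "'a::euclidean_space \<Rightarrow> 'a"
  assumes Q: "orthogonal_transformation Q" and [measurable]: "f \<in> borel_measurable borel"
  shows "(NNINT x. f (Q x)) = (NNINT x. f x)"
proof -
  note [measurable] = orthogonal_measurable[OF Q]
  have "(NNINT x. f x) = (\<integral>\<^sup>+x. f x \<partial>distr lborel borel Q)" by (simp add: lborel_distr_orthogonal[OF Q])
  also have "\<dots> = (NNINT x. f (Q x))" by (rule nn_integral_distr) auto
  finally show ?thesis by simp
qed

section \<open>Masses of small balls under rotation invariance\<close>

definition mass :: "('a::euclidean_space \<Rightarrow> real) \<Rightarrow> 'a set \<Rightarrow> ennreal" where
  "mass U X = (NNINT x. ennreal (U x) * indicator X x)"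

lemma ennreal_inverse_mult: "0 < c \<Longrightarrow> ennreal (inverse c) * ennreal c = 1"
  by (simp flip: ennreal_mult')

lemma mass_mono: "X \<subseteq> Y \<Longrightarrow> mass U X \<le> mass U Y"
  unfolding mass_def by (intro nn_integral_mono) (auto split: split_indicator)

text \<open>Bounds from below the volume of a shell of inner radius R and thickness \<rho>.\<close>

lemma power_increment_bound:
  fixes R \<rho> :: real
  assumes "0 \<le> R" "0 \<le> \<rho>" "0 < n"
  shows "R ^ (n - 1) * \<rho> \<le> (R + \<rho>) ^ n - R ^ n"
proof -
  obtain m where n: "n = Suc m" using assms(3) gr0_implies_Suc by blast
  have "R ^ m * (R + \<rho>) \<le> (R + \<rho>) ^ m * (R + \<rho>)"
    using assms by (intro mult_right_mono power_mono) auto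
  then show ?thesis by (simp add: n algebra_simps)
qed

text \<open>Rotating \<open>x\<close> next to each point \<open>y\<close> of a thin shell and integrating over \<open>y\<close> replaces the
  usual count of disjoint rotated balls.\<close>

lemma rotation_invariant_ball_mass:
  fixes U :: "real^'n \<Rightarrow> real"
  assumes [measurable]: "U \<in> borel_measurable borel"
    and rot: "\<And>Q. orthogonal_transformation Q \<Longrightarrow> AE x in lborel. U (Q x) = U x"
    and x: "x \<noteq> 0" and \<rho>: "0 < \<rho>"
  shows "ennreal (norm x ^ (CARD('n) - 1) * \<rho>) * mass U (ball x \<rho>)
      \<le> ennreal ((2 * \<rho>) ^ CARD('n)) * mass U (ball 0 (norm x + 3 * \<rho>))"
proof -
  let ?R = "norm x" and ?\<omega> = "unit_ball_volume TYPE(real^'n)"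
  note \<omega> = unit_ball_volume_pos[where 'a="real^'n"]
  have R: "0 < ?R" using x by simp
  let ?b = "\<lambda>y z. ennreal (U z) * indicator {..<2 * \<rho>} (dist y z)"
  let ?c = "\<lambda>z. ennreal (U z) * indicator (ball 0 (?R + 3 * \<rho>)) z"
  define Sh where "Sh = ball (0::real^'n) (?R + \<rho>) - ball 0 ?R"
  have Shm [measurable]: "Sh \<in> sets borel" by (simp add: Sh_def)
  have "emeasure lborel Sh = emeasure lborel (ball (0::real^'n) (?R + \<rho>)) - emeasure lborel (ball (0::real^'n) ?R)"
    unfolding Sh_def using emeasure_lborel_ball_finite[of "0::real^'n" ?R] \<rho>
    by (intro emeasure_Diff) auto
  also have "\<dots> = ennreal (?\<omega> * (?R + \<rho>) ^ CARD('n) - ?\<omega> * ?R ^ CARD('n))"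
    using R \<rho> \<omega> by (subst (1 2) emeasure_ball_scaled) (auto simp: ennreal_minus)
  finally have eSh: "emeasure lborel Sh = ennreal (?\<omega> * (?R + \<rho>) ^ CARD('n) - ?\<omega> * ?R ^ CARD('n))" .
  have Shle: "ennreal (?\<omega> * (?R ^ (CARD('n) - 1) * \<rho>)) \<le> emeasure lborel Sh"
    unfolding eSh using power_increment_bound[of ?R \<rho> "CARD('n)"] R \<rho> \<omega>
    by (intro ennreal_leI) (simp add: right_diff_distrib[symmetric])
  \<comment> \<open>Rotate x to the point of its sphere in the direction of y. That point is within
    \<rho> of y, so the rotated ball, which has the same mass, lies in the ball of radius 2 \<rho>
    around y.\<close>
  have near: "mass U (ball x \<rho>) \<le> (NNINT z. ?b y z)" if y: "y \<in> Sh" for y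
  proof -
    have ny: "?R \<le> norm y" "norm y < ?R + \<rho>" using y by (auto simp: Sh_def)
    then have y0: "0 < norm y" using R by linarith
    have "norm ((?R / norm y) *\<^sub>R y) = ?R" using y0 by simp
    then obtain Q where Q: "orthogonal_transformation Q" "Q x = (?R / norm y) *\<^sub>R y"
      using orthogonal_transformation_exists[of x "(?R / norm y) *\<^sub>R y"] by metis
    note [measurable] = orthogonal_measurable[OF Q(1)]
    have "Q x - y = (?R / norm y - 1) *\<^sub>R y" by (simp add: Q(2) scaleR_left_diff_distrib)
    then have "norm (Q x - y) = \<bar>?R / norm y - 1\<bar> * norm y" by simp
    also have "\<dots> = norm y - ?R" using ny y0 by (simp add: field_simps abs_if)
    finally have dQ: "norm (Q x - y) < \<rho>" using ny by simp
    have diso: "dist (Q a) (Q b) = dist a b" for a b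
      using Q(1) by (simp add: orthogonal_transformation_isometry)
    have "mass U (ball x \<rho>) = (NNINT z. ennreal (U (Q z)) * indicator (ball (Q x) \<rho>) (Q z))"
      unfolding mass_def using rot[OF Q(1)]
      by (intro nn_integral_cong_AE) (auto elim!: eventually_mono simp: diso split: split_indicator)
    also have "\<dots> = (NNINT z. ennreal (U z) * indicator (ball (Q x) \<rho>) z)"
      by (rule nn_integral_lborel_orthogonal[OF Q(1)]) measurable
    also have "\<dots> \<le> (NNINT z. ?b y z)"
    proof (rule nn_integral_mono)
      fix z
      have "dist y z < 2 * \<rho>" if "z \<in> ball (Q x) \<rho>"
        using that dQ dist_triangle[of y z "Q x"] by (simp add: dist_norm norm_minus_commute)
      then show "ennreal (U z) * indicator (ball (Q x) \<rho>) z \<le> ?b y z"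
        by (auto split: split_indicator)
    qed
    finally show ?thesis .
  qed
  have "ennreal (?\<omega> * (?R ^ (CARD('n) - 1) * \<rho>)) * mass U (ball x \<rho>) \<le> emeasure lborel Sh * mass U (ball x \<rho>)"
    by (intro mult_right_mono Shle) simp
  also have "\<dots> = (NNINT y. indicator Sh y * mass U (ball x \<rho>))"
    by (subst nn_integral_multc) auto
  also have "\<dots> \<le> (NNINT y. (NNINT z. indicator Sh y * ?b y z))"
  proof (rule nn_integral_mono)
    fix y
    have "(NNINT z. indicator Sh y * ?b y z)
      = indicator Sh y * (NNINT z. ?b y z)"
      by (rule nn_integral_cmult) measurable
    then show "indicator Sh y * mass U (ball x \<rho>) \<le> (NNINT z. indicator Sh y * ?b y z)"
      using near[of y] by (auto split: split_indicator)
  qed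
  also have "\<dots> = (NNINT z. (NNINT y. indicator Sh y * ?b y z))"
    by (rule lborel_pair.Fubini'[symmetric]) measurable
  \<comment> \<open>For fixed z the contributing y fill at most the ball of radius 2 \<rho> around
    z, and z lies within |x| + 3 \<rho> of the origin.\<close>
  also have "\<dots> \<le> (NNINT z. ennreal (?\<omega> * (2 * \<rho>) ^ CARD('n)) * ?c z)"
  proof (rule nn_integral_mono)
    fix z
    have "(NNINT y. indicator Sh y * ?b y z)
       \<le> (NNINT y. ?c z * indicator (ball z (2 * \<rho>)) y)"
    proof (rule nn_integral_mono)
      fix y
      have "norm z < ?R + 3 * \<rho>" if "y \<in> Sh" "dist y z < 2 * \<rho>"
        using that norm_triangle_ineq3[of z y] by (auto simp: Sh_def dist_norm norm_minus_commute)
      then show "indicator Sh y * ?b y z \<le> ?c z * indicator (ball z (2 * \<rho>)) y"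
        by (auto simp: dist_commute split: split_indicator)
    qed
    also have "\<dots> = ?c z * emeasure lborel (ball z (2 * \<rho>))"
      by (rule nn_integral_cmult_indicator) simp
    also have "\<dots> = ennreal (?\<omega> * (2 * \<rho>) ^ CARD('n)) * ?c z"
      using \<rho> by (subst emeasure_ball_scaled) (auto simp: mult.commute)
    finally show "(NNINT y. indicator Sh y * ?b y z)
       \<le> ennreal (?\<omega> * (2 * \<rho>) ^ CARD('n)) * ?c z" .
  qed
  also have "\<dots> = ennreal (?\<omega> * (2 * \<rho>) ^ CARD('n)) * mass U (ball 0 (?R + 3 * \<rho>))"
    unfolding mass_def by (rule nn_integral_cmult) simp
  finally have *: "ennreal ?\<omega> * (ennreal (?R ^ (CARD('n) - 1) * \<rho>) * mass U (ball x \<rho>))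
      \<le> ennreal ?\<omega> * (ennreal ((2 * \<rho>) ^ CARD('n)) * mass U (ball 0 (?R + 3 * \<rho>)))"
    using \<omega> by (simp add: ennreal_mult' mult.assoc)
  have "ennreal (inverse ?\<omega>) * (ennreal ?\<omega> * (ennreal (?R ^ (CARD('n) - 1) * \<rho>) * mass U (ball x \<rho>)))
      \<le> ennreal (inverse ?\<omega>) * (ennreal ?\<omega> * (ennreal ((2 * \<rho>) ^ CARD('n)) * mass U (ball 0 (?R + 3 * \<rho>))))"
    by (rule mult_left_mono[OF *]) simp
  moreover have "ennreal (inverse ?\<omega>) * ennreal ?\<omega> = 1"
    by (rule ennreal_inverse_mult[OF \<omega>])
  ultimately show ?thesis by (simp only: mult.assoc[symmetric] mult_1_left)
qed

section \<open>Finite differences and the second moment on an annulus\<close>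

lemma finite_difference_square_bound:
  fixes a :: "nat \<Rightarrow> real"
  assumes a: "\<And>j. 0 \<le> a j"
  shows "(a 0)\<^sup>2 \<le> (\<Sum>j\<le>k. (-1) ^ j * real (k choose j) * a j)\<^sup>2 + 2 ^ (k + 1) * (\<Sum>j=1..k. a 0 * a j)"
proof -
  \<comment> \<open>T collects all terms but the zeroth. Expanding (a 0 + T)^2 and dropping T^2
    leaves only the cross term to estimate; as all a j are nonnegative, -T is at most 2^k times
    their sum.\<close>
  define T where "T = (\<Sum>j=1..k. (-1) ^ j * real (k choose j) * a j)"
  have eq: "(\<Sum>j\<le>k. (-1) ^ j * real (k choose j) * a j) = a 0 + T"
    unfolding T_def atLeast0AtMost[symmetric] by (subst sum.atLeast_Suc_atMost) auto
  have "\<bar>T\<bar> \<le> (\<Sum>j=1..k. \<bar>(-1) ^ j * real (k choose j) * a j\<bar>)" unfolding T_def by (rule sum_abs)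
  also have "\<dots> \<le> (\<Sum>j=1..k. 2 ^ k * a j)"
  proof (rule sum_mono)
    fix j assume "j \<in> {1..k}"
    have "k choose j \<le> (2::nat) ^ k" by (rule binomial_le_pow2)
    then have "real (k choose j) \<le> 2 ^ k" by (metis of_nat_le_iff of_nat_numeral of_nat_power)
    then show "\<bar>(-1) ^ j * real (k choose j) * a j\<bar> \<le> 2 ^ k * a j"
      using a[of j] by (simp add: abs_mult mult_right_mono)
  qed
  also have "\<dots> = 2 ^ k * (\<Sum>j=1..k. a j)" by (simp add: sum_distrib_left)
  finally have "a 0 * (- T) \<le> a 0 * (2 ^ k * (\<Sum>j=1..k. a j))" using a[of 0] by (intro mult_left_mono) auto
  also have "\<dots> = 2 ^ k * (\<Sum>j=1..k. a 0 * a j)" by (simp add: sum_distrib_left mult_ac)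
  finally have "- (a 0 * T) \<le> 2 ^ k * (\<Sum>j=1..k. a 0 * a j)" by simp
  moreover have "(a 0 + T)\<^sup>2 = (a 0)\<^sup>2 + 2 * (a 0 * T) + T\<^sup>2" by (simp add: power2_sum)
  moreover have "2 ^ (k + 1) * (\<Sum>j=1..k. a 0 * a j) = 2 * (2 ^ k * (\<Sum>j=1..k. a 0 * a j))" by simp
  ultimately show ?thesis unfolding eq using zero_le_power2[of T] by linarith
qed

text \<open>The k-th forward difference up to the sign (-1)^k, normalised so that \<open>U x\<close>
  has coefficient one.\<close>

abbreviation fdiff :: "nat \<Rightarrow> ('a::real_vector \<Rightarrow> real) \<Rightarrow> 'a \<Rightarrow> 'a \<Rightarrow> real" where
  "fdiff k U z x \<equiv> (\<Sum>j\<le>k. (-1) ^ j * real (k choose j) * U (x + real j *\<^sub>R z))"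

definition annulus :: "real \<Rightarrow> (real^'n) set" where
  "annulus R = {x. R \<le> norm x \<and> norm x < 2 * R}"

lemma annulus_sets [measurable]: "annulus R \<in> sets borel"
  unfolding annulus_def by measurable

text \<open>The first summand is the difference term. The second is the averaged product term: the
  mass J of a small ball times the mass of the annulus, divided by the volume of the ball of steps.
  Rotation invariance puts h^(d - 1) into J, which cancels all but one power of h and leaves
  1/h.\<close>

lemma annulus_L2_bound:
  fixes U :: "real^'n \<Rightarrow> real"
  assumes Um [measurable]: "U \<in> borel_measurable borel" and U0: "\<And>x. 0 \<le> U x"
    and rot: "\<And>Q. orthogonal_transformation Q \<Longrightarrow> AE x in lborel. U (Q x) = U x"
    and M: "\<And>R. 0 < R \<Longrightarrow> mass U (ball 0 R) \<le> ennreal (G * R powr m)" and G: "0 \<le> G" and m: "0 \<le> m"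
    and diff: "\<And>z. (NNINT x. ennreal ((fdiff k U z x)\<^sup>2))
          \<le> ennreal ((K * norm z powr s)\<^sup>2)"
    and K: "0 \<le> K" and s: "0 \<le> s" and h: "0 < h" "real k * h \<le> R" and k: "1 \<le> k" and R: "0 < R"
  shows "(NNINT x. ennreal ((U x)\<^sup>2) * indicator (annulus R) x)
    \<le> ennreal ((K * h powr s)\<^sup>2
        + 2 ^ (k + 1) * real k * 2 ^ CARD('n) * real k ^ (CARD('n) - 1) * 25 powr m / unit_ball_volume TYPE(real^'n)
          * (G\<^sup>2 * (R powr (2 * m - (real CARD('n) - 1)) / h)))"
proof -
  let ?D = "CARD('n)" and ?\<omega> = "unit_ball_volume TYPE(real^'n)" and ?T = "annulus R"
  note \<omega> = unit_ball_volume_pos[where 'a="real^'n"]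
  \<comment> \<open>J bounds the mass of a ball of radius k h centred on the annulus. The comparison
    ball of radius |x| + 3 k h fits into radius 5 R, as |x| < 2 R and k h \<le> R.\<close>
  define J where "J = 2 ^ ?D * (real k * h / R) ^ (?D - 1) * (G * (5 * R) powr m)"
  have J0: "0 \<le> J" using G R h by (simp add: J_def)
  have kh: "0 < real k * h" using k h by simp
  have local: "mass U (ball x (real k * h)) \<le> ennreal J" if x: "x \<in> ?T" for x
  proof -
    have nx: "R \<le> norm x" "norm x < 2 * R" using x by (auto simp: annulus_def)
    have x0: "x \<noteq> 0" using nx R by auto
    have nx0: "0 < norm x" using x0 by simp
    let ?\<rho> = "real k * h"
    have "mass U (ball 0 (norm x + 3 * ?\<rho>)) \<le> mass U (ball 0 (5 * R))"
      using nx h by (intro mass_mono subset_ball) linarith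
    also have "\<dots> \<le> ennreal (G * (5 * R) powr m)" using M[of "5 * R"] R by simp
    finally have 1: "mass U (ball 0 (norm x + 3 * ?\<rho>)) \<le> ennreal (G * (5 * R) powr m)" .
    let ?c = "norm x ^ (?D - 1) * ?\<rho>"
    have c: "0 < ?c" using nx0 kh by simp
    have "ennreal ?c * mass U (ball x ?\<rho>) \<le> ennreal ((2 * ?\<rho>) ^ ?D) * ennreal (G * (5 * R) powr m)"
      using rotation_invariant_ball_mass[OF Um rot x0 kh] mult_left_mono[OF 1, of "ennreal ((2 * ?\<rho>) ^ ?D)"] by (meson order_trans zero_le)
    then have "ennreal (inverse ?c) * (ennreal ?c * mass U (ball x ?\<rho>)) \<le> ennreal (inverse ?c) * (ennreal ((2 * ?\<rho>) ^ ?D) * ennreal (G * (5 * R) powr m))"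
      by (rule mult_left_mono) simp
    moreover have "ennreal (inverse ?c) * ennreal ?c = 1" by (rule ennreal_inverse_mult[OF c])
    moreover have "ennreal (inverse ?c) * (ennreal ((2 * ?\<rho>) ^ ?D) * ennreal (G * (5 * R) powr m)) = ennreal (inverse ?c * ((2 * ?\<rho>) ^ ?D * (G * (5 * R) powr m)))"
    proof -
      have "0 \<le> inverse ?c" "0 \<le> (2 * ?\<rho>) ^ ?D" using c kh by (auto simp del: inverse_mult_distrib)
      then show ?thesis by (metis ennreal_mult')
    qed
    ultimately have "mass U (ball x ?\<rho>) \<le> ennreal (inverse ?c * ((2 * ?\<rho>) ^ ?D * (G * (5 * R) powr m)))"
      by (simp only: mult.assoc[symmetric] mult_1_left)
    also have "\<dots> \<le> ennreal J"
    proof (rule ennreal_leI)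
      have alg: "inverse (a ^ (?D - 1) * t) * ((2 * t) ^ ?D * X) = 2 ^ ?D * (t / a) ^ (?D - 1) * X"
        if "0 < a" "0 < t" for a t X :: real
      proof -
        have "t ^ ?D = t ^ (?D - 1) * t" by (subst power_minus_mult) auto
        then show ?thesis using that by (simp add: power_mult_distrib power_divide field_simps)
      qed
      have "inverse ?c * ((2 * ?\<rho>) ^ ?D * (G * (5 * R) powr m)) = 2 ^ ?D * (?\<rho> / norm x) ^ (?D - 1) * (G * (5 * R) powr m)"
        by (rule alg[OF nx0 kh])
      also have "\<dots> \<le> J" unfolding J_def using nx R kh G mult_pos_pos[OF nx0 R]
        by (intro mult_right_mono mult_left_mono power_mono divide_left_mono) auto
      finally show "inverse ?c * ((2 * ?\<rho>) ^ ?D * (G * (5 * R) powr m)) \<le> J" .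
    qed
    finally show ?thesis .
  qed
  have inner: "(NNINT z. indicator (ball 0 h) z * ennreal (U (x + real j *\<^sub>R z))) \<le> ennreal J"
    if x: "x \<in> ?T" and j: "j \<in> {1..k}" for x j
  proof -
    have j1: "1 \<le> real j" "real j \<le> real k" using j by auto
    have jh: "real j * h \<le> real k * h" using j1 h by (intro mult_right_mono) auto
    have "(NNINT z. indicator (ball 0 h) z * ennreal (U (x + real j *\<^sub>R z)))
       \<le> ennreal (\<bar>real j\<bar> ^ DIM(real^'n)) * (NNINT z. ennreal (U (x + real j *\<^sub>R z)) * indicator (ball x (real k * h)) (x + real j *\<^sub>R z))"
    proof -
      have "(NNINT z. indicator (ball 0 h) z * ennreal (U (x + real j *\<^sub>R z)))
        \<le> (NNINT z. ennreal (U (x + real j *\<^sub>R z)) * indicator (ball x (real k * h)) (x + real j *\<^sub>R z))"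
      proof (rule nn_integral_mono)
        fix z :: "real^'n"
        have "norm (real j *\<^sub>R z) < real k * h" if "norm z < h"
        proof -
          have "real j * norm z < real j * h" using that j1 by simp
          then show ?thesis using jh by simp
        qed
        then show "indicator (ball 0 h) z * ennreal (U (x + real j *\<^sub>R z)) \<le> ennreal (U (x + real j *\<^sub>R z)) * indicator (ball x (real k * h)) (x + real j *\<^sub>R z)"
          by (auto simp: dist_norm split: split_indicator)
      qed
      \<comment> \<open>The substitution y = x + j z has Jacobian j^d \<ge> 1, so it may be inserted
        for free.\<close>
      moreover have "1 \<le> ennreal (\<bar>real j\<bar> ^ DIM(real^'n))"
        using j1 by (metis abs_of_nat ennreal_1 ennreal_leI one_le_power)
      ultimately show ?thesis by (metis (no_types, lifting) dual_order.trans mult_1 mult_right_mono zero_le)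
    qed
    also have "\<dots> = mass U (ball x (real k * h))"
      unfolding mass_def using j1
      by (intro nn_integral_lborel_affine[symmetric, where f="\<lambda>y. ennreal (U y) * indicator (ball x (real k * h)) y"]) auto
    also have "\<dots> \<le> ennreal J" by (rule local[OF x])
    finally show ?thesis .
  qed
  have massT: "mass U ?T \<le> ennreal (G * (5 * R) powr m)"
  proof -
    have "mass U ?T \<le> mass U (ball 0 (5 * R))" using R by (intro mass_mono) (auto simp: annulus_def)
    also have "\<dots> \<le> ennreal (G * (5 * R) powr m)" using M[of "5 * R"] R by simp
    finally show ?thesis .
  qed
  let ?I = "\<integral>\<^sup>+x. ennreal ((U x)\<^sup>2) * indicator ?T x \<partial>lborel"
  let ?Dz = "\<lambda>z x. (fdiff k U z x)\<^sup>2"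
  let ?P = "\<lambda>j z. \<integral>\<^sup>+x. ennreal (U x * U (x + real j *\<^sub>R z)) * indicator ?T x \<partial>lborel"
  have pointz: "?I \<le> ennreal ((K * norm z powr s)\<^sup>2) + ennreal (2 ^ (k + 1)) * (\<Sum>j=1..k. ?P j z)" for z
  proof -
    have "?I \<le> (NNINT x. ennreal (?Dz z x) + ennreal (2 ^ (k + 1)) * (\<Sum>j=1..k. ennreal (U x * U (x + real j *\<^sub>R z)) * indicator ?T x))"
    proof (rule nn_integral_mono)
      fix x
      show "ennreal ((U x)\<^sup>2) * indicator ?T x \<le> ennreal (?Dz z x) + ennreal (2 ^ (k + 1)) * (\<Sum>j=1..k. ennreal (U x * U (x + real j *\<^sub>R z)) * indicator ?T x)"
      proof (cases "x \<in> ?T")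
        case True
        have "(U x)\<^sup>2 \<le> ?Dz z x + 2 ^ (k + 1) * (\<Sum>j=1..k. U x * U (x + real j *\<^sub>R z))"
          using finite_difference_square_bound[of "\<lambda>j. U (x + real j *\<^sub>R z)" k] U0 by simp
        then have "ennreal ((U x)\<^sup>2) \<le> ennreal (?Dz z x + 2 ^ (k + 1) * (\<Sum>j=1..k. U x * U (x + real j *\<^sub>R z)))"
          by (rule ennreal_leI)
        also have "\<dots> = ennreal (?Dz z x) + ennreal (2 ^ (k + 1) * (\<Sum>j=1..k. U x * U (x + real j *\<^sub>R z)))"
          using U0 by (intro ennreal_plus) (auto intro!: mult_nonneg_nonneg sum_nonneg)
        also have "ennreal (2 ^ (k + 1) * (\<Sum>j=1..k. U x * U (x + real j *\<^sub>R z))) = ennreal (2 ^ (k + 1)) * (\<Sum>j=1..k. ennreal (U x * U (x + real j *\<^sub>R z)))"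
          using U0 by (subst ennreal_mult') (auto simp: sum_ennreal)
        finally show ?thesis using True by simp
      qed simp
    qed
    also have "\<dots> = (NNINT x. ennreal (?Dz z x)) + ennreal (2 ^ (k + 1)) * (\<Sum>j=1..k. ?P j z)"
      by (subst nn_integral_add) (auto simp: nn_integral_cmult nn_integral_sum simp del: sum_mult_indicator)
    also have "\<dots> \<le> ennreal ((K * norm z powr s)\<^sup>2) + ennreal (2 ^ (k + 1)) * (\<Sum>j=1..k. ?P j z)"
      by (intro add_right_mono diff)
    finally show ?thesis .
  qed
  \<comment> \<open>After exchanging the integrals, the average over z sees only U (x + j z), which
    \<open>inner\<close> bounds uniformly on the annulus; what remains is the mass of the
    annulus.\<close>
  have avg: "(NNINT z. indicator (ball 0 h) z * ?P j z) \<le> ennreal (J * (G * (5 * R) powr m))" if j: "j \<in> {1..k}" for j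
  proof -
    have "(NNINT z. indicator (ball 0 h) z * ?P j z)
      = (NNINT z. (NNINT x. indicator (ball 0 h) z * (ennreal (U x * U (x + real j *\<^sub>R z)) * indicator ?T x)))"
      by (intro nn_integral_cong nn_integral_cmult[symmetric]) measurable
    also have "\<dots> = (NNINT x. (NNINT z. indicator (ball 0 h) z * (ennreal (U x * U (x + real j *\<^sub>R z)) * indicator ?T x)))"
      by (rule lborel_pair.Fubini') measurable
    also have "\<dots> = (NNINT x. (ennreal (U x) * indicator ?T x) * (NNINT z. indicator (ball 0 h) z * ennreal (U (x + real j *\<^sub>R z))))"
      by (intro nn_integral_cong, subst nn_integral_cmult[symmetric])
         (auto intro!: nn_integral_cong simp: ennreal_mult' U0 mult_ac)
    also have "\<dots> \<le> (NNINT x. (ennreal (U x) * indicator ?T x) * ennreal J)"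
      using inner[OF _ j] by (intro nn_integral_mono) (auto intro!: mult_left_mono split: split_indicator)
    also have "\<dots> = mass U ?T * ennreal J"
      unfolding mass_def by (rule nn_integral_multc) simp
    also have "\<dots> \<le> ennreal (G * (5 * R) powr m) * ennreal J" by (intro mult_right_mono massT) simp
    also have "\<dots> = ennreal (J * (G * (5 * R) powr m))" using J0 G by (simp add: ennreal_mult'[symmetric] mult.commute)
    finally show ?thesis .
  qed
  let ?V = "?\<omega> * h ^ ?D"
  have V: "0 < ?V" using \<omega> h by simp
  let ?E = "(K * h powr s)\<^sup>2 * ?V + 2 ^ (k + 1) * (real k * (J * (G * (5 * R) powr m)))"
  have eV: "emeasure lborel (ball (0::real^'n) h) = ennreal ?V" using h by (simp add: emeasure_ball_scaled)
  have "ennreal ?V * ?I = (NNINT z::real^'n. indicator (ball 0 h) z * ?I)"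
    by (subst nn_integral_multc) (auto simp: eV)
  also have "\<dots> \<le> (NNINT z. ennreal ((K * h powr s)\<^sup>2) * indicator (ball 0 h) z + ennreal (2 ^ (k + 1)) * (\<Sum>j=1..k. indicator (ball 0 h) z * ?P j z))"
  proof (rule nn_integral_mono)
    fix z :: "real^'n"
    show "indicator (ball 0 h) z * ?I \<le> ennreal ((K * h powr s)\<^sup>2) * indicator (ball 0 h) z + ennreal (2 ^ (k + 1)) * (\<Sum>j=1..k. indicator (ball 0 h) z * ?P j z)"
    proof (cases "norm z < h")
      case True
      have "norm z powr s \<le> h powr s" using True s by (intro powr_mono2) auto
      then have "(K * norm z powr s)\<^sup>2 \<le> (K * h powr s)\<^sup>2" using K by (intro power_mono mult_left_mono) auto
      then have "ennreal ((K * norm z powr s)\<^sup>2) \<le> ennreal ((K * h powr s)\<^sup>2)" by (rule ennreal_leI)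
      then have "?I \<le> ennreal ((K * h powr s)\<^sup>2) + ennreal (2 ^ (k + 1)) * (\<Sum>j=1..k. ?P j z)"
        using order_trans[OF pointz[of z] add_right_mono] by blast
      then show ?thesis using True by simp
    qed simp
  qed
  also have "\<dots> = ennreal ((K * h powr s)\<^sup>2) * ennreal ?V + ennreal (2 ^ (k + 1)) * (\<Sum>j=1..k. \<integral>\<^sup>+z. indicator (ball 0 h) z * ?P j z \<partial>lborel)"
    by (subst nn_integral_add)
       (auto simp: nn_integral_cmult_indicator eV nn_integral_cmult nn_integral_sum simp del: sum_mult_indicator sum_indicator_mult)
  also have "\<dots> \<le> ennreal ((K * h powr s)\<^sup>2) * ennreal ?V + ennreal (2 ^ (k + 1)) * (\<Sum>j=1..k. ennreal (J * (G * (5 * R) powr m)))"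
    by (intro add_left_mono mult_left_mono sum_mono avg) auto
  also have "\<dots> = ennreal (?E)"
    using V J0 G by (simp add: ennreal_mult'[symmetric] ennreal_plus[symmetric] ennreal_of_nat_eq_real_of_nat del: ennreal_plus)
  finally have fin: "ennreal ?V * ?I \<le> ennreal (?E)" .
  have "ennreal (inverse ?V) * (ennreal ?V * ?I) \<le> ennreal (inverse ?V) * ennreal (?E)"
    by (rule mult_left_mono[OF fin]) simp
  moreover have "ennreal (inverse ?V) * ennreal ?V = 1" by (rule ennreal_inverse_mult[OF V])
  moreover have "ennreal (inverse ?V) * ennreal (?E)
     = ennreal (inverse ?V * (?E))"
    using V by (intro ennreal_mult'[symmetric]) (simp del: inverse_mult_distrib)
  ultimately have "?I \<le> ennreal (inverse ?V * (?E))"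
    by (simp only: mult.assoc[symmetric] mult_1_left)
  also have "inverse ?V * (?E)
     = (K * h powr s)\<^sup>2 + 2 ^ (k + 1) * real k * 2 ^ ?D * real k ^ (?D - 1) * 25 powr m / ?\<omega> * (G\<^sup>2 * (R powr (2 * m - (real ?D - 1)) / h))"
  proof -
    have D1: "1 \<le> ?D" by (simp add: Suc_leI)
    have hD: "h ^ ?D = h ^ (?D - 1) * h" using D1 by (subst power_minus_mult) auto
    \<comment> \<open>The two mass bounds at radius 5 R, one inside J and one for the annulus,
      contribute 5^m each.\<close>
    have g1: "(5 * R) powr m * (5 * R) powr m = 25 powr m * (R powr m * R powr m)"
    proof -
      have "(5::real) powr m * 5 powr m = 25 powr m" by (simp flip: powr_mult)
      then show ?thesis using R by (simp add: powr_mult mult_ac)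
    qed
    have g2: "R powr m * R powr m / R ^ (?D - 1) = R powr (2 * m - (real ?D - 1))"
    proof -
      have "R ^ (?D - 1) = R powr (real ?D - 1)" using R D1 by (simp add: powr_realpow[symmetric] of_nat_diff)
      then show ?thesis by (simp add: powr_diff powr_add[symmetric])
    qed
    have g3: "inverse ?V * (2 ^ (k + 1) * (real k * (J * (G * (5 * R) powr m))))
      = 2 ^ (k + 1) * real k * 2 ^ ?D * real k ^ (?D - 1) / ?\<omega> * (G\<^sup>2 * (((5 * R) powr m * (5 * R) powr m) / R ^ (?D - 1) / h))"
      using h R \<omega> unfolding J_def hD by (simp add: power_mult_distrib power_divide power2_eq_square field_simps)
    have g4: "(5 * R) powr m * (5 * R) powr m / R ^ (?D - 1) = 25 powr m * R powr (2 * m - (real ?D - 1))"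
      unfolding g1 g2[symmetric] by simp
    have "inverse ?V * (2 ^ (k + 1) * (real k * (J * (G * (5 * R) powr m))))
      = 2 ^ (k + 1) * real k * 2 ^ ?D * real k ^ (?D - 1) * 25 powr m / ?\<omega> * (G\<^sup>2 * (R powr (2 * m - (real ?D - 1)) / h))"
      unfolding g3 g4 by simp
    moreover have "inverse v * (c * v) = c" if "0 < v" for v c :: real using that by simp
    from this[OF V] have "inverse ?V * ((K * h powr s)\<^sup>2 * ?V) = (K * h powr s)\<^sup>2" .
    ultimately show ?thesis by (simp only: distrib_left)
  qed
  finally show ?thesis .
qed

section \<open>Interpolation and summation over dyadic annuli\<close>

lemma nn_integral_powr_interpolate:
  fixes U :: "'a::euclidean_space \<Rightarrow> real"
  assumes [measurable]: "U \<in> borel_measurable borel" "X \<in> sets borel" and U0: "\<And>x. 0 \<le> U x"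
    and p: "1 < p" "p < 2" and I: "0 < I1" "0 < I2"
    and 1: "mass U X \<le> ennreal I1"
    and 2: "(NNINT x. ennreal ((U x)\<^sup>2) * indicator X x) \<le> ennreal I2"
  shows "(NNINT x. ennreal (U x powr p) * indicator X x) \<le> ennreal (2 * (I1 powr (2 - p) * I2 powr (p - 1)))"
proof -
  \<comment> \<open>Heights below l are charged to the first moment and heights above l to the
    second. This l makes both charges equal to I1^(2 - p) I2^(p - 1), whence the factor 2.\<close>
  define l where "l = I2 / I1"
  have l: "0 < l" using I by (simp add: l_def)
  have pt: "t powr p \<le> l powr (p - 1) * t + l powr (p - 2) * t\<^sup>2" if t: "0 \<le> t" for t
  proof (cases "t = 0")
    case False
    with t have t0: "0 < t" by simp
    show ?thesis
    proof (cases "t \<le> l")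
      case True
      have "t powr p = t powr (p - 1) * t" using powr_add[of t "p - 1" 1] t0 by simp
      also have "\<dots> \<le> l powr (p - 1) * t" using True p t0 by (intro mult_right_mono powr_mono2) auto
      finally show ?thesis by (simp add: add_increasing2)
    next
      case False
      have "t powr p = t powr (p - 2) * t\<^sup>2" using powr_add[of t "p - 2" 2] t0 by simp
      also have "\<dots> \<le> l powr (p - 2) * t\<^sup>2"
        using False p l by (intro mult_right_mono powr_mono2') auto
      finally show ?thesis using t0 by (simp add: add_increasing)
    qed
  qed simp
  have "(NNINT x. ennreal (U x powr p) * indicator X x)
     \<le> (NNINT x. ennreal (l powr (p - 1)) * (ennreal (U x) * indicator X x) + ennreal (l powr (p - 2)) * (ennreal ((U x)\<^sup>2) * indicator X x))"
  proof (rule nn_integral_mono)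
    fix x
    have "ennreal (U x powr p) \<le> ennreal (l powr (p - 1) * U x + l powr (p - 2) * (U x)\<^sup>2)"
      by (rule ennreal_leI[OF pt[OF U0]])
    also have "\<dots> = ennreal (l powr (p - 1)) * ennreal (U x) + ennreal (l powr (p - 2)) * ennreal ((U x)\<^sup>2)"
      using U0[of x] by (simp add: ennreal_mult')
    finally show "ennreal (U x powr p) * indicator X x \<le> ennreal (l powr (p - 1)) * (ennreal (U x) * indicator X x) + ennreal (l powr (p - 2)) * (ennreal ((U x)\<^sup>2) * indicator X x)"
      by (auto split: split_indicator)
  qed
  also have "\<dots> = ennreal (l powr (p - 1)) * mass U X + ennreal (l powr (p - 2)) * (NNINT x. ennreal ((U x)\<^sup>2) * indicator X x)"
    unfolding mass_def by (subst nn_integral_add) (auto simp: nn_integral_cmult)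
  also have "\<dots> \<le> ennreal (l powr (p - 1)) * ennreal I1 + ennreal (l powr (p - 2)) * ennreal I2"
    by (intro add_mono mult_left_mono 1 2) auto
  also have "\<dots> = ennreal (l powr (p - 1) * I1 + l powr (p - 2) * I2)"
    using I by (simp add: ennreal_mult'[symmetric] ennreal_plus[symmetric] del: ennreal_plus)
  also have "l powr (p - 1) * I1 + l powr (p - 2) * I2 = 2 * (I1 powr (2 - p) * I2 powr (p - 1))"
  proof -
    have a: "l powr (p - 1) = I2 powr (p - 1) / I1 powr (p - 1)" using I by (simp add: l_def powr_divide)
    have b: "l powr (p - 2) = I2 powr (p - 2) / I1 powr (p - 2)" using I by (simp add: l_def powr_divide)
    have c: "I2 powr (p - 2) * I2 = I2 powr (p - 1)" using powr_add[of I2 "p - 2" 1] I by simp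
    have d: "I1 / I1 powr (p - 1) = I1 powr (2 - p)" using powr_diff[of I1 1 "p - 1"] I by (simp add: algebra_simps)
    have e: "1 / I1 powr (p - 2) = I1 powr (2 - p)" using powr_minus_divide[of I1 "p - 2"] by simp
    have "l powr (p - 1) * I1 = I2 powr (p - 1) * (I1 / I1 powr (p - 1))" by (simp add: a)
    moreover have "l powr (p - 2) * I2 = (I2 powr (p - 2) * I2) * (1 / I1 powr (p - 2))" by (simp add: b)
    ultimately show ?thesis by (simp only: c d e) simp
  qed
  finally show ?thesis .
qed

lemma dyadic_annuli_cover:
  fixes x :: "real^'n"
  assumes L: "0 < L" and x: "L \<le> norm x"
  shows "\<exists>i::nat. x \<in> annulus (2 ^ i * L)"
proof -
  define i where "i = nat \<lfloor>log 2 (norm x / L)\<rfloor>"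
  define l where "l = log 2 (norm x / L)"
  have l0: "0 \<le> l" unfolding l_def using L x by (subst zero_le_log_cancel_iff) (auto simp: field_simps)
  have il: "real i \<le> l" "l < real i + 1" using l0 unfolding i_def l_def by linarith+
  have "0 < norm x / L" using less_le_trans[OF L x] L by (intro divide_pos_pos)
  then have "2 powr l = norm x / L" unfolding l_def by (intro powr_log_cancel) auto
  then have eq: "norm x = 2 powr l * L" using L by simp
  have "2 powr real i \<le> 2 powr l" "2 powr l < 2 powr (real i + 1)"
    using il by (auto intro: powr_mono powr_less_mono)
  then have "2 ^ i \<le> 2 powr l" "2 powr l < 2 * 2 ^ i" by (auto simp: powr_realpow powr_add)
  then show ?thesis using L by (auto simp: annulus_def eq intro!: exI[of _ i])
qed

text \<open>The interface between the Fourier side and the summation, with U in the role of |D^r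
  \<phi>|, B of the norm of D^S \<phi>, and B L^S of the norm of \<phi>. The numerical factor 2 in
  the last clause is the square of the sqrt 2 from \<open>weighted_L2_interpolation\<close>.\<close>

definition radial_bounds :: "real \<Rightarrow> real \<Rightarrow> real \<Rightarrow> real \<Rightarrow> nat \<Rightarrow> (real^'n \<Rightarrow> real) \<Rightarrow> real \<Rightarrow> real \<Rightarrow> bool" where
  "radial_bounds r S c1 c3 k U B L \<longleftrightarrow> U \<in> borel_measurable borel \<and> (\<forall>x. 0 \<le> U x) \<and> 0 < B \<and> 0 < L
     \<and> (\<forall>Q. orthogonal_transformation Q \<longrightarrow> (AE x in lborel. U (Q x) = U x))
     \<and> (\<forall>R>0. mass U (ball 0 R) \<le> ennreal (c1 * (B * L powr S) * R powr (real CARD('n) / 2 - r)))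
     \<and> (\<forall>z. (NNINT x. ennreal ((fdiff k U z x)\<^sup>2)) \<le> ennreal ((c3 * B * norm z powr (S - r))\<^sup>2))
     \<and> (NNINT x. ennreal ((U x)\<^sup>2)) \<le> ennreal (2 * (B * L powr (S - r))\<^sup>2)"

text \<open>With \<open>A = B L\<^sup>S\<close>, the step \<open>h\<close> on the annulus of radius \<open>\<rho> L\<close> is a multiple of \<open>L \<rho>\<close> to the
  power \<open>- (2 r - 1) / (2 s + 1)\<close>, which balances the two terms of the annulus bound.\<close>

lemma radial_low_exponent:
  fixes r S p c1 c3 :: real and k :: nat
  defines "d \<equiv> real CARD('n)"
  defines "s \<equiv> S - r" and "m \<equiv> d / 2 - r"
  defines "\<kappa> \<equiv> (2 * r - 1) / (2 * (S - r) + 1)"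
  assumes r: "1 / 2 < r" "r < d / 2" and s: "0 < s" and p: "1 < p" "p < 2"
    and exponent: "m * (2 - p) < 2 * s * \<kappa> * (p - 1)"
    and c1: "0 < c1" and c3: "0 < c3" and k: "1 \<le> k"
  shows "\<exists>C\<ge>0. \<forall>(U::real^'n \<Rightarrow> real) B L. radial_bounds r S c1 c3 k U B L
     \<longrightarrow> (NNINT x. ennreal (U x powr p))
        \<le> ennreal (C * ((B * L powr (m + S)) powr (2 - p) * ((B * L powr s)\<^sup>2) powr (p - 1)))" (is "\<exists>C\<ge>0. \<forall>U B L. _ U B L \<longrightarrow> ?bound C U B L")
proof -
  let ?\<omega> = "unit_ball_volume TYPE(real^'n)"
  note \<omega> = unit_ball_volume_pos[where 'a="real^'n"]
  have m: "0 < m" using r by (simp add: m_def)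
  have \<kappa>: "0 < \<kappa>" using r s by (simp add: \<kappa>_def s_def)
  \<comment> \<open>The balance of exponents: with h proportional to \<rho>^(-\<kappa>), the
    difference term h^(2s) and the product term \<rho>^(1 - 2r) / h carry the same power of
    \<rho>.\<close>
  have \<kappa>eq: "\<kappa> + 1 - 2 * r = - (2 * s * \<kappa>)"
  proof -
    have "\<kappa> * (2 * s + 1) = 2 * r - 1" using s by (simp add: \<kappa>_def s_def)
    then show ?thesis by (simp add: algebra_simps)
  qed
  define W where "W = 2 ^ (k + 1) * real k * 2 ^ CARD('n) * real k ^ (CARD('n) - 1) * 25 powr m / ?\<omega>"
  have W: "0 < W" using k \<omega> by (simp add: W_def)
  \<comment> \<open>The first summand comes from the difference term, where h carries a factor 1/k;
    the second from the product term, where dividing by h returns the factor k.\<close>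
  define c5 where "c5 = c3\<^sup>2 * ((1 / real k) powr s)\<^sup>2 + W * c1\<^sup>2 * real k"
  have c5: "0 < c5" using c3 W c1 k by (auto simp: c5_def intro!: add_pos_nonneg)
  \<comment> \<open>The ratio between consecutive dyadic annuli after interpolation; the assumption
    \<open>exponent\<close> says exactly that it is less than one.\<close>
  define q where "q = 2 powr (m * (2 - p) - 2 * s * \<kappa> * (p - 1))"
  have q: "0 < q" "q < 1" using exponent by (auto simp: q_def powr_less_one)
  define C1 where "C1 = 2 * (c1 powr (2 - p) * 2 powr (p - 1))"
  define C2 where "C2 = 2 * ((c1 * 2 powr m) powr (2 - p) * c5 powr (p - 1))"
  define C where "C = C1 + C2 / (1 - q)"
  have C12: "0 \<le> C1" "0 \<le> C2" by (auto simp: C1_def C2_def)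
  have C: "0 \<le> C" using C12 q by (simp add: C_def)
  have main: "?bound C U B L"
    if Um [measurable]: "U \<in> borel_measurable borel" and U0: "\<And>x. 0 \<le> U x" and B: "0 < B" and L: "0 < L"
      and rot: "\<And>Q. orthogonal_transformation Q \<Longrightarrow> AE x in lborel. U (Q x) = U x"
      and M: "\<And>R. 0 < R \<Longrightarrow> mass U (ball 0 R) \<le> ennreal (c1 * (B * L powr S) * R powr m)"
      and diff: "\<And>z. (NNINT x. ennreal ((fdiff k U z x)\<^sup>2))
          \<le> ennreal ((c3 * B * norm z powr s)\<^sup>2)"
      and L2: "(NNINT x. ennreal ((U x)\<^sup>2)) \<le> ennreal (2 * (B * L powr s)\<^sup>2)"
    for U :: "real^'n \<Rightarrow> real" and B L :: real
  proof -
    define X where "X = B * L powr (m + S)"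
    define Y where "Y = (B * L powr s)\<^sup>2"
    have X: "0 < X" and Y: "0 < Y" using B L by (auto simp: X_def Y_def)
    have XL: "c1 * (B * L powr S) * (t * L) powr m = c1 * t powr m * X" if "0 < t" for t
      using that L by (simp add: X_def powr_mult powr_add mult_ac)
    have inner: "(NNINT x. ennreal (U x powr p) * indicator (ball 0 L) x) \<le> ennreal (C1 * (X powr (2 - p) * Y powr (p - 1)))"
    proof -
      have "(NNINT x. ennreal (U x powr p) * indicator (ball 0 L) x) \<le> ennreal (2 * ((c1 * X) powr (2 - p) * (2 * Y) powr (p - 1)))"
      proof (rule nn_integral_powr_interpolate[OF Um _ U0 p])
        show "mass U (ball 0 L) \<le> ennreal (c1 * X)" using M[OF L] XL[OF zero_less_one] unfolding mult_1_left powr_one_eq_one mult_1_right by simp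
        have "(NNINT x. ennreal ((U x)\<^sup>2) * indicator (ball 0 L) x) \<le> (NNINT x. ennreal ((U x)\<^sup>2))"
          by (intro nn_integral_mono) (auto split: split_indicator)
        then show "(NNINT x. ennreal ((U x)\<^sup>2) * indicator (ball 0 L) x) \<le> ennreal (2 * Y)"
          using L2 by (simp add: Y_def)
      qed (use c1 X Y in auto)
      also have "2 * ((c1 * X) powr (2 - p) * (2 * Y) powr (p - 1)) = C1 * (X powr (2 - p) * Y powr (p - 1))"
        using c1 X Y by (simp add: C1_def powr_mult)
      finally show ?thesis .
    qed
    have outer: "(NNINT x. ennreal (U x powr p) * indicator (annulus (2 ^ i * L)) x) \<le> ennreal (C2 * (X powr (2 - p) * Y powr (p - 1)) * q ^ i)" for i :: nat
    proof -
      define \<rho> where "\<rho> = (2::real) ^ i"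
      have \<rho>: "1 \<le> \<rho>" by (simp add: \<rho>_def)
      have \<rho>0: "0 < \<rho>" using \<rho> by simp
      \<comment> \<open>Dividing by k keeps all k steps within k h = \<rho>^(-\<kappa>) L, which is
        at most the radius \<rho> L because \<rho> \<ge> 1.\<close>
      define h where "h = \<rho> powr - \<kappa> * L / real k"
      have h: "0 < h" using \<rho> L k by (simp add: h_def)
      have kh: "real k * h \<le> \<rho> * L"
      proof -
        have "\<rho> powr - \<kappa> \<le> \<rho> powr 1" using \<rho> \<kappa> by (intro powr_mono) auto
        then show ?thesis using k L \<rho> by (simp add: h_def)
      qed
      have "(NNINT x. ennreal ((U x)\<^sup>2) * indicator (annulus (\<rho> * L)) x)
        \<le> ennreal ((c3 * B * h powr s)\<^sup>2 + W * ((c1 * (B * L powr S))\<^sup>2 * ((\<rho> * L) powr (2 * m - (real CARD('n) - 1)) / h)))"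
        unfolding W_def
        by (rule annulus_L2_bound[OF Um U0 rot M _ _ diff _ _ h kh k])
           (use c1 c3 B L m s \<rho> in auto)
      also have "(c3 * B * h powr s)\<^sup>2 + W * ((c1 * (B * L powr S))\<^sup>2 * ((\<rho> * L) powr (2 * m - (real CARD('n) - 1)) / h)) = c5 * Y * \<rho> powr - (2 * s * \<kappa>)"
      proof -
        have hs: "h powr s = \<rho> powr - (s * \<kappa>) * L powr s * (1 / real k) powr s"
        proof -
          have "h = \<rho> powr - \<kappa> * L * (1 / real k)" by (simp add: h_def)
          then have "h powr s = (\<rho> powr - \<kappa>) powr s * L powr s * (1 / real k) powr s"
            by (simp only: powr_mult)
          then show ?thesis by (simp add: powr_powr mult.commute)
        qed
        have sq: "(\<rho> powr - (s * \<kappa>))\<^sup>2 = \<rho> powr - (2 * s * \<kappa>)"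
          by (simp add: power2_eq_square powr_add[symmetric] algebra_simps)
        have t1: "(c3 * B * h powr s)\<^sup>2 = c3\<^sup>2 * ((1 / real k) powr s)\<^sup>2 * Y * \<rho> powr - (2 * s * \<kappa>)"
          unfolding hs Y_def sq[symmetric] by (simp add: power_mult_distrib mult_ac)
        have e: "2 * m - (real CARD('n) - 1) = 1 - 2 * r" by (simp add: m_def d_def)
        have "(\<rho> * L) powr (1 - 2 * r) / h = real k * (\<rho> powr (1 - 2 * r) / \<rho> powr - \<kappa>) * (L powr (1 - 2 * r) / L)"
          using L \<rho>0 by (simp add: h_def powr_mult field_simps)
        also have "\<rho> powr (1 - 2 * r) / \<rho> powr - \<kappa> = \<rho> powr - (2 * s * \<kappa>)"
        proof -
          have "1 - 2 * r - - \<kappa> = - (2 * s * \<kappa>)" using \<kappa>eq by simp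
          then show ?thesis using powr_diff[of \<rho> "1 - 2 * r" "- \<kappa>"] by (simp only:)
        qed
        also have "L powr (1 - 2 * r) / L = L powr (- 2 * r)"
          using powr_diff[of L "1 - 2 * r" 1] L by simp
        finally have t2: "(\<rho> * L) powr (1 - 2 * r) / h = real k * \<rho> powr - (2 * s * \<kappa>) * L powr (- 2 * r)" .
        have t3: "(L powr S)\<^sup>2 * L powr (- 2 * r) = (L powr s)\<^sup>2"
          unfolding power2_eq_square powr_add[symmetric] by (simp add: s_def algebra_simps)
        have "W * ((c1 * (B * L powr S))\<^sup>2 * ((\<rho> * L) powr (1 - 2 * r) / h))
          = W * c1\<^sup>2 * real k * (B\<^sup>2 * ((L powr S)\<^sup>2 * L powr (- 2 * r))) * \<rho> powr - (2 * s * \<kappa>)"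
          unfolding t2 by (simp add: power_mult_distrib mult_ac)
        also have "\<dots> = W * c1\<^sup>2 * real k * Y * \<rho> powr - (2 * s * \<kappa>)"
          unfolding t3 Y_def by (simp add: power_mult_distrib)
        finally show ?thesis unfolding e t1 c5_def by (simp only: distrib_right)
      qed
      finally have I2: "(NNINT x. ennreal ((U x)\<^sup>2) * indicator (annulus (\<rho> * L)) x) \<le> ennreal (c5 * Y * \<rho> powr - (2 * s * \<kappa>))" .
      have "mass U (annulus (\<rho> * L)) \<le> mass U (ball 0 ((2 * \<rho>) * L))"
        by (intro mass_mono) (auto simp: annulus_def)
      also have "\<dots> \<le> ennreal (c1 * (2 * \<rho>) powr m * X)"
        using M[of "(2 * \<rho>) * L"] XL[of "2 * \<rho>"] \<rho> L by simp
      finally have I1: "mass U (annulus (\<rho> * L)) \<le> ennreal (c1 * (2 * \<rho>) powr m * X)" .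
      have "(NNINT x. ennreal (U x powr p) * indicator (annulus (\<rho> * L)) x)
        \<le> ennreal (2 * ((c1 * (2 * \<rho>) powr m * X) powr (2 - p) * (c5 * Y * \<rho> powr - (2 * s * \<kappa>)) powr (p - 1)))"
        by (rule nn_integral_powr_interpolate[OF Um annulus_sets U0 p _ _ I1 I2]) (use c1 c5 X Y \<rho>0 in auto)
      also have "2 * ((c1 * (2 * \<rho>) powr m * X) powr (2 - p) * (c5 * Y * \<rho> powr - (2 * s * \<kappa>)) powr (p - 1))
         = C2 * (X powr (2 - p) * Y powr (p - 1)) * q ^ i"
      proof -
        have f1: "(c1 * (2 * \<rho>) powr m * X) powr (2 - p) = (c1 * 2 powr m) powr (2 - p) * X powr (2 - p) * \<rho> powr (m * (2 - p))"
        proof -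
          have "c1 * (2 * \<rho>) powr m * X = (c1 * 2 powr m) * X * \<rho> powr m" by (simp add: powr_mult)
          then show ?thesis by (simp only: powr_mult[of "c1 * 2 powr m * X"] powr_mult[of "c1 * 2 powr m" X] powr_powr)
        qed
        have f2: "(c5 * Y * \<rho> powr - (2 * s * \<kappa>)) powr (p - 1) = c5 powr (p - 1) * Y powr (p - 1) * \<rho> powr (- (2 * s * \<kappa>) * (p - 1))"
          by (simp only: powr_mult powr_powr)
        have f3: "\<rho> powr (m * (2 - p)) * \<rho> powr (- (2 * s * \<kappa>) * (p - 1)) = q ^ i"
        proof -
          have "\<rho> powr (m * (2 - p)) * \<rho> powr (- (2 * s * \<kappa>) * (p - 1)) = \<rho> powr (m * (2 - p) - 2 * s * \<kappa> * (p - 1))"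
            unfolding powr_add[symmetric] by (simp add: algebra_simps)
          also have "\<dots> = (2 powr real i) powr (m * (2 - p) - 2 * s * \<kappa> * (p - 1))"
            by (simp add: \<rho>_def powr_realpow)
          also have "\<dots> = q powr real i"
            by (simp add: q_def powr_powr mult.commute)
          finally show ?thesis using q by (simp add: powr_realpow)
        qed
        show ?thesis unfolding f1 f2 C2_def f3[symmetric] by (simp add: mult_ac)
      qed
      finally show ?thesis by (simp add: \<rho>_def)
    qed
    let ?Z = "X powr (2 - p) * Y powr (p - 1)"
    let ?a = "\<lambda>i x. ennreal (U x powr p) * indicator (annulus (2 ^ i * L)) x"
    have "(NNINT x. ennreal (U x powr p))
      \<le> (NNINT x. ennreal (U x powr p) * indicator (ball 0 L) x + (\<Sum>i. ?a i x))"
    proof (rule nn_integral_mono)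
      fix x :: "real^'n"
      show "ennreal (U x powr p) \<le> ennreal (U x powr p) * indicator (ball 0 L) x + (\<Sum>i. ?a i x)"
      proof (cases "norm x < L")
        case True
        then show ?thesis by simp
      next
        case False
        then obtain i :: nat where i: "x \<in> annulus (2 ^ i * L)" using dyadic_annuli_cover[OF L, of x] by auto
        have "ennreal (U x powr p) = ?a i x" using i by simp
        also have "\<dots> \<le> (\<Sum>i. ?a i x)"
          by (rule ennreal_term_le_suminf)
        finally show ?thesis by (simp add: add_increasing)
      qed
    qed
    also have "\<dots> = (NNINT x. ennreal (U x powr p) * indicator (ball 0 L) x) + (NNINT x. (\<Sum>i. ?a i x))"
      by (rule nn_integral_add) measurable
    also have "(NNINT x. (\<Sum>i. ?a i x)) = (\<Sum>i. NNINT x. ?a i x)"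
      by (rule nn_integral_suminf) measurable
    also have "(NNINT x. ennreal (U x powr p) * indicator (ball 0 L) x) + (\<Sum>i. NNINT x. ?a i x)
       \<le> ennreal (C1 * ?Z) + (\<Sum>i. ennreal (C2 * ?Z * q ^ i))"
      by (intro add_mono inner suminf_le outer) auto
    also have "(\<Sum>i. ennreal (C2 * ?Z * q ^ i)) = ennreal (\<Sum>i. C2 * ?Z * q ^ i)"
      using q C12 by (intro suminf_ennreal2 summable_mult summable_geometric) auto
    also have "(\<Sum>i. C2 * ?Z * q ^ i) = C2 / (1 - q) * ?Z"
      using q by (subst suminf_mult) (auto simp: suminf_geometric summable_geometric)
    also have "ennreal (C1 * ?Z) + ennreal (C2 / (1 - q) * ?Z) = ennreal (C * ?Z)"
    proof -
      have "C * ?Z = C1 * ?Z + C2 / (1 - q) * ?Z" by (simp add: C_def distrib_right)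
      then show ?thesis using C12 q by (simp add: ennreal_plus[symmetric] del: ennreal_plus)
    qed
    finally show ?thesis by (simp add: X_def Y_def)
  qed
  show ?thesis
    by (rule exI[of _ C], intro conjI C allI impI)
       (use main in \<open>auto simp: radial_bounds_def s_def m_def d_def\<close>)
qed

section \<open>Mass and difference bounds from the Fourier side\<close>

lemma powr_le_exp:
  fixes a y :: real
  assumes a: "0 < a" and y: "0 \<le> y"
  shows "y powr a \<le> a powr a * exp y"
proof (cases "y = 0")
  case False
  with y have y0: "0 < y" by simp
  \<comment> \<open>The constant a^a results from ln t \<le> t - 1 at t = y/a, after a term -a in
    the exponent is dropped.\<close>
  have "ln (y / a) \<le> y / a - 1" using y0 a by (intro ln_le_minus_one) auto
  then have "a * ln (y / a) \<le> y - a" using a by (simp add: field_simps)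
  then have "a * ln y \<le> a * ln a + y" using y0 a by (simp add: ln_div algebra_simps)
  then have "exp (a * ln y) \<le> exp (a * ln a + y)" by simp
  then show ?thesis using y0 a by (simp add: powr_def exp_add)
qed simp

lemma gauss_square: "(gauss \<epsilon> x)\<^sup>2 = gauss (2 * \<epsilon>) x"
  by (simp add: gauss_def power2_eq_square exp_add[symmetric])

text \<open>Testing \<open>u\<close> against a Gaussian of width \<open>R\<close>, whose transform lives at frequencies of order \<open>1 / R\<close>.\<close>

lemma nonnegative_ball_mass_bound:
  fixes u \<psi> :: "'a::euclidean_space \<Rightarrow> complex" and U :: "'a \<Rightarrow> real"
  assumes F: "fourier_L2 u (freq_weight r \<psi>)" and \<psi>: "sq_int \<psi>"
    and Um [measurable]: "U \<in> borel_measurable borel" and U0: "\<And>x. 0 \<le> U x"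
    and uU: "AE x in lborel. u x = of_real (U x)" and r: "0 < r" and R: "0 < R"
  shows "mass U (ball 0 R) \<le> ennreal (exp pi * sqrt (r powr r) * L2norm \<psi> * R powr (real DIM('a) / 2 - r))"
proof -
  let ?d = "real DIM('a)"
  let ?b = "sqrt (r powr r) * R powr (?d / 2 - r)"
  note s = fourier_L2_sq_int[OF F]
  note [measurable] = sq_int_measurable[OF s(1)] sq_int_measurable[OF \<psi>]
  \<comment> \<open>With this width the Gaussian is at least exp (-pi) on the ball of radius R,
    which is the origin of the factor exp pi.\<close>
  define \<epsilon> where "\<epsilon> = 1 / R\<^sup>2"
  have e: "0 < \<epsilon>" using R by (simp add: \<epsilon>_def)
  let ?g = "\<lambda>x::'a. complex_of_real (gauss \<epsilon> x)"
  have gi: "integrable lborel ?g" by (intro integrable_of_real gauss_integrable e)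
  have gs: "sq_int ?g"
    unfolding sq_int_def using gauss_integrable[of "2 * \<epsilon>", where 'a='a] e by (simp add: gauss_square)
  \<comment> \<open>The weight |\<xi>|^r is moved from \<psi> onto the transform of the Gaussian, so
    that only the norm of \<psi> itself enters.\<close>
  define k where "k \<xi> = complex_of_real (norm \<xi> powr r * ghat \<epsilon> \<xi>)" for \<xi> :: 'a
  have km [measurable]: "k \<in> borel_measurable borel" unfolding k_def by measurable
  have gh: "ghat \<epsilon> \<xi> = R ^ DIM('a) * gauss (R\<^sup>2) \<xi>" for \<xi> :: 'a
    using R by (simp add: ghat_def \<epsilon>_def real_sqrt_divide)
  \<comment> \<open>The square of k contains two Gaussian factors: one absorbs (R |\<xi>|)^(2r) at
    the cost of \<open>r powr r\<close>, the other is kept for the integration over \<xi>.\<close>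
  have pt: "(cmod (k \<xi>))\<^sup>2 \<le> r powr r * R powr (2 * ?d - 2 * r) * gauss (R\<^sup>2) \<xi>" for \<xi>
  proof -
    have "((R * norm \<xi>)\<^sup>2) powr r \<le> r powr r * exp ((R * norm \<xi>)\<^sup>2)"
      by (rule powr_le_exp[OF r]) simp
    also have "\<dots> \<le> r powr r * exp (pi * R\<^sup>2 * (norm \<xi>)\<^sup>2)"
    proof -
      have "1 * (R * norm \<xi>)\<^sup>2 \<le> pi * (R * norm \<xi>)\<^sup>2" using pi_gt3 by (intro mult_right_mono) auto
      then show ?thesis by (intro mult_left_mono) (auto simp: power_mult_distrib)
    qed
    finally have a: "((R * norm \<xi>)\<^sup>2) powr r * gauss (R\<^sup>2) \<xi> \<le> r powr r"
      by (simp add: gauss_def exp_minus field_simps)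
    have b: "((R * norm \<xi>)\<^sup>2) powr r = R powr (2 * r) * (norm \<xi> powr r)\<^sup>2"
    proof -
      have "((R * norm \<xi>)\<^sup>2) powr r = ((R * norm \<xi>) powr 2) powr r" using R by simp
      also have "\<dots> = R powr (2 * r) * norm \<xi> powr (r + r)" unfolding powr_powr using R by (simp add: powr_mult)
      finally show ?thesis by (simp only: powr_add power2_eq_square)
    qed
    have c: "(R ^ DIM('a))\<^sup>2 = R powr (2 * ?d - 2 * r) * R powr (2 * r)"
    proof -
      have "R ^ DIM('a) = R powr ?d" using R by (simp add: powr_realpow)
      then have "(R ^ DIM('a))\<^sup>2 = R powr (?d + ?d)" by (simp only: power2_eq_square powr_add)
      also have "\<dots> = R powr (2 * ?d - 2 * r) * R powr (2 * r)" unfolding powr_add[symmetric] by simp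
      finally show ?thesis .
    qed
    have "(cmod (k \<xi>))\<^sup>2 = (norm \<xi> powr r)\<^sup>2 * ((R ^ DIM('a))\<^sup>2 * (gauss (R\<^sup>2) \<xi>)\<^sup>2)"
      unfolding k_def gh by (simp only: norm_of_real power2_abs power_mult_distrib)
    also have "\<dots> = R powr (2 * ?d - 2 * r) * gauss (R\<^sup>2) \<xi> * (((R * norm \<xi>)\<^sup>2) powr r * gauss (R\<^sup>2) \<xi>)"
      unfolding b c by (simp add: power2_eq_square mult_ac)
    also have "\<dots> \<le> R powr (2 * ?d - 2 * r) * gauss (R\<^sup>2) \<xi> * r powr r"
      by (intro mult_left_mono a) auto
    finally show ?thesis by (simp add: mult_ac)
  qed
  have "(NNINT \<xi>. ennreal ((cmod (k \<xi>))\<^sup>2)) \<le> (NNINT \<xi>::'a. ennreal (r powr r * R powr (2 * ?d - 2 * r)) * ennreal (gauss (R\<^sup>2) \<xi>))"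
    using pt by (intro nn_integral_mono) (simp add: ennreal_mult'[symmetric] ennreal_leI)
  also have "\<dots> = ennreal (r powr r * R powr (2 * ?d - 2 * r)) * ennreal ((1 / R) ^ DIM('a))"
    using R gauss_integrable[of "R\<^sup>2", where 'a='a] integral_gauss[of "R\<^sup>2", where 'a='a]
    by (subst nn_integral_cmult) (auto simp: nn_integral_eq_integral)
  also have "\<dots> = ennreal ((?b)\<^sup>2)"
  proof -
    have "(1 / R) ^ DIM('a) = R powr - ?d" using R by (simp add: powr_minus powr_realpow power_divide inverse_eq_divide)
    then have "R powr (2 * ?d - 2 * r) * (1 / R) ^ DIM('a) = R powr ((?d / 2 - r) + (?d / 2 - r))"
      unfolding powr_add[symmetric] by (simp only: powr_add[symmetric]) (simp add: algebra_simps)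
    also have "\<dots> = (R powr (?d / 2 - r))\<^sup>2" by (simp only: powr_add power2_eq_square)
    finally have "r powr r * R powr (2 * ?d - 2 * r) * (1 / R) ^ DIM('a) = (?b)\<^sup>2"
      by (simp add: power_mult_distrib mult.assoc)
    then show ?thesis by (subst ennreal_mult'[symmetric]) auto
  qed
  finally have *: "(NNINT \<xi>. ennreal ((cmod (k \<xi>))\<^sup>2)) \<le> ennreal ((?b)\<^sup>2)" .
  have k: "sq_int k" "L2norm k \<le> ?b"
    using sq_int_L2norm_le_nn[OF km *] by auto
  have "inv_fourier ?g \<xi> = of_real (ghat \<epsilon> \<xi>)" for \<xi>
    unfolding inv_fourier_def gauss_Fourier[OF e] by (simp add: ghat_def)
  then have "(LBINT x. u x * ?g x) = (LBINT \<xi>. \<psi> \<xi> * k \<xi>)"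
    unfolding fourier_L2_pairing[OF F gs gi] by (intro LBINT_cong) (auto simp: k_def)
  then have "cmod (LBINT x. u x * ?g x) \<le> L2norm \<psi> * L2norm k"
    using L2_Cauchy_Schwarz[OF \<psi> k(1)] by simp
  also have "\<dots> \<le> L2norm \<psi> * (?b)" by (intro mult_left_mono k) auto
  finally have b1: "cmod (LBINT x. u x * ?g x) \<le> L2norm \<psi> * (?b)" .
  have ug: "AE x in lborel. u x * ?g x = of_real (U x * gauss \<epsilon> x)"
    using uU by eventually_elim simp
  have iug: "integrable lborel (\<lambda>x. complex_of_real (U x * gauss \<epsilon> x))"
    using integrable_sq_int_mult[OF s(1) gs] ug by (subst integrable_cong_AE[where g="\<lambda>x. u x * ?g x"]) (auto elim!: eventually_mono)
  have iU: "integrable lborel (\<lambda>x. U x * gauss \<epsilon> x)" using integrable_Re[OF iug] by simp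
  have "(LBINT x. u x * ?g x) = (LBINT x. complex_of_real (U x * gauss \<epsilon> x))"
    using ug by (intro integral_cong_AE) auto
  also have "\<dots> = of_real (LBINT x. U x * gauss \<epsilon> x)" by (rule integral_complex_of_real)
  finally have b2: "(LBINT x. U x * gauss \<epsilon> x) \<le> L2norm \<psi> * (?b)"
    using b1 by simp
  have "mass U (ball 0 R) \<le> (NNINT x. ennreal (exp pi) * ennreal (U x * gauss \<epsilon> x))"
    unfolding mass_def
  proof (rule nn_integral_mono)
    fix x :: 'a
    show "ennreal (U x) * indicator (ball 0 R) x \<le> ennreal (exp pi) * ennreal (U x * gauss \<epsilon> x)"
    proof (cases "norm x < R")
      case True
      then have "(norm x)\<^sup>2 \<le> R\<^sup>2" by (intro power_mono) auto
      then have "pi * \<epsilon> * (norm x)\<^sup>2 \<le> pi * 1" using R by (simp add: \<epsilon>_def field_simps)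
      then have "1 \<le> exp pi * gauss \<epsilon> x" by (simp add: gauss_def exp_add[symmetric])
      then have "U x * 1 \<le> U x * (exp pi * gauss \<epsilon> x)" using U0 by (intro mult_left_mono)
      then have "ennreal (U x) \<le> ennreal (exp pi * (U x * gauss \<epsilon> x))" by (intro ennreal_leI) (simp add: mult_ac)
      then show ?thesis using True by (simp add: ennreal_mult')
    qed simp
  qed
  also have "\<dots> = ennreal (exp pi) * ennreal (LBINT x. U x * gauss \<epsilon> x)"
    using iU U0 by (subst nn_integral_cmult) (auto simp: nn_integral_eq_integral)
  also have "\<dots> \<le> ennreal (exp pi) * ennreal (L2norm \<psi> * (?b))"
    by (intro mult_left_mono ennreal_leI b2) auto
  also have "\<dots> = ennreal (exp pi * sqrt (r powr r) * L2norm \<psi> * R powr (?d / 2 - r))"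
    by (simp add: ennreal_mult'[symmetric] mult_ac)
  finally show ?thesis .
qed

lemma fourier_L2_zero: "fourier_L2 (\<lambda>x. 0) (\<lambda>x. 0)"
  by (simp add: fourier_L2_def sq_int_def)

lemma fourier_L2_sum:
  assumes "finite I" "\<And>i. i \<in> I \<Longrightarrow> fourier_L2 (f i) (g i)"
  shows "fourier_L2 (\<lambda>x. \<Sum>i\<in>I. f i x) (\<lambda>\<xi>. \<Sum>i\<in>I. g i \<xi>)"
  using assms by (induction I rule: finite_induct) (auto intro: fourier_L2_zero fourier_L2_add)

text \<open>Half the modulus of 1 - exp (i \<theta>) is at most 1 and at most t = pi |z| |\<xi>|.
  Hence its k-th power is at most its s-th power, because s \<le> k, and that is at most
  t^s.\<close>

lemma finite_difference_multiplier_bound: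
  fixes z \<xi> :: "'a::euclidean_space"
  assumes s: "0 \<le> s" "s \<le> real k" and k: "1 \<le> k" and nz: "\<xi> \<noteq> 0"
  shows "cmod ((1 - ifker (z \<bullet> \<xi>)) ^ k) \<le> 2 ^ k * pi powr s * norm z powr s * norm \<xi> powr s"
proof (cases "z = 0")
  case False
  let ?\<theta> = "2 * pi * (z \<bullet> \<xi>)"
  define a where "a = cmod (1 - ifker (z \<bullet> \<xi>)) / 2"
  define t where "t = pi * (norm z * norm \<xi>)"
  have t: "0 < t" using False nz by (simp add: t_def)
  have a0: "0 \<le> a" by (simp add: a_def)
  have a1: "a \<le> 1"
    using norm_triangle_ineq4[of 1 "ifker (z \<bullet> \<xi>)"] by (simp add: a_def)
  have e: "2 * pi * \<i> * complex_of_real (z \<bullet> \<xi>) = \<i> * complex_of_real ?\<theta>" by simp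
  have "cmod (1 - ifker (z \<bullet> \<xi>)) \<le> \<bar>?\<theta>\<bar>"
    unfolding e by (subst norm_minus_commute) (use iexp_approx1[of ?\<theta> 0] in simp)
  also have "\<dots> \<le> 2 * t"
    using Cauchy_Schwarz_ineq2[of z \<xi>] by (simp add: t_def abs_mult)
  finally have at: "a \<le> t" by (simp add: a_def)
  have "a ^ k \<le> t powr s"
  proof (cases "a = 0")
    case True
    then show ?thesis using k by (simp add: power_0_left)
  next
    case False
    then have ap: "0 < a" using a0 by simp
    have "a ^ k = a powr real k" using ap by (simp add: powr_realpow)
    also have "\<dots> \<le> a powr s" using ap a1 s by (intro powr_mono') auto
    also have "\<dots> \<le> t powr s" using ap at s by (intro powr_mono2) auto
    finally show ?thesis .
  qed
  then have "2 ^ k * a ^ k \<le> 2 ^ k * t powr s" by simp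
  also have "2 ^ k * t powr s = 2 ^ k * pi powr s * norm z powr s * norm \<xi> powr s"
    by (simp add: t_def powr_mult)
  finally show ?thesis by (simp add: norm_power a_def power_divide)
qed (use k in \<open>simp add: power_0_left\<close>)

text \<open>By the binomial theorem the k-th difference is the Fourier multiplier (1 - exp (2 pi i z
  . \<xi>))^k, so Plancherel reduces the claim to the pointwise multiplier bound.\<close>

lemma finite_difference_L2_bound:
  fixes u v :: "'a::euclidean_space \<Rightarrow> complex"
  assumes F: "fourier_L2 u v" and w: "sq_int (freq_weight s v)"
    and s: "0 \<le> s" "s \<le> real k" and k: "1 \<le> k"
  shows "sq_int (\<lambda>x. \<Sum>j\<le>k. of_real ((-1) ^ j * real (k choose j)) * u (x + real j *\<^sub>R z))" (is "sq_int ?D")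
    and "L2norm (\<lambda>x. \<Sum>j\<le>k. of_real ((-1) ^ j * real (k choose j)) * u (x + real j *\<^sub>R z))
      \<le> 2 ^ k * pi powr s * norm z powr s * L2norm (freq_weight s v)"
proof -
  let ?e = "\<lambda>\<xi>. ifker (z \<bullet> \<xi>)"
  have F': "fourier_L2 ?D
     (\<lambda>\<xi>. \<Sum>j\<le>k. of_real ((-1) ^ j * real (k choose j)) * (ifker ((real j *\<^sub>R z) \<bullet> \<xi>) * v \<xi>))"
    by (intro fourier_L2_sum fourier_L2_cmult fourier_L2_translate F) simp
  have eq: "(\<Sum>j\<le>k. of_real ((-1) ^ j * real (k choose j)) * (ifker ((real j *\<^sub>R z) \<bullet> \<xi>) * v \<xi>)) = (1 - ?e \<xi>) ^ k * v \<xi>" for \<xi>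
  proof -
    have ej: "ifker ((real j *\<^sub>R z) \<bullet> \<xi>) = ?e \<xi> ^ j" for j :: nat
    proof -
      have "2 * pi * \<i> * complex_of_real ((real j *\<^sub>R z) \<bullet> \<xi>) = of_nat j * (2 * pi * \<i> * complex_of_real (z \<bullet> \<xi>))" by simp
      then show ?thesis by (simp only: exp_of_nat_mult)
    qed
    have "(1 - ?e \<xi>) ^ k = (- ?e \<xi> + 1) ^ k" by simp
    also have "\<dots> = (\<Sum>j\<le>k. of_nat (k choose j) * (- ?e \<xi>) ^ j * 1 ^ (k - j))" by (rule binomial_ring)
    also have "\<dots> = (\<Sum>j\<le>k. of_real ((-1) ^ j * real (k choose j)) * ?e \<xi> ^ j)"
      by (intro sum.cong refl) (simp add: power_minus[of "exp _"] mult_ac)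
    finally have e: "(1 - ?e \<xi>) ^ k = (\<Sum>j\<le>k. of_real ((-1) ^ j * real (k choose j)) * ?e \<xi> ^ j)" .
    show ?thesis unfolding ej e by (simp only: sum_distrib_right mult.assoc)
  qed
  note sq = fourier_L2_sq_int[OF F'] and [measurable] = sq_int_measurable[OF fourier_L2_sq_int(2)[OF F]]
  show "sq_int ?D" by (rule sq(1))
  have "L2norm ?D = L2norm (\<lambda>\<xi>. (1 - ?e \<xi>) ^ k * v \<xi>)"
    using fourier_L2_Plancherel[OF F'] by (simp only: eq)
  also have "\<dots> \<le> 2 ^ k * pi powr s * norm z powr s * L2norm (freq_weight s v)"
  proof (rule L2norm_bound(2)[OF w])
    have "AE \<xi> in lborel. \<xi> \<noteq> (0::'a)" using AE_lborel_singleton by auto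
    then show "AE \<xi> in lborel. cmod ((1 - ?e \<xi>) ^ k * v \<xi>) \<le> 2 ^ k * pi powr s * norm z powr s * cmod (of_real (norm \<xi> powr s) * v \<xi>)"
    proof eventually_elim
      case (elim \<xi>)
      have "cmod ((1 - ?e \<xi>) ^ k) * cmod (v \<xi>) \<le> (2 ^ k * pi powr s * norm z powr s * norm \<xi> powr s) * cmod (v \<xi>)"
        by (intro mult_right_mono finite_difference_multiplier_bound s k elim) simp
      then show ?case by (simp add: norm_mult mult.assoc)
    qed
  qed auto
  finally show "L2norm ?D
      \<le> 2 ^ k * pi powr s * norm z powr s * L2norm (freq_weight s v)" .
qed

section \<open>Norm bounds for \<open>D^r \<phi>\<close> in the two ranges of exponents\<close>

lemma AE_lborel_translate:
  fixes a :: "'a::euclidean_space"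
  assumes "AE x in lborel. P x"
  shows "AE x in lborel. P (x + a)"
proof -
  have "AE x in distr lborel borel ((+) a). P x" using assms by (subst lborel_distr_plus)
  then have "AE x in lborel. P (a + x)" using AE_distrD[of "(+) a" lborel borel P] by simp
  then show ?thesis by (simp add: add.commute)
qed

lemma sq_int_cong_AE:
  assumes f: "sq_int f" and [measurable]: "g \<in> borel_measurable borel" and eq: "AE x in lborel. f x = g x"
  shows "sq_int g" "L2norm g = L2norm f"
proof -
  note [measurable] = sq_int_measurable[OF f]
  have "AE x in lborel. (cmod (f x))\<^sup>2 = (cmod (g x))\<^sup>2" using eq by eventually_elim simp
  then show "sq_int g" "L2norm g = L2norm f"
    using f integrable_cong_AE[of "\<lambda>x. (cmod (f x))\<^sup>2" lborel "\<lambda>x. (cmod (g x))\<^sup>2"]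
      integral_cong_AE[of "\<lambda>x. (cmod (f x))\<^sup>2" lborel "\<lambda>x. (cmod (g x))\<^sup>2"]
    by (auto simp: sq_int_def L2norm_def)
qed

text \<open>\<open>Lpnorm\<close> is built on the Bochner integral, which is 0 for a function that
  is not integrable, so a bound on it alone would say little. The bound on the extended integral
  provides integrability as well.\<close>

lemma Lpnorm_le_nn:
  assumes [measurable]: "u \<in> borel_measurable borel" and p: "0 < p" and C: "0 \<le> C" and T: "0 \<le> T"
    and le: "(NNINT x. ennreal (cmod (u x) powr p)) \<le> ennreal (C * T powr p)"
  shows "integrable lborel (\<lambda>x. cmod (u x) powr p)" "Lpnorm p u \<le> C powr (1 / p) * T"
proof -
  show i: "integrable lborel (\<lambda>x. cmod (u x) powr p)"
    using le by (intro integrableI_nonneg) (auto simp: le_less_trans)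
  then have "(LBINT x. cmod (u x) powr p) \<le> C * T powr p"
    using le C by (simp add: nn_integral_eq_integral)
  then have "Lpnorm p u \<le> (C * T powr p) powr (1 / p)"
    unfolding Lpnorm_def using p by (intro powr_mono2) auto
  also have "\<dots> = C powr (1 / p) * T" using p T by (simp add: powr_mult powr_powr)
  finally show "Lpnorm p u \<le> C powr (1 / p) * T" .
qed

text \<open>\<phi> is radial at every point, but u is known only up to null sets. Uniqueness
  transfers the symmetry from \<phi> to \<psi> and back to u, with an exceptional set that may
  depend on Q.\<close>

lemma rotation_invariant_Dpow:
  fixes \<phi> :: "'a::euclidean_space \<Rightarrow> complex"
  assumes "radial \<phi>" and \<psi>: "fourier_L2 \<phi> \<psi>" and F: "fourier_L2 u (freq_weight r \<psi>)"
    and Q: "orthogonal_transformation Q"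
  shows "AE x in lborel. u (Q x) = u x"
proof -
  have n: "norm (Q x) = norm x" for x using Q by (simp add: orthogonal_transformation)
  have "\<phi> (Q x) = \<phi> x" for x using assms(1) n[of x] unfolding radial_def by blast
  then have "fourier_L2 \<phi> (\<lambda>\<xi>. \<psi> (Q \<xi>))" using fourier_L2_orthogonal[OF Q \<psi>] by simp
  then have "AE \<xi> in lborel. \<psi> (Q \<xi>) = \<psi> \<xi>" using fourier_L2_unique[OF _ \<psi>, of \<phi> "\<lambda>\<xi>. \<psi> (Q \<xi>)"] by simp
  then have "AE \<xi> in lborel. of_real (norm (Q \<xi>) powr r) * \<psi> (Q \<xi>) = of_real (norm \<xi> powr r) * \<psi> \<xi>"
    by eventually_elim (simp add: n)
  then show ?thesis using fourier_L2_unique[OF fourier_L2_orthogonal[OF Q F] F] by simp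
qed

text \<open>Sobolev embedding from L^2 to L^p costs d/2 - d/p derivatives beyond r, so a is the
  total order that interpolation between 0 and S must supply. At p = 2 the embedding is replaced by
  Plancherel.\<close>

lemma Dpow_high_exponent:
  fixes r S p :: real
  defines "d \<equiv> real DIM('a::euclidean_space)"
  defines "a \<equiv> r + (d / 2 - d / p)"
  assumes p: "2 \<le> p" and r: "0 \<le> r" and S: "0 < S" and aS: "a \<le> S"
  shows "\<exists>C\<ge>0. \<forall>(u::'a \<Rightarrow> complex) \<psi>. fourier_L2 u (freq_weight r \<psi>) \<and> sq_int \<psi>
      \<and> sq_int (freq_weight S \<psi>) \<and> 0 < L2norm \<psi> \<and> 0 < L2norm (freq_weight S \<psi>) \<longrightarrow>
      (NNINT x. ennreal (cmod (u x) powr p))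
       \<le> ennreal (C * (L2norm \<psi> * (L2norm \<psi> / L2norm (freq_weight S \<psi>)) powr - (a / S)) powr p)" (is "\<exists>C\<ge>0. \<forall>u \<psi>. _ u \<psi> \<longrightarrow> ?bound C u \<psi>")
proof -
  have d: "0 < d" by (simp add: d_def)
  have dp: "d / p \<le> d / 2" using p d by (intro divide_left_mono) auto
  then have a0: "0 \<le> a" using r by (simp add: a_def)
  \<comment> \<open>Keeping 2 < p as a premise of the estimate gives one constant for both cases; at
    p = 2 the estimate is vacuous and C0 = 0 is taken.\<close>
  obtain C0 where C0: "0 \<le> C0" and E: "\<And>(u::'a \<Rightarrow> complex) v. fourier_L2 u v \<Longrightarrow> sq_int (freq_weight (d / 2 - d / p) v) \<Longrightarrow> 2 < p \<Longrightarrow>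
     (NNINT x. ennreal (cmod (u x) powr p)) \<le> ennreal (C0 * L2norm (freq_weight (d / 2 - d / p) v) powr p)"
  proof (cases "2 < p")
    case True
    then show ?thesis using Sobolev_embedding[OF True, where 'a='a] that unfolding d_def by blast
  next
    case False
    then show ?thesis using that[of 0] by simp
  qed
  \<comment> \<open>The maximum with 1 covers p = 2, where the embedding constant is one.\<close>
  define C where "C = max C0 1 * sqrt 2 powr p"
  have C: "0 \<le> C" by (simp add: C_def)
  have "?bound C u \<psi>"
    if F: "fourier_L2 u (freq_weight r \<psi>)" and \<psi>: "sq_int \<psi>"
      and w: "sq_int (freq_weight S \<psi>)" and A: "0 < L2norm \<psi>" and B: "0 < L2norm (freq_weight S \<psi>)"
    for u \<psi> :: "'a \<Rightarrow> complex"
  proof -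
    let ?A = "L2norm \<psi>" and ?B = "L2norm (freq_weight S \<psi>)"
    let ?T = "?A * (?A / ?B) powr - (a / S)"
    have T: "0 \<le> ?T" using A by simp
    let ?n = "L2norm (freq_weight a \<psi>)"
    have La: "((?A / ?B) powr (1 / S)) powr - a = (?A / ?B) powr - (a / S)" by (simp add: powr_powr)
    note I = weighted_L2_interpolation[OF \<psi> w S a0 aS A B, unfolded La]
    have bound: "max C0 1 * ?n powr p \<le> C * ?T powr p"
    proof -
      have "?n powr p \<le> (sqrt 2 * ?T) powr p"
        using I(2) p by (intro powr_mono2) auto
      also have "\<dots> = sqrt 2 powr p * ?T powr p" by (rule powr_mult)
      finally have "max C0 1 * ?n powr p \<le> max C0 1 * (sqrt 2 powr p * ?T powr p)"
        by (intro mult_left_mono) auto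
      then show ?thesis by (simp only: C_def mult.assoc)
    qed
    show ?thesis
    proof (cases "p = 2")
      case True
      then have ar: "a = r" by (simp add: a_def)
      have "(NNINT x. ennreal (cmod (u x) powr p)) = ennreal ((L2norm u)\<^sup>2)"
        unfolding True nn_integral_square_cmod[OF fourier_L2_sq_int(1)[OF F], symmetric]
        by (intro nn_integral_cong) simp
      also have "L2norm u = ?n"
        unfolding ar by (rule fourier_L2_Plancherel[OF F, symmetric])
      also have "ennreal ((?n)\<^sup>2) \<le> ennreal (C * ?T powr p)"
      proof (rule ennreal_leI)
        have "(?n)\<^sup>2 = 1 * ?n powr p"
          using True by simp
        also have "\<dots> \<le> max C0 1 * ?n powr p"
          by (intro mult_right_mono) auto
        finally show "(?n)\<^sup>2 \<le> C * ?T powr p" using bound by linarith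
      qed
      finally show ?thesis .
    next
      case False
      then have p2: "2 < p" using p by simp
      have eq: "(\<lambda>\<xi>. of_real (norm \<xi> powr (d / 2 - d / p)) * (of_real (norm \<xi> powr r) * \<psi> \<xi>)) = (freq_weight a \<psi>)"
      proof
        fix \<xi> :: 'a
        have "norm \<xi> powr a = norm \<xi> powr (d / 2 - d / p) * norm \<xi> powr r"
          unfolding powr_add[symmetric] by (simp add: a_def add.commute)
        then show "of_real (norm \<xi> powr (d / 2 - d / p)) * (of_real (norm \<xi> powr r) * \<psi> \<xi>) = of_real (norm \<xi> powr a) * \<psi> \<xi>" by simp
      qed
      have "(NNINT x. ennreal (cmod (u x) powr p)) \<le> ennreal (C0 * ?n powr p)"
        using E[OF F _ p2] I(1) unfolding eq by blast
      also have "\<dots> \<le> ennreal (C * ?T powr p)"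
      proof (rule ennreal_leI)
        have "C0 * ?n powr p \<le> max C0 1 * ?n powr p"
          by (intro mult_right_mono) auto
        then show "C0 * ?n powr p \<le> C * ?T powr p" using bound by linarith
      qed
      finally show ?thesis .
    qed
  qed
  then show ?thesis using C by blast
qed

text \<open>The exponent e is dictated by scaling: the L^p norm of D^r \<phi> is measured as L^e
  times the norm of D^S \<phi>.\<close>

lemma Dpow_low_exponent:
  fixes r S p :: real
  defines "d \<equiv> real CARD('n)"
  defines "s \<equiv> S - r" and "m \<equiv> d / 2 - r"
  defines "\<kappa> \<equiv> (2 * r - 1) / (2 * (S - r) + 1)"
  defines "e \<equiv> s + d * (1 / p - 1 / 2)"
  assumes r: "1 / 2 < r" "r < d / 2" and s: "0 < s" and p: "1 < p" "p < 2"
    and exponent: "m * (2 - p) < 2 * s * \<kappa> * (p - 1)"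
  shows "\<exists>C\<ge>0. \<forall>(\<phi>::real^'n \<Rightarrow> complex) u \<psi>. radial \<phi> \<and> fourier_L2 \<phi> \<psi> \<and> fourier_L2 u (freq_weight r \<psi>)
      \<and> sq_int (freq_weight S \<psi>) \<and> 0 < L2norm \<psi> \<and> 0 < L2norm (freq_weight S \<psi>)
      \<and> (AE x in lborel. Im (u x) = 0 \<and> Re (u x) \<ge> 0) \<longrightarrow>
      (NNINT x. ennreal (cmod (u x) powr p))
       \<le> ennreal (C * (L2norm (freq_weight S \<psi>)
            * (L2norm \<psi> / L2norm (freq_weight S \<psi>)) powr (e / S)) powr p)" (is "\<exists>C\<ge>0. \<forall>\<phi> u \<psi>. _ \<phi> u \<psi> \<longrightarrow> ?bound C u \<psi>")
proof -
  \<comment> \<open>The order of the difference has to be at least s for the multiplier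
    bound.\<close>
  define k where "k = nat \<lceil>s\<rceil> + 1"
  have k: "1 \<le> k" "s \<le> real k" unfolding k_def by linarith+
  define c1 where "c1 = exp pi * sqrt (r powr r)"
  have c1: "0 < c1" using r by (simp add: c1_def)
  define c3 where "c3 = 2 ^ k * pi powr s"
  have c3: "0 < c3" by (simp add: c3_def)
  have S: "0 < S" using r s by (simp add: s_def)
  obtain C where C: "0 \<le> C" and main: "\<And>(U::real^'n \<Rightarrow> real) B L. radial_bounds r S c1 c3 k U B L
     \<Longrightarrow> (NNINT x. ennreal (U x powr p))
        \<le> ennreal (C * ((B * L powr (m + S)) powr (2 - p) * ((B * L powr s)\<^sup>2) powr (p - 1)))"
    using radial_low_exponent[where 'n='n, of r S p c1 c3 k] r s p exponent c1 c3 k(1)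
    unfolding d_def s_def m_def \<kappa>_def by blast
  have "?bound C u \<psi>"
    if rad: "radial \<phi>" and \<psi>: "fourier_L2 \<phi> \<psi>" and F: "fourier_L2 u (freq_weight r \<psi>)"
      and w: "sq_int (freq_weight S \<psi>)" and A: "0 < L2norm \<psi>" and B: "0 < L2norm (freq_weight S \<psi>)"
      and pos: "AE x in lborel. Im (u x) = 0 \<and> Re (u x) \<ge> 0"
    for \<phi> u \<psi> :: "real^'n \<Rightarrow> complex"
  proof -
    let ?A = "L2norm \<psi>" and ?B = "L2norm (freq_weight S \<psi>)"
    define L where "L = (?A / ?B) powr (1 / S)"
    \<comment> \<open>The modulus is a representative that is nonnegative everywhere and agrees with
      u almost everywhere.\<close>
    define U where "U x = cmod (u x)" for x
    have L: "0 < L" using A B by (simp add: L_def)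
    have LS: "?B * L powr S = ?A" using A B S by (simp add: L_def powr_powr)
    note sq\<psi> = fourier_L2_sq_int(2)[OF \<psi>] and squ = fourier_L2_sq_int(1)[OF F]
    note [measurable] = sq_int_measurable[OF squ]
    have Um: "U \<in> borel_measurable borel" unfolding U_def by measurable
    have U0: "0 \<le> U x" for x by (simp add: U_def)
    have uU: "AE x in lborel. u x = of_real (U x)"
      using pos by eventually_elim (auto simp: U_def complex_eq_iff cmod_def)
    have rot: "AE x in lborel. U (Q x) = U x" if "orthogonal_transformation Q" for Q
      using rotation_invariant_Dpow[OF rad \<psi> F that] by eventually_elim (simp add: U_def)
    have M: "mass U (ball 0 R) \<le> ennreal (c1 * (?B * L powr S) * R powr m)" if "0 < R" for R
      using nonnegative_ball_mass_bound[OF F sq\<psi> Um U0 uU _ that] r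
      unfolding LS c1_def m_def d_def by simp
    have eqs: "(\<lambda>\<xi>. of_real (norm \<xi> powr s) * (of_real (norm \<xi> powr r) * \<psi> \<xi>)) = (freq_weight S \<psi>)"
    proof
      fix \<xi> :: "real^'n"
      have "norm \<xi> powr S = norm \<xi> powr s * norm \<xi> powr r" unfolding powr_add[symmetric] by (simp add: s_def)
      then show "of_real (norm \<xi> powr s) * (of_real (norm \<xi> powr r) * \<psi> \<xi>) = of_real (norm \<xi> powr S) * \<psi> \<xi>" by simp
    qed
    have diff: "(NNINT x. ennreal ((fdiff k U z x)\<^sup>2))
          \<le> ennreal ((c3 * ?B * norm z powr s)\<^sup>2)" for z
    proof -
      let ?D = "\<lambda>x. \<Sum>j\<le>k. of_real ((-1) ^ j * real (k choose j)) * u (x + real j *\<^sub>R z)"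
      have sqD: "sq_int ?D" and nD: "L2norm ?D \<le> 2 ^ k * pi powr s * norm z powr s * ?B"
        using finite_difference_L2_bound[OF F _ _ k(2) k(1), of z] w s unfolding eqs by auto
      \<comment> \<open>Only finitely many translates occur, so their exceptional null sets can be
        united.\<close>
      have "AE x in lborel. \<forall>j\<in>{..k}. u (x + real j *\<^sub>R z) = of_real (U (x + real j *\<^sub>R z))"
        by (subst AE_ball_countable) (auto intro: AE_lborel_translate[OF uU] countable_finite)
      then have "AE x in lborel. ((fdiff k U z x)\<^sup>2) = (cmod (?D x))\<^sup>2"
      proof eventually_elim
        case (elim x)
        then have "?D x = of_real (fdiff k U z x)"
          unfolding of_real_sum by (intro sum.cong) auto
        then show ?case by (simp only: norm_of_real power2_abs)
      qed
      then have "(NNINT x. ennreal ((fdiff k U z x)\<^sup>2)) = (NNINT x. ennreal ((cmod (?D x))\<^sup>2))"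
        by (intro nn_integral_cong_AE) (auto elim!: eventually_mono)
      also have "\<dots> = ennreal ((L2norm ?D)\<^sup>2)" by (rule nn_integral_square_cmod[OF sqD])
      also have "\<dots> \<le> ennreal ((c3 * ?B * norm z powr s)\<^sup>2)"
        using nD by (intro ennreal_leI power_mono) (auto simp: c3_def mult_ac)
      finally show ?thesis .
    qed
    have L2: "(NNINT x. ennreal ((U x)\<^sup>2)) \<le> ennreal (2 * (?B * L powr s)\<^sup>2)"
    proof -
      have rS: "0 \<le> r" "r \<le> S" using r s by (auto simp: s_def)
      have "(NNINT x. ennreal ((U x)\<^sup>2)) = ennreal ((L2norm u)\<^sup>2)"
        unfolding U_def by (rule nn_integral_square_cmod[OF squ])
      also have "L2norm u = L2norm (freq_weight r \<psi>)" by (rule fourier_L2_Plancherel[OF F, symmetric])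
      also have "ennreal ((L2norm (freq_weight r \<psi>))\<^sup>2) \<le> ennreal ((sqrt 2 * (?A * L powr - r))\<^sup>2)"
        using weighted_L2_interpolation(2)[OF sq\<psi> w S rS A B] by (intro ennreal_leI power_mono) (auto simp: L_def)
      also have "?A * L powr - r = ?B * L powr s"
        unfolding LS[symmetric] s_def by (simp add: powr_diff powr_minus divide_inverse)
      finally show ?thesis by (simp add: power_mult_distrib)
    qed
    have "(NNINT x. ennreal (U x powr p)) \<le> ennreal (C * ((?B * L powr (m + S)) powr (2 - p) * ((?B * L powr s)\<^sup>2) powr (p - 1)))"
    proof (rule main)
      show "radial_bounds r S c1 c3 k U ?B L"
        unfolding radial_bounds_def s_def[symmetric] d_def[symmetric] m_def[symmetric]
        by (intro conjI allI impI Um U0 B L rot M diff L2)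
    qed
    also have "(?B * L powr (m + S)) powr (2 - p) * ((?B * L powr s)\<^sup>2) powr (p - 1) = (?B * (?A / ?B) powr (e / S)) powr p"
    proof -
      have "((?B * L powr s)\<^sup>2) powr (p - 1) = ((?B * L powr s) powr 2) powr (p - 1)" using B by simp
      also have "\<dots> = (?B * L powr s) powr (2 * (p - 1))" by (simp only: powr_powr)
      finally have "(?B * L powr (m + S)) powr (2 - p) * ((?B * L powr s)\<^sup>2) powr (p - 1)
         = (?B powr (2 - p) * ?B powr (2 * (p - 1))) * (L powr ((m + S) * (2 - p)) * L powr (s * (2 * (p - 1))))"
        by (simp only: powr_mult powr_powr mult_ac)
      \<comment> \<open>Since m + S = d/2 + s, the powers of L add up to s p + d (1 - p/2), which is
        e p.\<close>
      also have "\<dots> = ?B powr p * L powr (e * p)"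
      proof -
        have 1: "(2 - p) + 2 * (p - 1) = p" by simp
        have "(m + S) * (2 - p) + s * (2 * (p - 1)) = s * p + d * (1 - p / 2)"
          by (simp add: m_def s_def field_simps)
        also have "\<dots> = e * p" using p by (simp add: e_def field_simps)
        finally show ?thesis unfolding powr_add[symmetric] 1 by simp
      qed
      also have "\<dots> = (?B * L powr e) powr p" by (simp add: powr_mult powr_powr)
      also have "L powr e = (?A / ?B) powr (e / S)" by (simp add: L_def powr_powr)
      finally show ?thesis .
    qed
    finally show ?thesis by (simp only: U_def)
  qed
  then show ?thesis using C by blast
qed

section \<open>The threshold exponent, the two ranges and the degenerate cases\<close>

theorem theorem1p1:
  fixes r S :: real
  defines "d \<equiv> real CARD('n::finite)"
  defines "p0 \<equiv> (d - 2 * r + 2 * (S - r) * (d - 1)) /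
                 (- ((S - r) - 1 / 2) * (d - 2 * r) + 2 * (S - r) * (d - 1))"
  assumes "CARD('n) \<ge> 2"
    and "1 / 2 < r" and "r < d / 2" and "r < S - 1 / 2"
  shows "p0 < 2 \<and>
    (\<forall>p::real. p0 < p \<and> (S - r < d / 2 \<longrightarrow> p \<le> 2 * d / (d - 2 * (S - r))) \<longrightarrow>
      (\<exists>C::real. \<forall>(\<phi>::real^'n \<Rightarrow> complex) u w.
         in_H_rad_plus S r \<phi> \<and> is_Dpow r \<phi> u \<and> is_Dpow S \<phi> w \<longrightarrow>
         integrable lborel (\<lambda>x. cmod (u x) powr p) \<and>
         Lpnorm p u \<le> C * L2norm \<phi> powr (1 - (r - d * (1 / p - 1 / 2)) / S)
                          * L2norm w powr ((r - d * (1 / p - 1 / 2)) / S)))"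
proof -
  have d2: "2 \<le> d" using \<open>CARD('n) \<ge> 2\<close> by (simp add: d_def)
  note r = \<open>1 / 2 < r\<close> \<open>r < d / 2\<close>
  have s: "1 / 2 < S - r" using \<open>r < S - 1 / 2\<close> by simp
  have S: "0 < S" using r s by linarith
  \<comment> \<open>In these variables p0 = (a + 2Q) / (2Q - P + a/2). Then p0 < 2 amounts to P < Q,
    which is r > 1/2, and p0 > 1 amounts to P + a/2 > 0.\<close>
  define a where "a = d - 2 * r"
  define P where "P = (S - r) * a"
  define Q where "Q = (S - r) * (d - 1)"
  have a: "0 < a" "a < d - 1" using r by (auto simp: a_def)
  have P0: "0 < P" using s a by (simp add: P_def)
  have PQ: "P < Q" unfolding P_def Q_def using s a by (intro mult_strict_left_mono) auto
  have num: "d - 2 * r + 2 * (S - r) * (d - 1) = a + 2 * Q" by (simp add: a_def Q_def)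
  have den: "- ((S - r) - 1 / 2) * (d - 2 * r) + 2 * (S - r) * (d - 1) = 2 * Q - P + a / 2"
    by (simp add: a_def[symmetric] Q_def P_def left_diff_distrib)
  have den0: "0 < 2 * Q - P + a / 2" using a P0 PQ by linarith
  have p0: "p0 = (a + 2 * Q) / (2 * Q - P + a / 2)" unfolding p0_def num den ..
  have p02: "p0 < 2" unfolding p0 using den0 PQ by (simp add: divide_less_eq)
  have p01: "1 < p0" unfolding p0 using den0 P0 a by (simp add: less_divide_eq)
  show ?thesis
  proof (intro conjI p02 allI impI)
    fix p :: real
    assume hp: "p0 < p \<and> (S - r < d / 2 \<longrightarrow> p \<le> 2 * d / (d - 2 * (S - r)))"
    have p1: "1 < p" using hp p01 by linarith
    define \<theta> where "\<theta> = (r - d * (1 / p - 1 / 2)) / S"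
    have "\<exists>C\<ge>0. \<forall>(\<phi>::real^'n \<Rightarrow> complex) u \<psi>. radial \<phi> \<and> fourier_L2 \<phi> \<psi> \<and> fourier_L2 u (freq_weight r \<psi>)
      \<and> sq_int (freq_weight S \<psi>) \<and> 0 < L2norm \<psi> \<and> 0 < L2norm (freq_weight S \<psi>)
      \<and> (AE x in lborel. Im (u x) = 0 \<and> Re (u x) \<ge> 0) \<longrightarrow>
      (NNINT x. ennreal (cmod (u x) powr p))
       \<le> ennreal (C * (L2norm \<psi> powr (1 - \<theta>) * L2norm (freq_weight S \<psi>) powr \<theta>) powr p)" (is "\<exists>C\<ge>0. ?bound C")
    proof (cases "p < 2")
      case True
      \<comment> \<open>Clearing the denominator in p0 < p and regrouping gives (P + a/2)(2 - p) < 2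
        (Q - P)(p - 1). With Q - P = s (2r - 1), where s = S - r, division by 2s + 1 yields the
        summability condition.\<close>
      have ex: "(d / 2 - r) * (2 - p) < 2 * (S - r) * ((2 * r - 1) / (2 * (S - r) + 1)) * (p - 1)"
      proof -
        have s1: "0 < 2 * (S - r) + 1" using s by simp
        have "a + 2 * Q < p * (2 * Q - P + a / 2)"
          using hp den0 unfolding p0 by (simp add: divide_less_eq mult.commute)
        then have "(P + a / 2) * (2 - p) < (2 * Q - 2 * P) * (p - 1)" by (simp add: algebra_simps diff_divide_distrib)
        moreover have "(d / 2 - r) * (2 - p) * (2 * (S - r) + 1) = (P + a / 2) * (2 - p)"
          by (simp add: P_def a_def field_simps)
        moreover have "2 * (S - r) * (2 * r - 1) * (p - 1) = (2 * Q - 2 * P) * (p - 1)"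
          by (simp add: P_def Q_def a_def algebra_simps)
        ultimately have "(d / 2 - r) * (2 - p) * (2 * (S - r) + 1) < 2 * (S - r) * (2 * r - 1) * (p - 1)" by (simp only:)
        then have "(d / 2 - r) * (2 - p) < 2 * (S - r) * (2 * r - 1) * (p - 1) / (2 * (S - r) + 1)"
          using s1 by (simp add: pos_less_divide_eq)
        then show ?thesis by (simp add: mult_ac)
      qed
      have s0: "0 < S - r" using s by simp
      have e: "(S - r + d * (1 / p - 1 / 2)) / S = 1 - \<theta>" using S by (simp add: \<theta>_def field_simps)
      have "B * (A / B) powr (1 - \<theta>) = A powr (1 - \<theta>) * B powr \<theta>" if "0 < A" "0 < B" for A B :: real
        using that by (simp add: powr_divide powr_diff)
      then show ?thesis
        using Dpow_low_exponent[where 'n='n, of r S p] r s0 p1 True ex e unfolding d_def by simp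
    next
      case False
      then have p2: "2 \<le> p" by simp
      \<comment> \<open>The upper limit on p is exactly the condition that the embedding uses no
        more than S derivatives.\<close>
      have aS: "r + (d / 2 - d / p) \<le> S"
      proof (cases "S - r < d / 2")
        case True
        then have "p \<le> 2 * d / (d - 2 * (S - r))" using hp by blast
        then have "p * (d - 2 * (S - r)) \<le> 2 * d" using True by (simp add: pos_le_divide_eq)
        then have "(d - 2 * (S - r)) / 2 \<le> d / p" using p2 by (simp add: field_simps)
        then show ?thesis by simp
      next
        case False
        moreover have "0 \<le> d / p" using d2 p2 by simp
        ultimately show ?thesis by linarith
      qed
      have e: "- ((r + (d / 2 - d / p)) / S) = - \<theta>" by (simp add: \<theta>_def field_simps)
      have "A * (A / B) powr - \<theta> = A powr (1 - \<theta>) * B powr \<theta>" if "0 < A" "0 < B" for A B :: real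
        using that by (simp add: powr_divide powr_diff powr_minus divide_simps)
      then show ?thesis
        using Dpow_high_exponent[where 'a="real^'n", of p r S] p2 r S aS e unfolding d_def
        by simp (blast intro: fourier_L2_sq_int(2))
    qed
    then obtain C where C: "0 \<le> C" and main: "?bound C" by blast
    show "\<exists>C::real. \<forall>(\<phi>::real^'n \<Rightarrow> complex) u w.
         in_H_rad_plus S r \<phi> \<and> is_Dpow r \<phi> u \<and> is_Dpow S \<phi> w \<longrightarrow>
         integrable lborel (\<lambda>x. cmod (u x) powr p) \<and>
         Lpnorm p u \<le> C * L2norm \<phi> powr (1 - (r - d * (1 / p - 1 / 2)) / S)
                          * L2norm w powr ((r - d * (1 / p - 1 / 2)) / S)"
    proof (intro exI[of _ "C powr (1 / p)"] allI impI)
      fix \<phi> u w :: "real^'n \<Rightarrow> complex"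
      assume h: "in_H_rad_plus S r \<phi> \<and> is_Dpow r \<phi> u \<and> is_Dpow S \<phi> w"
      then obtain \<psi> \<psi>' where F: "fourier_L2 \<phi> \<psi>" "fourier_L2 u (freq_weight r \<psi>)"
        and F': "fourier_L2 \<phi> \<psi>'" "fourier_L2 w (freq_weight S \<psi>')"
        by (auto simp: is_Dpow_def)
      have rad: "radial \<phi>" and pos: "AE x in lborel. Im (u x) = 0 \<and> Re (u x) \<ge> 0"
        using h by (auto simp: in_H_rad_plus_def)
      note [measurable] = sq_int_measurable[OF fourier_L2_sq_int(2)[OF F(1)]] sq_int_measurable[OF fourier_L2_sq_int(1)[OF F(2)]]
      \<comment> \<open>u and w come with transforms of \<phi> chosen independently; uniqueness
        allows \<psi> to be used for both.\<close>
      have "AE \<xi> in lborel. \<psi>' \<xi> = \<psi> \<xi>" using fourier_L2_unique[OF F'(1) F(1)] by simp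
      then have "AE \<xi> in lborel. of_real (norm \<xi> powr S) * \<psi>' \<xi> = of_real (norm \<xi> powr S) * \<psi> \<xi>" by eventually_elim simp
      from sq_int_cong_AE[OF fourier_L2_sq_int(2)[OF F'(2)] _ this]
      have w: "sq_int (freq_weight S \<psi>)" and B: "L2norm (freq_weight S \<psi>) = L2norm w"
        using fourier_L2_Plancherel[OF F'(2)] by auto
      have A: "L2norm \<psi> = L2norm \<phi>" by (rule fourier_L2_Plancherel[OF F(1)])
      let ?T = "L2norm \<phi> powr (1 - \<theta>) * L2norm w powr \<theta>"
      have "(NNINT x. ennreal (cmod (u x) powr p)) \<le> ennreal (C * ?T powr p)"
      \<comment> \<open>If either norm vanishes there is no length L. Then \<psi> vanishes almost
        everywhere, the origin being a null set in the case of the weighted norm, and so does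
        u.\<close>
      proof (cases "0 < L2norm \<psi> \<and> 0 < L2norm (freq_weight S \<psi>)")
        case True
        then show ?thesis using main[rule_format, of \<phi> \<psi> u] rad F w pos unfolding A B by blast
      next
        case False
        then have "L2norm \<psi> = 0 \<or> L2norm (freq_weight S \<psi>) = 0"
          using L2norm_nonneg[of \<psi>] L2norm_nonneg[of "\<lambda>\<xi>. of_real (norm \<xi> powr S) * \<psi> \<xi>"] by linarith
        moreover have "AE \<xi> in lborel. \<xi> \<noteq> (0::real^'n)" using AE_lborel_singleton by auto
        ultimately have "AE \<xi> in lborel. of_real (norm \<xi> powr r) * \<psi> \<xi> = 0"
        proof (elim disjE)
          assume "L2norm \<psi> = 0"
          from L2norm_eq_0[OF fourier_L2_sq_int(2)[OF F(1)] this] show ?thesis by eventually_elim simp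
        next
          assume 0: "L2norm (freq_weight S \<psi>) = 0" and nz: "AE \<xi> in lborel. \<xi> \<noteq> (0::real^'n)"
          from L2norm_eq_0[OF w 0] nz show ?thesis by eventually_elim auto
        qed
        then have "AE x in lborel. u x = 0" using fourier_L2_unique[OF F(2) fourier_L2_zero] by simp
        then have "(NNINT x. ennreal (cmod (u x) powr p)) = (NNINT x::real^'n. 0)"
          by (intro nn_integral_cong_AE) (auto elim!: eventually_mono)
        then show ?thesis by simp
      qed
      from Lpnorm_le_nn[OF _ _ C _ this] p1
      show "integrable lborel (\<lambda>x. cmod (u x) powr p) \<and>
         Lpnorm p u \<le> C powr (1 / p) * L2norm \<phi> powr (1 - (r - d * (1 / p - 1 / 2)) / S)
                          * L2norm w powr ((r - d * (1 / p - 1 / 2)) / S)"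
        unfolding \<theta>_def[symmetric] by (simp add: mult.assoc)
    qed
  qed
qed

end
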